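(* Let $n$ be a positive integer, $Y$ a Banach space, $\kappa\in\mathbf R$, $k$ an integer, and $\nu$ a continuous seminorm on $\mathscr D_{\mathbf B(0,1)}(\mathbf R^n,Y)$. Let $Y_k$ be the vector space of polynomial functions $\mathbf R^n\to Y'$ of degree at most $k$ (with $Y_k=\{0\}$ if $k<0$). For $(a,T,P)\in\mathbf R^n\times\mathscr D'(\mathbf R^n,Y)\times Y_k$ and $0<r<\infty$ write $$\Sigma(a,T,P,r)=\sup\{(T-P)^{a,r}(\theta):\theta\in\mathscr D_{\mathbf B(0,1)}(\mathbf R^n,Y),\ \nu(\theta)\le1\}.$$ Then: (1) The set $E$ of all $(a,T,P)\in\mathbf R^n\times\mathscr E'(\mathbf R^n,Y)\times Y_k$ satisfying $\limsup_{r\to0^+}r^{\kappa}\,\Sigma(a,T,P,r)<+\infty$ is a countable union of closed subsets of $\mathbf R^n\times\mathscr E'(\mathbf R^n,Y)_b\times Y_k$. Moreover, if $Y$ is finite dimensional, then $E$ is a countable union of compact subsets of $\mathbf R^n\times\mathscr E'(\mathbf R^n,Y)_b\times Y_k$. (2) The set $E_0$ of all $(a,T,P)\in\mathbf R^n\times\mathscr E'(\mathbf R^n,Y)\times Y_k$ satisfying $\lim_{r\to0^+}r^{\kappa}\,\Sigma(a,T,P,r)=0$ is a Borel subset of $\mathbf R^n\times\mathscr E'(\mathbf R^n,Y)_b\times Y_k$. (3) The set $D$ of all $(a,T,P)\in\mathbf R^n\times\mathscr D'(\mathbf R^n,Y)\times Y_k$ satisfying $\limsup_{r\to0^+}r^{\kappa}\,\Sigma(a,T,P,r)<+\infty$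 is a countable union of closed subsets of $\mathbf R^n\times\mathscr D'(\mathbf R^n,Y)_b\times Y_k$. (4) The set $D_0$ of all $(a,T,P)\in\mathbf R^n\times\mathscr D'(\mathbf R^n,Y)\times Y_k$ satisfying $\lim_{r\to0^+}r^{\kappa}\,\Sigma(a,T,P,r)=0$ is a Borel subset of $\mathbf R^n\times\mathscr D'(\mathbf R^n,Y)_b\times Y_k$.
   Context: All vector spaces are real. $Y'$ is the topological dual of $Y$. $\mathscr E(\mathbf R^n,Y)$ is the space of smooth functions $\mathbf R^n\to Y$ with the complete metrizable locally convex topology given by the seminorms $\theta\mapsto\sup_{x\in K}\|D^j\theta(x)\|$ for $j=0,1,2,\dots$ and $K\subset\mathbf R^n$ compact. For compact $K$, $\mathscr D_K(\mathbf R^n,Y)$ is the subspace of functions with support in $K$ (with the induced topology), and $\mathscr D(\mathbf R^n,Y)=\bigcup_K\mathscr D_K(\mathbf R^n,Y)$ with the strict inductive limit locally convex topology. $\mathbf B(a,r)$ is the closed ball. $\mathscr D'(\mathbf R^n,Y)$ is the space of distributions, i.e. linear $T:\mathscr D(\mathbf R^n,Y)\to\mathbf R$ continuous on each $\mathscr D_K(\mathbf R^n,Y)$. $\mathscr E'(\mathbf R^n,Y)$ is the space of continuous linear functionals on $\mathscr E(\mathbf R^n,Y)$, regarded as distributions by restriction to $\mathscr D(\mathbf R^n,Y)$. The subscript $b$ means the dual space carries the topology of uniform convergence on bounded subsets of $\mathscr D(\mathbf R^n,Y)$, respectively $\mathscr E(\mathbf R^n,Y)$. A polynomial function $P:\mathbf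 R^n\to Y'$ is a finite sum of maps $x\mapsto\psi_m(x,\dots,x)$ with $\psi_m$ symmetric $m$-linear with values in $Y'$; it is identified with the distribution $P(\theta)=\int\langle\theta(x),P(x)\rangle\,d\mathscr L^n_x$, where $\mathscr L^n$ is Lebesgue measure. $Y_k$ has its natural normed topology: $P\in Y_k$ is determined by the coefficients $D^mP(0)$, $0\le m\le k$, and $Y_k$ is normed e.g. by $\sum_{m=0}^k\|D^mP(0)\|$. For a distribution $T$, $a\in\mathbf R^n$ and $0<r<\infty$, $T^{a,r}(\theta)=r^{-n}T_x(\theta(r^{-1}(x-a)))$, where $T_x(\cdot)$ means $T$ applied to the indicated function of $x$. *)

theory Defs
  imports "HOL-Analysis.Analysis" "HOL-Library.Function_Algebras"
begin

text \<open>Together with \<^theory>\<open>HOL-Library.Function_Algebras\<close> this turns functions into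
  a real vector space under the pointwise operations, so that spaces of test functions and
  of functionals are linear subspaces of a type.\<close>

instantiation "fun" :: (type, real_vector) real_vector
begin

definition scaleR_fun :: "real \<Rightarrow> ('a \<Rightarrow> 'b) \<Rightarrow> 'a \<Rightarrow> 'b"
  where "scaleR_fun c f = (\<lambda>x. c *\<^sub>R f x)"

instance
  by standard (auto simp: scaleR_fun_def plus_fun_def fun_eq_iff algebra_simps)

end

definition seminorm_on :: "'v::real_vector set \<Rightarrow> ('v \<Rightarrow> real) \<Rightarrow> bool"
  where "seminorm_on V p \<longleftrightarrow>
    (\<forall>x\<in>V. \<forall>y\<in>V. p (x + y) \<le> p x + p y) \<and> (\<forall>c. \<forall>x\<in>V. p (c *\<^sub>R x) = \<bar>c\<bar> * p x)"

definition linear_functional_on :: "'v::real_vector set \<Rightarrow> ('v \<Rightarrow> real) \<Rightarrow> bool"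
  where "linear_functional_on V T \<longleftrightarrow>
    (\<forall>x\<in>V. \<forall>y\<in>V. T (x + y) = T x + T y) \<and> (\<forall>c. \<forall>x\<in>V. T (c *\<^sub>R x) = c * T x)"

definition seminorm_topology :: "'v::real_vector set \<Rightarrow> ('v \<Rightarrow> real) set \<Rightarrow> 'v topology"
  where "seminorm_topology V \<P> = topology (\<lambda>U. U \<subseteq> V \<and>
    (\<forall>x\<in>U. \<exists>F e. finite F \<and> F \<subseteq> \<P> \<and> e > 0 \<and> {y \<in> V. \<forall>p\<in>F. p (y - x) < e} \<subseteq> U))"

lemma openin_seminorm_topology:
  "openin (seminorm_topology V \<P>) U \<longleftrightarrow> U \<subseteq> V \<and>
    (\<forall>x\<in>U. \<exists>F e. finite F \<and> F \<subseteq> \<P> \<and> e > 0 \<and> {y \<in> V. \<forall>p\<in>F. p (y - x) < e} \<subseteq> U)"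
proof -
  let ?N = "\<lambda>U x. \<exists>F e. finite F \<and> F \<subseteq> \<P> \<and> e > 0 \<and> {y \<in> V. \<forall>p\<in>F. p (y - x) < e} \<subseteq> U"
  have int: "?N (S \<inter> T) x" if S: "?N S x" and T: "?N T x" for S T x
  proof -
    obtain F e where F: "finite F" "F \<subseteq> \<P>" "e > 0" "{y \<in> V. \<forall>p\<in>F. p (y - x) < e} \<subseteq> S"
      using S by blast
    obtain G d where G: "finite G" "G \<subseteq> \<P>" "d > 0" "{y \<in> V. \<forall>p\<in>G. p (y - x) < d} \<subseteq> T"
      using T by blast
    have "{y \<in> V. \<forall>p\<in>F \<union> G. p (y - x) < min e d} \<subseteq> S \<inter> T"
      using F(4) G(4) by auto
    then show ?thesis
      using F G by (intro exI[of _ "F \<union> G"] exI[of _ "min e d"]) auto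
  qed
  have mono: "?N T x" if "?N S x" "S \<subseteq> T" for x S T
    using that by (meson order_trans)
  have "istopology (\<lambda>U. U \<subseteq> V \<and> (\<forall>x\<in>U. ?N U x))"
    unfolding istopology_def
  proof (intro conjI allI impI)
    fix S T assume "S \<subseteq> V \<and> (\<forall>x\<in>S. ?N S x)" "T \<subseteq> V \<and> (\<forall>x\<in>T. ?N T x)"
    then show "S \<inter> T \<subseteq> V" "\<forall>x\<in>S \<inter> T. ?N (S \<inter> T) x"
      using int by (fast, simp)
  next
    fix \<K> assume K: "\<forall>U\<in>\<K>. U \<subseteq> V \<and> (\<forall>x\<in>U. ?N U x)"
    then show "\<Union>\<K> \<subseteq> V" by blast
    show "\<forall>x\<in>\<Union>\<K>. ?N (\<Union>\<K>) x"
    proof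
      fix x assume "x \<in> \<Union>\<K>"
      then obtain U where U: "U \<in> \<K>" "x \<in> U" by blast
      then have "?N U x" using K by simp
      then show "?N (\<Union>\<K>) x" by (rule mono) (use U in blast)
    qed
  qed
  then show ?thesis
    unfolding seminorm_topology_def by (simp add: topology_inverse')
qed

lemma topspace_seminorm_topology [simp]: "topspace (seminorm_topology V \<P>) = V"
proof -
  have "\<exists>F e. finite F \<and> F \<subseteq> \<P> \<and> e > 0 \<and> {y \<in> V. \<forall>p\<in>F. p (y - x) < e} \<subseteq> V" for x
    by (rule exI[of _ "{}"], rule exI[of _ 1]) simp
  then have "openin (seminorm_topology V \<P>) V"
    unfolding openin_seminorm_topology by blast
  then show ?thesis
    by (meson openin_seminorm_topology openin_subset openin_topspace subset_antisym)
qed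

text \<open>The locally convex inductive limit topology on \<open>V\<close> of a family of topologies on linear
  subspaces: a base of neighbourhoods of zero is formed by the convex balanced sets whose traces
  on all the subspaces are open.\<close>

definition lc_inductive_limit :: "'v::real_vector set \<Rightarrow> 'v topology set \<Rightarrow> 'v topology"
  where "lc_inductive_limit V \<X> = topology (\<lambda>U. U \<subseteq> V \<and>
    (\<forall>x\<in>U. \<exists>W. W \<subseteq> V \<and> 0 \<in> W \<and> convex W \<and> (\<forall>c. \<bar>c\<bar> \<le> 1 \<longrightarrow> (*\<^sub>R) c ` W \<subseteq> W) \<and>
      (\<forall>X\<in>\<X>. openin X (W \<inter> topspace X)) \<and> (+) x ` W \<subseteq> U))"

lemma openin_lc_inductive_limit:
  "openin (lc_inductive_limit V \<X>) U \<longleftrightarrow> U \<subseteq> V \<and>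
    (\<forall>x\<in>U. \<exists>W. W \<subseteq> V \<and> 0 \<in> W \<and> convex W \<and> (\<forall>c. \<bar>c\<bar> \<le> 1 \<longrightarrow> (*\<^sub>R) c ` W \<subseteq> W) \<and>
      (\<forall>X\<in>\<X>. openin X (W \<inter> topspace X)) \<and> (+) x ` W \<subseteq> U)"
proof -
  let ?B = "\<lambda>W. W \<subseteq> V \<and> 0 \<in> W \<and> convex W \<and> (\<forall>c. \<bar>c\<bar> \<le> 1 \<longrightarrow> (*\<^sub>R) c ` W \<subseteq> W) \<and>
      (\<forall>X\<in>\<X>. openin X (W \<inter> topspace X))"
  have B: "?B (W \<inter> W')" if "?B W" "?B W'" for W W'
  proof -
    have "openin X (W \<inter> W' \<inter> topspace X)" if "X \<in> \<X>" for X
    proof -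
      have "openin X ((W \<inter> topspace X) \<inter> (W' \<inter> topspace X))"
        using \<open>?B W\<close> \<open>?B W'\<close> that by blast
      then show ?thesis by (simp add: Int_ac)
    qed
    moreover have "(*\<^sub>R) c ` (W \<inter> W') \<subseteq> W \<inter> W'" if "\<bar>c\<bar> \<le> 1" for c
      using \<open>?B W\<close> \<open>?B W'\<close> that by blast
    ultimately show ?thesis
      using that by (auto intro: convex_Int)
  qed
  have "istopology (\<lambda>U. U \<subseteq> V \<and> (\<forall>x\<in>U. \<exists>W. ?B W \<and> (+) x ` W \<subseteq> U))"
    unfolding istopology_def
  proof (intro conjI allI impI)
    fix S T assume S: "S \<subseteq> V \<and> (\<forall>x\<in>S. \<exists>W. ?B W \<and> (+) x ` W \<subseteq> S)"
      and T: "T \<subseteq> V \<and> (\<forall>x\<in>T. \<exists>W. ?B W \<and> (+) x ` W \<subseteq> T)"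
    then show "S \<inter> T \<subseteq> V" by blast
    show "\<forall>x\<in>S \<inter> T. \<exists>W. ?B W \<and> (+) x ` W \<subseteq> S \<inter> T"
    proof
      fix x assume "x \<in> S \<inter> T"
      then have "\<exists>W. ?B W \<and> (+) x ` W \<subseteq> S" "\<exists>W. ?B W \<and> (+) x ` W \<subseteq> T"
        using S T by simp_all
      then obtain W W' where W: "?B W" "(+) x ` W \<subseteq> S" and W': "?B W'" "(+) x ` W' \<subseteq> T"
        by (elim exE conjE) blast
      have "?B (W \<inter> W')" by (rule B[OF W(1) W'(1)])
      moreover have "(+) x ` (W \<inter> W') \<subseteq> S \<inter> T" using W(2) W'(2) by blast
      ultimately show "\<exists>W. ?B W \<and> (+) x ` W \<subseteq> S \<inter> T" by (intro exI[of _ "W \<inter> W'"] conjI) simp_all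
    qed
  next
    fix \<K> assume K: "\<forall>U\<in>\<K>. U \<subseteq> V \<and> (\<forall>x\<in>U. \<exists>W. ?B W \<and> (+) x ` W \<subseteq> U)"
    then show "\<Union>\<K> \<subseteq> V" by blast
    show "\<forall>x\<in>\<Union>\<K>. \<exists>W. ?B W \<and> (+) x ` W \<subseteq> \<Union>\<K>"
    proof
      fix x assume "x \<in> \<Union>\<K>"
      then obtain U where U: "U \<in> \<K>" "x \<in> U" by blast
      then have "\<exists>W. ?B W \<and> (+) x ` W \<subseteq> U" using K by simp
      then obtain W where W: "?B W" "(+) x ` W \<subseteq> U" by (elim exE conjE) blast
      have "(+) x ` W \<subseteq> \<Union>\<K>" using W(2) U(1) by blast
      with W(1) show "\<exists>W. ?B W \<and> (+) x ` W \<subseteq> \<Union>\<K>" by (intro exI[of _ W] conjI) simp_all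
    qed
  qed
  then show ?thesis
    unfolding lc_inductive_limit_def by (simp add: topology_inverse' conj_ac)
qed

definition von_neumann_bounded :: "'v::real_vector topology \<Rightarrow> 'v set \<Rightarrow> bool"
  where "von_neumann_bounded X S \<longleftrightarrow> S \<subseteq> topspace X \<and>
    (\<forall>U. openin X U \<and> 0 \<in> U \<longrightarrow> (\<exists>s>0. \<forall>t>s. S \<subseteq> (*\<^sub>R) t ` U))"

text \<open>Uniform convergence on the bounded subsets of \<open>X\<close>, on a space \<open>V'\<close> of functionals that
  are bounded on those subsets.\<close>

definition strong_topology :: "'v::real_vector topology \<Rightarrow> ('v \<Rightarrow> real) set \<Rightarrow> ('v \<Rightarrow> real) topology"
  where "strong_topology X V' =
    seminorm_topology V' {(\<lambda>T. SUP x\<in>S. \<bar>T x\<bar>) | S. von_neumann_bounded X S \<and> S \<noteq> {}}"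

definition borel_sets_of :: "'a topology \<Rightarrow> 'a set set"
  where "borel_sets_of X = sigma_sets (topspace X) {U. openin X U}"

text \<open>\<open>iterated_deriv f [v\<^sub>1, \<dots>, v\<^sub>j] x\<close> is \<open>D\<^sup>jf(x)(v\<^sub>1, \<dots>, v\<^sub>j)\<close>. As the domain is finite
  dimensional, \<open>D\<^sup>jf\<close> is differentiable as a map into the \<open>j\<close>-linear maps if and only if it is
  differentiable after evaluation at arbitrary vectors.\<close>

primrec iterated_deriv ::
  "('a::euclidean_space \<Rightarrow> 'b::real_normed_vector) \<Rightarrow> 'a list \<Rightarrow> 'a \<Rightarrow> 'b"
  where
    "iterated_deriv f [] = f"
  | "iterated_deriv f (v # vs) = (\<lambda>x. frechet_derivative (iterated_deriv f vs) (at x) v)"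

definition smooth :: "('a::euclidean_space \<Rightarrow> 'b::real_normed_vector) \<Rightarrow> bool"
  where "smooth f \<longleftrightarrow> (\<forall>vs x. iterated_deriv f vs differentiable (at x))"

definition deriv_norm :: "nat \<Rightarrow> ('a::euclidean_space \<Rightarrow> 'b::real_normed_vector) \<Rightarrow> 'a \<Rightarrow> real"
  where "deriv_norm j f x =
    (SUP vs\<in>{vs. length vs = j \<and> (\<forall>v\<in>set vs. norm v \<le> 1)}. norm (iterated_deriv f vs x))"

definition deriv_seminorm ::
  "nat \<Rightarrow> 'a set \<Rightarrow> ('a::euclidean_space \<Rightarrow> 'b::real_normed_vector) \<Rightarrow> real"
  where "deriv_seminorm j K f = (SUP x\<in>K. deriv_norm j f x)"

text \<open>The empty set is left out because \<open>Sup {}\<close> is unspecified on the reals.\<close>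

definition smooth_topology :: "('a::euclidean_space \<Rightarrow> 'b::real_normed_vector) topology"
  where "smooth_topology =
    seminorm_topology (Collect smooth) {deriv_seminorm j K | j K. compact K \<and> K \<noteq> {}}"

definition test_functions_in :: "'a set \<Rightarrow> ('a::euclidean_space \<Rightarrow> 'b::real_normed_vector) set"
  where "test_functions_in K = {\<theta>. smooth \<theta> \<and> closure {x. \<theta> x \<noteq> 0} \<subseteq> K}"

definition test_topology_in :: "'a set \<Rightarrow> ('a::euclidean_space \<Rightarrow> 'b::real_normed_vector) topology"
  where "test_topology_in K = subtopology smooth_topology (test_functions_in K)"

definition test_functions :: "('a::euclidean_space \<Rightarrow> 'b::real_normed_vector) set"
  where "test_functions = (\<Union>K\<in>{K. compact K}. test_functions_in K)"

definition test_topology :: "('a::euclidean_space \<Rightarrow> 'b::real_normed_vector) topology"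
  where "test_topology = lc_inductive_limit test_functions {test_topology_in K | K. compact K}"

text \<open>A functional on a subspace is represented by its extension by zero to the whole type.\<close>

definition distributions :: "(('a::euclidean_space \<Rightarrow> 'b::real_normed_vector) \<Rightarrow> real) set"
  where "distributions = {T. linear_functional_on test_functions T \<and>
    (\<forall>\<theta>. \<theta> \<notin> test_functions \<longrightarrow> T \<theta> = 0) \<and>
    (\<forall>K. compact K \<longrightarrow> continuous_map (test_topology_in K) euclideanreal T)}"

definition compact_distributions ::
    "(('a::euclidean_space \<Rightarrow> 'b::real_normed_vector) \<Rightarrow> real) set"
  where "compact_distributions = {T. linear_functional_on (Collect smooth) T \<and>
    (\<forall>\<theta>. \<not> smooth \<theta> \<longrightarrow> T \<theta> = 0) \<and> continuous_map smooth_topology euclideanreal T}"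

definition to_distribution ::
    "(('a::euclidean_space \<Rightarrow> 'b::real_normed_vector) \<Rightarrow> real) \<Rightarrow> ('a \<Rightarrow> 'b) \<Rightarrow> real"
  where "to_distribution T = (\<lambda>\<theta>. if \<theta> \<in> test_functions then T \<theta> else 0)"

definition distributions_b ::
    "(('a::euclidean_space \<Rightarrow> 'b::real_normed_vector) \<Rightarrow> real) topology"
  where "distributions_b = strong_topology test_topology distributions"

definition compact_distributions_b ::
    "(('a::euclidean_space \<Rightarrow> 'b::real_normed_vector) \<Rightarrow> real) topology"
  where "compact_distributions_b = strong_topology smooth_topology compact_distributions"

text \<open>An \<open>m\<close>-linear map is a function on lists, of which only the values at lists of length \<open>m\<close>
  matter.\<close>

definition symmetric_multilinear :: "nat \<Rightarrow> ('a::real_vector list \<Rightarrow> 'b::real_vector) \<Rightarrow> bool"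
  where "symmetric_multilinear m \<psi> \<longleftrightarrow>
    (\<forall>vs i. length vs = m \<and> i < m \<longrightarrow> linear (\<lambda>v. \<psi> (vs[i := v]))) \<and>
    (\<forall>vs ws. length vs = m \<and> mset ws = mset vs \<longrightarrow> \<psi> ws = \<psi> vs)"

text \<open>For \<open>k < 0\<close> the sum is empty, so that only the zero function remains.\<close>

definition poly_functions :: "int \<Rightarrow> ('a::real_vector \<Rightarrow> 'b::real_vector) set"
  where "poly_functions k = {P. \<exists>\<psi>. (\<forall>m. symmetric_multilinear m (\<psi> m)) \<and>
    (\<forall>x. P x = (\<Sum>m\<in>{m. int m \<le> k}. \<psi> m (replicate m x)))}"

definition poly_topology :: "int \<Rightarrow> ('a::euclidean_space \<Rightarrow> 'b::real_normed_vector) topology"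
  where "poly_topology k =
    seminorm_topology (poly_functions k) {\<lambda>P. \<Sum>m\<in>{m. int m \<le> k}. deriv_norm m P 0}"

definition poly_distribution ::
    "('a::euclidean_space \<Rightarrow> 'b::real_normed_vector \<Rightarrow>\<^sub>L real) \<Rightarrow> ('a \<Rightarrow> 'b) \<Rightarrow> real"
  where "poly_distribution P =
    to_distribution (\<lambda>\<theta>. \<integral>x. blinfun_apply (P x) (\<theta> x) \<partial>lborel)"

definition rescale ::
    "((real^'n \<Rightarrow> 'b::real_normed_vector) \<Rightarrow> real) \<Rightarrow> real^'n \<Rightarrow> real \<Rightarrow> (real^'n \<Rightarrow> 'b) \<Rightarrow> real"
  where "rescale T a r \<theta> = T (\<lambda>x. \<theta> ((x - a) /\<^sub>R r)) / r ^ CARD('n)"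

definition rescaled_sup ::
    "((real^'n \<Rightarrow> 'b::real_normed_vector) \<Rightarrow> real) \<Rightarrow> real^'n \<Rightarrow>
     ((real^'n \<Rightarrow> 'b) \<Rightarrow> real) \<Rightarrow> (real^'n \<Rightarrow> 'b \<Rightarrow>\<^sub>L real) \<Rightarrow> real \<Rightarrow> ereal"
  where "rescaled_sup \<nu> a T P r =
    (SUP \<theta>\<in>{\<theta> \<in> test_functions_in (cball 0 1). \<nu> \<theta> \<le> 1}.
      ereal (rescale (T - poly_distribution P) a r \<theta>))"

end

theory Submission
  imports Defs
begin

text \<open>For a fixed scale \<open>r > 0\<close> and a fixed test function \<open>\<theta>\<close> the number \<open>(T - P)\<^sup>a\<^sup>,\<^sup>r(\<theta>)\<close> depends
  continuously on \<open>(a, T, P)\<close>.  Consequently each condition \<open>r\<^sup>\<kappa> \<Sigma>(a, T, P, r) \<le> c\<close>, being a family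
  of inequalities between continuous functions indexed by \<open>\<theta>\<close>, describes a closed set, and so does
  its conjunction over all \<open>r\<close> below a given scale.  The limes superior is finite if and only if such a
  conjunction holds for some bound \<open>c = M\<close> and some scale \<open>1/(N+1)\<close> with natural numbers \<open>M\<close>, \<open>N\<close>,
  whence a countable union of closed sets.  As \<open>\<theta> = 0\<close> competes in the supremum, \<open>\<Sigma> \<ge> 0\<close>; hence the
  limit is zero if and only if for every \<open>c = 1/(m+1)\<close> the conjunction holds at some scale, whence a
  countable intersection of such unions.  This part is the locale \<open>scaled_family\<close>.

  The joint continuity rests on \<open>continuous_map_pairing\<close>.  When \<open>a\<close> stays near \<open>a\<^sub>0\<close>, the functions
  \<open>x \<mapsto> \<theta>((x - a)/r)\<close> form a bounded set of test functions, on which convergence in the strong topology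
  is uniform, while for a single distribution the dependence on \<open>a\<close> is continuous because
  \<open>a \<mapsto> \<theta>((\<cdot> - a)/r)\<close> is continuous into the smooth functions.  For polynomial functions the uniform
  bound comes from \<open>norm_poly_le_deriv_norms\<close>, which estimates a polynomial on a ball by its
  coefficients at the origin.

  If \<open>Y\<close> is finite-dimensional, then the whole space \<open>\<real>\<^sup>n \<times> \<E>' \<times> Y\<^sub>k\<close> is a countable union of
  compact sets, and intersecting these with the closed sets above gives the remaining claim.
  Indeed, \<open>Y\<^sub>k\<close> has a finite basis.  The dual \<open>\<E>'\<close> is the union of the sets of functionals \<open>T\<close> with
  \<open>\<bar>T\<theta>\<bar> \<le> N p\<^sub>N(\<theta>)\<close>, where \<open>p\<^sub>N\<close> adds up the suprema of the derivatives of order at most \<open>N\<close> over the ball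
  of radius \<open>N\<close>.  Such a set is compact for pointwise convergence by Tychonoff's theorem, and on it
  the strong topology is no finer, since bounded sets of smooth functions are totally bounded with
  respect to \<open>p\<^sub>N\<close>: this is the argument of Arzela and Ascoli, applied to the derivatives of order at
  most \<open>N\<close>, which are equi-Lipschitz and take values in balls of \<open>Y\<close>, hence in compact sets.\<close>

section \<open>Calculus of iterated derivatives\<close>

lemma iterated_deriv_append:
  "iterated_deriv f (vs @ ws) = iterated_deriv (iterated_deriv f ws) vs"
  by (induction vs) auto

lemma smooth_has_derivative:
  assumes "smooth f"
  shows "(iterated_deriv f vs has_derivative (\<lambda>v. iterated_deriv f (v # vs) x)) (at x)"
  using assms by (auto simp: smooth_def frechet_derivative_works)

lemma smooth_iterated_deriv:
  assumes "smooth f"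
  shows "smooth (iterated_deriv f vs)"
  using assms by (metis smooth_def iterated_deriv_append)

lemma smooth_continuous_on:
  assumes "smooth f"
  shows "continuous_on S (iterated_deriv f vs)"
  by (meson assms continuous_at_imp_continuous_on has_derivative_continuous smooth_has_derivative)

text \<open>Iterated derivatives are computed by guessing: a family that starts with \<open>f\<close> and whose
  members are linked by differentiation is the family of iterated derivatives.\<close>

lemma iterated_deriv_eqI:
  assumes "G [] = f"
    and G: "\<And>vs x. (G vs has_derivative (\<lambda>v. G (v # vs) x)) (at x)"
  shows "iterated_deriv f = G" and "smooth f"
proof -
  have "iterated_deriv f vs = G vs" for vs
  proof (induction vs)
    case (Cons v vs)
    have "frechet_derivative (G vs) (at x) v = G (v # vs) x" for x
      by (simp add: frechet_derivative_at[OF G[of vs x], symmetric])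
    then show ?case using Cons by auto
  qed (simp add: assms)
  then show eq: "iterated_deriv f = G" by blast
  show "smooth f"
    unfolding smooth_def eq using G differentiable_def by blast
qed

text \<open>Suited to classes of functions whose higher derivatives have no convenient closed form.\<close>

lemma smooth_coinduct:
  assumes "f \<in> F"
    and F: "\<And>f. f \<in> F \<Longrightarrow> \<exists>f'. (\<forall>x. (f has_derivative (\<lambda>v. f' v x)) (at x)) \<and> (\<forall>v. f' v \<in> F)"
  shows "smooth f"
proof -
  have "iterated_deriv f vs \<in> F" for vs
  proof (induction vs)
    case (Cons v vs)
    then obtain f' where f': "\<And>x. (iterated_deriv f vs has_derivative (\<lambda>v. f' v x)) (at x)" "f' v \<in> F"
      using F by meson
    have "iterated_deriv f (v # vs) = f' v"
      by (simp add: frechet_derivative_at[OF f'(1), symmetric])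
    then show ?case using f' by simp
  qed (simp add: assms)
  then show ?thesis
    unfolding smooth_def differentiable_def using F by meson
qed

lemma
  assumes "smooth f" "smooth g"
  shows iterated_deriv_add: "iterated_deriv (f + g) = iterated_deriv f + iterated_deriv g"
    and smooth_add: "smooth (f + g)"
proof -
  have "((iterated_deriv f + iterated_deriv g) vs has_derivative
      (\<lambda>v. (iterated_deriv f + iterated_deriv g) (v # vs) x)) (at x)" for vs x
    unfolding plus_fun_def
    by (intro has_derivative_add smooth_has_derivative assms)
  from iterated_deriv_eqI[OF _ this, of "f + g"]
  show "iterated_deriv (f + g) = iterated_deriv f + iterated_deriv g" "smooth (f + g)"
    by (auto simp: plus_fun_def)
qed

lemma
  assumes "smooth f"
  shows iterated_deriv_scaleR: "iterated_deriv (c *\<^sub>R f) = c *\<^sub>R iterated_deriv f"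
    and smooth_scaleR: "smooth (c *\<^sub>R f)"
proof -
  have "((c *\<^sub>R iterated_deriv f) vs has_derivative
      (\<lambda>v. (c *\<^sub>R iterated_deriv f) (v # vs) x)) (at x)" for vs x
    unfolding scaleR_fun_def
    by (intro has_derivative_scaleR_right smooth_has_derivative assms)
  from iterated_deriv_eqI[OF _ this, of "c *\<^sub>R f"]
  show "iterated_deriv (c *\<^sub>R f) = c *\<^sub>R iterated_deriv f" "smooth (c *\<^sub>R f)"
    by (auto simp: scaleR_fun_def)
qed

lemma scaleR_fun_apply [simp]: "(c *\<^sub>R f) x = c *\<^sub>R f x"
  by (simp add: scaleR_fun_def)

lemma smooth_const: "smooth (\<lambda>x. c)"
  by (rule iterated_deriv_eqI[of "\<lambda>vs x. if vs = [] then c else 0"]) auto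

lemma subspace_smooth: "subspace (Collect smooth)"
  using smooth_const[of 0]
  by (auto simp: subspace_def smooth_add smooth_scaleR zero_fun_def)

lemma smooth_diff:
  assumes "smooth f" "smooth g"
  shows "smooth (f - g)"
  using subspace_diff[OF subspace_smooth] assms by blast

lemma iterated_deriv_diff:
  assumes "smooth f" "smooth g"
  shows "iterated_deriv (f - g) = iterated_deriv f - iterated_deriv g"
proof -
  have "iterated_deriv (f - g + g) = iterated_deriv (f - g) + iterated_deriv g"
    by (intro iterated_deriv_add smooth_diff assms)
  then show ?thesis by (simp add: algebra_simps)
qed

text \<open>The product with a linear form is smooth since the maps \<open>x \<mapsto> (x \<bullet> b) f(x) + g(x)\<close> with
  smooth \<open>f\<close> and \<open>g\<close> are closed under differentiation.\<close>

lemma smooth_inner_scaleR: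
  assumes "smooth f"
  shows "smooth (\<lambda>x. (x \<bullet> b) *\<^sub>R f x)"
proof (rule smooth_coinduct)
  let ?F = "{\<lambda>x. (x \<bullet> b) *\<^sub>R f x + g x |f g. smooth f \<and> smooth g}"
  show "(\<lambda>x. (x \<bullet> b) *\<^sub>R f x) \<in> ?F"
    using assms smooth_const[of 0] by force
  fix h assume "h \<in> ?F"
  then obtain f g where h: "h = (\<lambda>x. (x \<bullet> b) *\<^sub>R f x + g x)" and fg: "smooth f" "smooth g"
    by blast
  define f' where "f' v = (\<lambda>x. (x \<bullet> b) *\<^sub>R iterated_deriv f [v] x +
     (((v \<bullet> b) *\<^sub>R f) x + iterated_deriv g [v] x))" for v
  have "(h has_derivative (\<lambda>v. f' v x)) (at x)" for x
  proof -
    have *: "(f has_derivative (\<lambda>v. iterated_deriv f [v] x)) (at x)"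
      "(g has_derivative (\<lambda>v. iterated_deriv g [v] x)) (at x)"
      using smooth_has_derivative[OF fg(1), of "[]"] smooth_has_derivative[OF fg(2), of "[]"] by simp_all
    show ?thesis
      unfolding h f'_def scaleR_fun_def
      by (rule derivative_eq_intros * refl)+ (auto simp: algebra_simps)
  qed
  moreover have "f' v \<in> ?F" for v
  proof -
    have "smooth (((v \<bullet> b) *\<^sub>R f) + iterated_deriv g [v])" "smooth (iterated_deriv f [v])"
      by (intro smooth_add smooth_scaleR smooth_iterated_deriv fg)+
    then show ?thesis
      unfolding f'_def plus_fun_apply[symmetric, of "(v \<bullet> b) *\<^sub>R f"] by blast
  qed
  ultimately show "\<exists>f'. (\<forall>x. (h has_derivative (\<lambda>v. f' v x)) (at x)) \<and> (\<forall>v. f' v \<in> ?F)"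
    by blast
qed

lemma
  fixes f :: "'a::euclidean_space \<Rightarrow> 'b::real_normed_vector"
  assumes "smooth f"
  shows iterated_deriv_affine:
      "iterated_deriv (\<lambda>x. f ((x - a) /\<^sub>R r)) =
        (\<lambda>vs x. (1 / r) ^ length vs *\<^sub>R iterated_deriv f vs ((x - a) /\<^sub>R r))"
    and smooth_affine: "smooth (\<lambda>x. f ((x - a) /\<^sub>R r))"
proof -
  let ?G = "\<lambda>vs x. (1 / r) ^ length vs *\<^sub>R iterated_deriv f vs ((x - a) /\<^sub>R r)"
  have "(?G vs has_derivative (\<lambda>v. ?G (v # vs) x)) (at x)" for vs x
  proof -
    have lin: "linear (\<lambda>v. iterated_deriv f (v # vs) y)" for y
      using smooth_has_derivative[OF assms] has_derivative_linear by blast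
    have "((\<lambda>x. (x - a) /\<^sub>R r) has_derivative (\<lambda>v. v /\<^sub>R r)) (at x)"
      by (rule derivative_eq_intros refl)+ auto
    from has_derivative_compose[OF this smooth_has_derivative[OF assms]]
    have "((\<lambda>x. iterated_deriv f vs ((x - a) /\<^sub>R r)) has_derivative
        (\<lambda>v. iterated_deriv f (v /\<^sub>R r # vs) ((x - a) /\<^sub>R r))) (at x)" .
    moreover have "iterated_deriv f (v /\<^sub>R r # vs) y = (1/r) *\<^sub>R iterated_deriv f (v # vs) y" for v y
      using linear_cmul[OF lin] by (simp add: inverse_eq_divide)
    ultimately have "((\<lambda>x. iterated_deriv f vs ((x - a) /\<^sub>R r)) has_derivative
        (\<lambda>v. (1/r) *\<^sub>R iterated_deriv f (v # vs) ((x - a) /\<^sub>R r))) (at x)"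
      by simp
    from has_derivative_scaleR_right[OF this, of "(1 / r) ^ length vs"]
    show ?thesis by (simp add: algebra_simps)
  qed
  from iterated_deriv_eqI[OF _ this]
  show "iterated_deriv (\<lambda>x. f ((x - a) /\<^sub>R r)) = ?G" "smooth (\<lambda>x. f ((x - a) /\<^sub>R r))"
    by auto
qed

section \<open>The seminorms of the space of smooth functions\<close>

definition basis_lists :: "nat \<Rightarrow> 'a::euclidean_space list set"
  where "basis_lists j = {bs. set bs \<subseteq> Basis \<and> length bs = j}"

lemma finite_basis_lists [simp]: "finite (basis_lists j)"
  by (simp add: basis_lists_def finite_lists_length_eq)

lemma basis_lists_0 [simp]: "basis_lists 0 = {[]}"
  by (auto simp: basis_lists_def)

lemma sum_basis_lists_Suc:
  fixes g :: "'a::euclidean_space list \<Rightarrow> 'b::comm_monoid_add"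
  shows
  "(\<Sum>bs\<in>basis_lists (Suc j). g bs) = (\<Sum>b\<in>Basis. \<Sum>bs\<in>basis_lists j. g (b # bs))"
proof -
  have "(basis_lists (Suc j) :: 'a list set) = (\<lambda>(b, bs). b # bs) ` (Basis \<times> basis_lists j)"
    by (force simp: basis_lists_def image_iff length_Suc_conv)
  moreover have "inj_on (\<lambda>(b, bs). b # bs) (Basis \<times> basis_lists j)"
    by (auto simp: inj_on_def)
  ultimately have "sum g (basis_lists (Suc j)) = sum (g \<circ> (\<lambda>(b, bs). b # bs)) (Basis \<times> basis_lists j)"
    by (metis sum.reindex)
  then show ?thesis
    by (simp add: sum.cartesian_product case_prod_unfold o_def)
qed

lemma sum_basis_lists_Suc_snoc:
  fixes g :: "'a::euclidean_space list \<Rightarrow> 'b::comm_monoid_add"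
  shows
  "(\<Sum>bs\<in>basis_lists (Suc j). g bs) = (\<Sum>b\<in>Basis. \<Sum>bs\<in>basis_lists j. g (bs @ [b]))"
proof -
  have "(basis_lists (Suc j) :: 'a list set) = (\<lambda>(b, bs). bs @ [b]) ` (Basis \<times> basis_lists j)"
  proof
    show "(basis_lists (Suc j) :: 'a list set) \<subseteq> (\<lambda>(b, bs). bs @ [b]) ` (Basis \<times> basis_lists j)"
    proof
      fix bs :: "'a list" assume "bs \<in> basis_lists (Suc j)"
      then show "bs \<in> (\<lambda>(b, bs). bs @ [b]) ` (Basis \<times> basis_lists j)"
        by (cases bs rule: rev_cases) (auto simp: basis_lists_def image_iff)
    qed
  qed (auto simp: basis_lists_def)
  moreover have "inj_on (\<lambda>(b, bs). bs @ [b]) (Basis \<times> basis_lists j)"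
    by (auto simp: inj_on_def)
  ultimately have "sum g (basis_lists (Suc j)) = sum (g \<circ> (\<lambda>(b, bs). bs @ [b])) (Basis \<times> basis_lists j)"
    by (metis sum.reindex)
  then show ?thesis
    by (simp add: sum.cartesian_product case_prod_unfold o_def)
qed

text \<open>The \<open>j\<close>-linear map \<open>D\<^sup>jf(x)\<close> is controlled by its finitely many values on the basis.  The
  innermost direction is expanded, so that the induction passes from \<open>f\<close> to its first partial
  derivatives.\<close>

lemma norm_iterated_deriv_le_basis:
  assumes "smooth f" "\<And>v. v \<in> set vs \<Longrightarrow> norm v \<le> 1"
  shows "norm (iterated_deriv f vs x) \<le> (\<Sum>bs\<in>basis_lists (length vs). norm (iterated_deriv f bs x))"
  using assms
proof (induction vs arbitrary: f rule: rev_induct)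
  case (snoc v vs)
  let ?D = "\<lambda>w. iterated_deriv f [w]"
  have D: "(f has_derivative (\<lambda>w. ?D w y)) (at y)" for y
    using smooth_has_derivative[OF snoc(2), of "[]"] by simp
  have smD: "smooth (?D w)" for w
    by (rule smooth_iterated_deriv[OF snoc(2)])
  have lin: "linear (\<lambda>w. ?D w y)" for y
    using has_derivative_linear[OF D] .
  have "?D v = (\<lambda>y. \<Sum>b\<in>Basis. (v \<bullet> b) *\<^sub>R ?D b y)"
  proof
    fix y
    have "?D v y = ?D (\<Sum>b\<in>Basis. (v \<bullet> b) *\<^sub>R b) y" by (simp add: euclidean_representation)
    also have "\<dots> = (\<Sum>b\<in>Basis. (v \<bullet> b) *\<^sub>R ?D b y)"
      by (simp add: linear_sum[OF lin] linear_cmul[OF lin] del: iterated_deriv.simps)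
    finally show "?D v y = (\<Sum>b\<in>Basis. (v \<bullet> b) *\<^sub>R ?D b y)" .
  qed
  then have *: "?D v = (\<lambda>y. \<Sum>b\<in>Basis. (v \<bullet> b) *\<^sub>R iterated_deriv (?D b) [] y)" by simp
  have "iterated_deriv (?D v) = (\<lambda>vs y. \<Sum>b\<in>Basis. (v \<bullet> b) *\<^sub>R iterated_deriv (?D b) vs y)"
  proof (rule iterated_deriv_eqI)
    show "(\<lambda>y. \<Sum>b\<in>Basis. (v \<bullet> b) *\<^sub>R iterated_deriv (?D b) [] y) = ?D v" using * by simp
  qed (intro has_derivative_sum has_derivative_scaleR_right smooth_has_derivative smD)
  then have "norm (iterated_deriv f (vs @ [v]) x)
      = norm (\<Sum>b\<in>Basis. (v \<bullet> b) *\<^sub>R iterated_deriv (?D b) vs x)"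
    unfolding iterated_deriv_append by simp
  also have "\<dots> \<le> (\<Sum>b\<in>Basis. \<bar>v \<bullet> b\<bar> * norm (iterated_deriv (?D b) vs x))"
    by (rule order_trans[OF norm_sum]) simp
  also have "\<dots> \<le> (\<Sum>b\<in>Basis. 1 * (\<Sum>bs\<in>basis_lists (length vs). norm (iterated_deriv (?D b) bs x)))"
  proof (intro sum_mono mult_mono)
    fix b :: 'a assume "b \<in> Basis"
    then show "\<bar>v \<bullet> b\<bar> \<le> 1"
      using Basis_le_norm[of b v] snoc(3)[of v] by simp
    show "norm (iterated_deriv (?D b) vs x)
        \<le> (\<Sum>bs\<in>basis_lists (length vs). norm (iterated_deriv (?D b) bs x))"
      using snoc(3) by (intro snoc(1) smD) auto
  qed auto
  also have "\<dots> = (\<Sum>bs\<in>basis_lists (length (vs @ [v])). norm (iterated_deriv f bs x))"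
    unfolding iterated_deriv_append by (simp add: sum_basis_lists_Suc_snoc iterated_deriv_append del: iterated_deriv.simps)
  finally show ?case .
qed simp

text \<open>Because of this bound by finitely many continuous functions the suprema in \<^const>\<open>deriv_norm\<close> and, on
  compact sets, in \<^const>\<open>deriv_seminorm\<close> are suprema of sets that are bounded above.\<close>

abbreviation unit_lists :: "nat \<Rightarrow> 'a::euclidean_space list set"
  where "unit_lists j \<equiv> {vs. length vs = j \<and> (\<forall>v\<in>set vs. norm v \<le> 1)}"

lemma unit_lists_nonempty: "unit_lists j \<noteq> {}"
  by (auto intro!: exI[of _ "replicate j 0"])

lemma deriv_norm_leI:
  assumes "\<And>vs. length vs = j \<Longrightarrow> (\<And>v. v \<in> set vs \<Longrightarrow> norm v \<le> 1) \<Longrightarrow> norm (iterated_deriv f vs x) \<le> c"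
  shows "deriv_norm j f x \<le> c"
  unfolding deriv_norm_def by (rule cSUP_least[OF unit_lists_nonempty]) (use assms in auto)

lemma deriv_norm_le_basis:
  assumes "smooth f"
  shows "deriv_norm j f x \<le> (\<Sum>bs\<in>basis_lists j. norm (iterated_deriv f bs x))"
  using norm_iterated_deriv_le_basis[OF assms] by (intro deriv_norm_leI) blast

lemma norm_iterated_deriv_le_deriv_norm:
  assumes "smooth f" "\<And>v. v \<in> set vs \<Longrightarrow> norm v \<le> 1"
  shows "norm (iterated_deriv f vs x) \<le> deriv_norm (length vs) f x"
  unfolding deriv_norm_def
proof (rule cSUP_upper)
  show "bdd_above ((\<lambda>us. norm (iterated_deriv f us x)) ` unit_lists (length vs))"
  proof (rule bdd_aboveI2)
    fix us :: "'a list" assume "us \<in> unit_lists (length vs)"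
    then show "norm (iterated_deriv f us x) \<le> (\<Sum>bs\<in>basis_lists (length vs). norm (iterated_deriv f bs x))"
      using norm_iterated_deriv_le_basis[OF assms(1), of us x] by simp
  qed
qed (use assms in auto)

lemma deriv_norm_nonneg:
  assumes "smooth f"
  shows "0 \<le> deriv_norm j f x"
proof -
  have "norm (iterated_deriv f (replicate j 0) x) \<le> deriv_norm j f x"
    using norm_iterated_deriv_le_deriv_norm[OF assms, of "replicate j 0" x] by simp
  then show ?thesis using norm_ge_zero order_trans by blast
qed

lemma deriv_norm_add:
  assumes "smooth f" "smooth g"
  shows "deriv_norm j (f + g) x \<le> deriv_norm j f x + deriv_norm j g x"
proof (rule deriv_norm_leI)
  fix vs :: "'a list" assume vs: "length vs = j" "\<And>v. v \<in> set vs \<Longrightarrow> norm v \<le> 1"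
  have "norm (iterated_deriv (f + g) vs x) \<le> norm (iterated_deriv f vs x) + norm (iterated_deriv g vs x)"
    by (simp add: iterated_deriv_add assms norm_triangle_ineq)
  then show "norm (iterated_deriv (f + g) vs x) \<le> deriv_norm j f x + deriv_norm j g x"
    using norm_iterated_deriv_le_deriv_norm[OF assms(1) vs(2)]
      norm_iterated_deriv_le_deriv_norm[OF assms(2) vs(2)] vs(1) by (smt (verit))
qed

lemma deriv_norm_scaleR_le:
  assumes "smooth f"
  shows "deriv_norm j (c *\<^sub>R f) x \<le> \<bar>c\<bar> * deriv_norm j f x"
proof (rule deriv_norm_leI)
  fix vs :: "'a list" assume vs: "length vs = j" "\<And>v. v \<in> set vs \<Longrightarrow> norm v \<le> 1"
  then show "norm (iterated_deriv (c *\<^sub>R f) vs x) \<le> \<bar>c\<bar> * deriv_norm j f x"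
    using norm_iterated_deriv_le_deriv_norm[OF assms vs(2), of vs x]
    by (simp add: iterated_deriv_scaleR[OF assms] scaleR_fun_apply mult_left_mono)
qed

lemma bdd_above_deriv_norm:
  assumes "smooth f" "compact K"
  shows "bdd_above (deriv_norm j f ` K)"
proof -
  have "continuous_on K (\<lambda>x. \<Sum>bs\<in>basis_lists j. norm (iterated_deriv f bs x))"
    by (intro continuous_intros smooth_continuous_on assms)
  then have "bdd_above ((\<lambda>x. \<Sum>bs\<in>basis_lists j. norm (iterated_deriv f bs x)) ` K)"
    using assms by (intro bounded_imp_bdd_above compact_imp_bounded compact_continuous_image)
  then obtain M where "\<And>x. x \<in> K \<Longrightarrow> (\<Sum>bs\<in>basis_lists j. norm (iterated_deriv f bs x)) \<le> M"
    by (auto simp: bdd_above_def)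
  then show ?thesis
    using deriv_norm_le_basis[OF assms(1)] by (meson bdd_aboveI2 order_trans)
qed

lemma deriv_norm_le_deriv_seminorm:
  assumes "smooth f" "compact K" "x \<in> K"
  shows "deriv_norm j f x \<le> deriv_seminorm j K f"
  unfolding deriv_seminorm_def by (rule cSUP_upper[OF assms(3) bdd_above_deriv_norm[OF assms(1,2)]])

lemma norm_iterated_deriv_le_deriv_seminorm:
  assumes "smooth f" "compact K" "x \<in> K" "\<And>v. v \<in> set vs \<Longrightarrow> norm v \<le> 1"
  shows "norm (iterated_deriv f vs x) \<le> deriv_seminorm (length vs) K f"
  by (rule order_trans[OF norm_iterated_deriv_le_deriv_norm deriv_norm_le_deriv_seminorm])
    (use assms in auto)

lemma norm_le_deriv_seminorm:
  assumes "smooth f" "compact K" "x \<in> K"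
  shows "norm (f x) \<le> deriv_seminorm 0 K f"
  using norm_iterated_deriv_le_deriv_seminorm[OF assms, of "[]"] by simp

lemma deriv_seminorm_nonneg:
  assumes "smooth f" "compact K" "K \<noteq> {}"
  shows "0 \<le> deriv_seminorm j K f"
  using assms deriv_norm_nonneg deriv_norm_le_deriv_seminorm by (metis ex_in_conv order_trans)

lemma deriv_seminorm_le_basis:
  assumes "smooth f" "K \<noteq> {}"
    and "\<And>x. x \<in> K \<Longrightarrow> (\<Sum>bs\<in>basis_lists j. norm (iterated_deriv f bs x)) \<le> c"
  shows "deriv_seminorm j K f \<le> c"
  unfolding deriv_seminorm_def
  using deriv_norm_le_basis[OF assms(1)] assms by (meson cSUP_least order_trans)

lemma deriv_seminorm_add:
  assumes "smooth f" "smooth g" "compact K" "K \<noteq> {}"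
  shows "deriv_seminorm j K (f + g) \<le> deriv_seminorm j K f + deriv_seminorm j K g"
  unfolding deriv_seminorm_def[of j K "f + g"]
proof (rule cSUP_least[OF assms(4)])
  fix x assume "x \<in> K"
  then show "deriv_norm j (f + g) x \<le> deriv_seminorm j K f + deriv_seminorm j K g"
    using deriv_norm_add[OF assms(1,2), of j x] deriv_norm_le_deriv_seminorm assms
    by (smt (verit))
qed

lemma deriv_seminorm_scaleR:
  assumes "smooth f" "compact K" "K \<noteq> {}"
  shows "deriv_seminorm j K (c *\<^sub>R f) = \<bar>c\<bar> * deriv_seminorm j K f"
proof -
  have le: "deriv_seminorm j K (c *\<^sub>R f) \<le> \<bar>c\<bar> * deriv_seminorm j K f"
    if "smooth f" for c and f :: "'a \<Rightarrow> 'b"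
    unfolding deriv_seminorm_def[of j K "c *\<^sub>R f"]
  proof (rule cSUP_least[OF assms(3)])
    fix x assume "x \<in> K"
    then show "deriv_norm j (c *\<^sub>R f) x \<le> \<bar>c\<bar> * deriv_seminorm j K f"
      using deriv_norm_scaleR_le[OF that, of j c x] deriv_norm_le_deriv_seminorm that assms
        mult_left_mono[of _ _ "\<bar>c\<bar>"] by (smt (verit))
  qed
  show ?thesis
  proof (cases "c = 0")
    case True
    then show ?thesis
      using le[OF assms(1), of 0] deriv_seminorm_nonneg[OF smooth_scaleR[OF assms(1), of 0] assms(2,3), of j]
      by simp
  next
    case False
    then have "deriv_seminorm j K f \<le> \<bar>1 / c\<bar> * deriv_seminorm j K (c *\<^sub>R f)"
      using le[OF smooth_scaleR[OF assms(1), of c], of "1 / c"] by simp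
    then show ?thesis
      using le[OF assms(1), of c] False by (simp add: field_simps)
  qed
qed

section \<open>Topologies given by seminorms\<close>

lemma seminorm_on_subset: "seminorm_on W p \<Longrightarrow> V \<subseteq> W \<Longrightarrow> seminorm_on V p"
  unfolding seminorm_on_def by blast

lemma seminorm_on_0:
  assumes "seminorm_on V p" "subspace V"
  shows "p 0 = 0"
proof -
  have "p (0 *\<^sub>R 0) = \<bar>0\<bar> * p 0"
    using assms subspace_0 unfolding seminorm_on_def by blast
  then show ?thesis by simp
qed

lemma seminorm_on_nonneg:
  assumes "seminorm_on V p" "subspace V" "x \<in> V"
  shows "0 \<le> p x"
proof -
  have "(-1) *\<^sub>R x \<in> V" using assms by (intro subspace_scale)
  then have "p (x + (-1) *\<^sub>R x) \<le> p x + p ((-1) *\<^sub>R x)"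
    using assms unfolding seminorm_on_def by blast
  moreover have "p ((-1) *\<^sub>R x) = \<bar>-1\<bar> * p x"
    using assms unfolding seminorm_on_def by blast
  ultimately show ?thesis using seminorm_on_0[OF assms(1,2)] by simp
qed

text \<open>The form with a dominating sum makes open balls available also for finite sums of defining
  seminorms, which need not be defining seminorms themselves.\<close>

lemma openin_seminorm_ball_of_dominated:
  assumes V: "subspace V" and p: "seminorm_on V p"
    and q: "finite I" "\<And>i. i \<in> I \<Longrightarrow> q i \<in> Q" "\<And>x. x \<in> V \<Longrightarrow> p x \<le> (\<Sum>i\<in>I. q i x)"
    and x0: "x0 \<in> V"
  shows "openin (seminorm_topology V Q) {x \<in> V. p (x - x0) < e}"
  unfolding openin_seminorm_topology
proof (intro conjI ballI)
  fix x assume x: "x \<in> {x \<in> V. p (x - x0) < e}"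
  let ?d = "(e - p (x - x0)) / (card I + 1)"
  have d: "?d > 0" using x by simp
  have "p (y - x0) < e" if y: "y \<in> V" "\<forall>r\<in>q ` I. r (y - x) < ?d" for y
  proof -
    have yx: "y - x \<in> V" using subspace_diff[OF V] y x by blast
    have "p ((y - x) + (x - x0)) \<le> p (y - x) + p (x - x0)"
      using p yx subspace_diff[OF V] x x0 unfolding seminorm_on_def by blast
    moreover have "p (y - x) \<le> (\<Sum>i\<in>I. ?d)"
      using y(2) by (intro order_trans[OF q(3)[OF yx]] sum_mono) (auto intro: less_imp_le)
    moreover have "(\<Sum>i\<in>I. ?d) < e - p (x - x0)"
      using x by (simp add: field_simps)
    ultimately show ?thesis by simp
  qed
  then show "\<exists>F d. finite F \<and> F \<subseteq> Q \<and> d > 0 \<and> {y \<in> V. \<forall>q\<in>F. q (y - x) < d} \<subseteq> {x \<in> V. p (x - x0) < e}"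
    using d q(1,2) by (intro exI[of _ "q ` I"] exI[of _ ?d]) auto
qed auto

lemma openin_seminorm_ball:
  assumes "subspace V" "seminorm_on V p" "p \<in> Q" "x0 \<in> V"
  shows "openin (seminorm_topology V Q) {x \<in> V. p (x - x0) < e}"
  using assms by (intro openin_seminorm_ball_of_dominated[of V p "{()}" "\<lambda>_. p"]) auto

lemma continuous_map_into_seminorm_topology:
  assumes V: "f \<in> topspace X \<rightarrow> V"
    and f: "\<And>x p e. x \<in> topspace X \<Longrightarrow> p \<in> Q \<Longrightarrow> 0 < e \<Longrightarrow>
      \<exists>U. openin X U \<and> x \<in> U \<and> (\<forall>y\<in>U. p (f y - f x) < e)"
  shows "continuous_map X (seminorm_topology V Q) f"
  unfolding continuous_map_def
proof (intro conjI allI impI)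
  show "f \<in> topspace X \<rightarrow> topspace (seminorm_topology V Q)"
    using V by simp
  fix W assume W: "openin (seminorm_topology V Q) W"
  show "openin X {x \<in> topspace X. f x \<in> W}"
    unfolding openin_subopen[of X "{x \<in> topspace X. f x \<in> W}"]
  proof
    fix x assume x: "x \<in> {x \<in> topspace X. f x \<in> W}"
    then obtain F e where F: "finite F" "F \<subseteq> Q" "e > 0" "{y \<in> V. \<forall>p\<in>F. p (y - f x) < e} \<subseteq> W"
      using W unfolding openin_seminorm_topology by blast
    have "\<forall>p\<in>F. \<exists>U. openin X U \<and> x \<in> U \<and> (\<forall>y\<in>U. p (f y - f x) < e)"
      using f F x by blast
    then obtain U where U: "\<And>p. p \<in> F \<Longrightarrow> openin X (U p) \<and> x \<in> U p \<and> (\<forall>y\<in>U p. p (f y - f x) < e)"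
      by metis
    have "openin X ((\<Inter>p\<in>F. U p) \<inter> topspace X)"
      using U F(1) by (intro openin_INT) auto
    moreover have "(\<Inter>p\<in>F. U p) \<inter> topspace X \<subseteq> {x \<in> topspace X. f x \<in> W}"
      using U F(4) V by fastforce
    ultimately show "\<exists>T. openin X T \<and> x \<in> T \<and> T \<subseteq> {x \<in> topspace X. f x \<in> W}"
      using U x by blast
  qed
qed

lemma seminorm_topology_norm: "seminorm_topology UNIV {norm} = (euclidean :: 'a::real_normed_vector topology)"
proof (rule topology_eq[THEN iffD2], intro allI)
  fix U :: "'a set"
  have "(\<exists>F e. finite F \<and> F \<subseteq> {norm} \<and> e > 0 \<and> {y. \<forall>p\<in>F. p (y - x) < e} \<subseteq> U)
     \<longleftrightarrow> (\<exists>e>0. ball x e \<subseteq> U)" for x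
  proof
    assume "\<exists>F e. finite F \<and> F \<subseteq> {norm} \<and> e > 0 \<and> {y. \<forall>p\<in>F. p (y - x) < e} \<subseteq> U"
    then obtain F e where F: "F \<subseteq> {norm}" "e > 0" "{y. \<forall>p\<in>F. p (y - x) < e} \<subseteq> U" by blast
    then have "ball x e \<subseteq> {y. \<forall>p\<in>F. p (y - x) < e}"
      by (auto simp: dist_norm norm_minus_commute)
    with F show "\<exists>e>0. ball x e \<subseteq> U" by blast
  next
    assume "\<exists>e>0. ball x e \<subseteq> U"
    then obtain e where "e > 0" "ball x e \<subseteq> U" by blast
    then show "\<exists>F e. finite F \<and> F \<subseteq> {norm} \<and> e > 0 \<and> {y. \<forall>p\<in>F. p (y - x) < e} \<subseteq> U"
      by (intro exI[of _ "{norm}"] exI[of _ e]) (auto simp: dist_norm norm_minus_commute subset_iff)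
  qed
  then show "openin (seminorm_topology UNIV {norm}) U \<longleftrightarrow> openin euclidean U"
    by (simp add: openin_seminorm_topology open_contains_ball)
qed

text \<open>The elementary inequality
  \<open>\<bar>h a T - h a\<^sub>0 T\<^sub>0\<bar> \<le> \<bar>h a (T - T\<^sub>0)\<bar> + \<bar>h a T\<^sub>0 - h a\<^sub>0 T\<^sub>0\<bar>\<close> reduces joint continuity of a pairing to
  continuity in the first variable and a locally uniform bound in the second one.\<close>

lemma continuous_map_pairing:
  fixes h :: "'m::metric_space \<Rightarrow> 't::real_vector \<Rightarrow> real"
  assumes V: "subspace V"
    and diff: "\<And>a S T. S \<in> V \<Longrightarrow> T \<in> V \<Longrightarrow> h a (S - T) = h a S - h a T"
    and cont: "\<And>T. T \<in> V \<Longrightarrow> continuous_on UNIV (\<lambda>a. h a T)"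
    and bnd: "\<And>a0. \<exists>p\<in>Q. \<exists>C>0. \<exists>d>0. seminorm_on V p \<and> (\<forall>a\<in>ball a0 d. \<forall>T\<in>V. \<bar>h a T\<bar> \<le> C * p T)"
  shows "continuous_map (prod_topology (euclidean :: 'm topology) (seminorm_topology V Q)) euclideanreal (\<lambda>(a, T). h a T)"
proof -
  have "continuous_map (prod_topology (euclidean :: 'm topology) (seminorm_topology V Q)) (seminorm_topology UNIV {norm})
    (\<lambda>(a, T). h a T)"
  proof (rule continuous_map_into_seminorm_topology)
    fix z p and e :: real
    assume z: "z \<in> topspace (prod_topology (euclidean :: 'm topology) (seminorm_topology V Q))" "p \<in> {norm :: real \<Rightarrow> real}" "0 < e"
    obtain a0 T0 where z0: "z = (a0, T0)" by (cases z)
    then have T0: "T0 \<in> V" using z by simp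
    obtain q C d where q: "q \<in> Q" "C > 0" "d > 0" "seminorm_on V q"
      "\<And>a T. a \<in> ball a0 d \<Longrightarrow> T \<in> V \<Longrightarrow> \<bar>h a T\<bar> \<le> C * q T"
      using bnd[of a0] by blast
    obtain d' where d': "d' > 0" "\<And>a. dist a a0 < d' \<Longrightarrow> dist (h a T0) (h a0 T0) < e / 2"
      using cont[OF T0] \<open>0 < e\<close> unfolding continuous_on_iff by (metis UNIV_I half_gt_zero)
    define U where "U = ball a0 (min d d') \<times> {T \<in> V. q (T - T0) < e / (2 * C)}"
    have "q 0 = 0" by (rule seminorm_on_0[OF q(4) V])
    then have "z \<in> U"
      using q d' z T0 by (auto simp: U_def z0)
    moreover have "openin (prod_topology (euclidean :: 'm topology) (seminorm_topology V Q)) U"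
      unfolding U_def using openin_seminorm_ball[OF V q(4,1) T0] by (simp add: openin_prod_Times_iff)
    moreover have "\<bar>h a T - h a0 T0\<bar> < e" if "(a, T) \<in> U" for a T
    proof -
      have "\<bar>h a (T - T0)\<bar> \<le> C * q (T - T0)"
        using that q T0 subspace_diff[OF V] by (auto simp: U_def)
      also have "\<dots> < e / 2"
        using that q by (auto simp: U_def field_simps)
      finally have "\<bar>h a T - h a T0\<bar> < e / 2"
        using diff that T0 by (auto simp: U_def)
      moreover have "\<bar>h a T0 - h a0 T0\<bar> < e / 2"
        using d'(2)[of a] that unfolding U_def dist_real_def by (simp add: dist_commute)
      ultimately show ?thesis by linarith
    qed
    ultimately show "\<exists>U. openin (prod_topology (euclidean :: 'm topology) (seminorm_topology V Q)) U \<and> z \<in> U \<and>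
        (\<forall>y\<in>U. p ((case y of (a, T) \<Rightarrow> h a T) - (case z of (a, T) \<Rightarrow> h a T)) < e)"
      using z z0 by (intro exI[of _ U]) auto
  qed auto
  then show ?thesis by (simp add: seminorm_topology_norm)
qed

section \<open>Spaces of test functions\<close>

lemma topspace_smooth_topology [simp]: "topspace smooth_topology = Collect smooth"
  by (simp add: smooth_topology_def)

lemma test_functions_in_iff:
  assumes "closed K"
  shows "\<theta> \<in> test_functions_in K \<longleftrightarrow> smooth \<theta> \<and> (\<forall>x. x \<notin> K \<longrightarrow> \<theta> x = 0)"
proof -
  have "closure {x. \<theta> x \<noteq> 0} \<subseteq> K \<longleftrightarrow> {x. \<theta> x \<noteq> 0} \<subseteq> K"
    using closure_minimal[OF _ assms] closure_subset[of "{x. \<theta> x \<noteq> 0}"] by (meson order_trans)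
  also have "\<dots> \<longleftrightarrow> (\<forall>x. x \<notin> K \<longrightarrow> \<theta> x = 0)" by blast
  finally show ?thesis by (simp add: test_functions_in_def)
qed

lemma subspace_test_functions_in:
  assumes "closed K"
  shows "subspace (test_functions_in K)"
  using subspace_smooth by (auto simp: subspace_def test_functions_in_iff[OF assms])

lemma topspace_test_topology_in [simp]: "topspace (test_topology_in K) = test_functions_in K"
  by (auto simp: test_topology_in_def test_functions_in_def)

lemma test_functions_in_mono: "K \<subseteq> L \<Longrightarrow> test_functions_in K \<subseteq> test_functions_in L"
  unfolding test_functions_in_def by (metis (mono_tags, lifting) Collect_mono order_trans)

lemma test_functionsE:
  assumes "\<theta> \<in> test_functions"
  obtains K where "compact K" "\<theta> \<in> test_functions_in K"
  using assms unfolding test_functions_def by blast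

lemma test_functionsI: "compact K \<Longrightarrow> \<theta> \<in> test_functions_in K \<Longrightarrow> \<theta> \<in> test_functions"
  unfolding test_functions_def by blast

lemma subspace_test_functions: "subspace test_functions"
  unfolding subspace_def
proof (intro conjI ballI allI)
  show "0 \<in> test_functions"
    by (rule test_functionsI[OF compact_empty subspace_0[OF subspace_test_functions_in]]) simp
next
  fix x y :: "'a \<Rightarrow> 'b" assume "x \<in> test_functions" "y \<in> test_functions"
  then obtain K L where K: "compact K" "x \<in> test_functions_in K" and L: "compact L" "y \<in> test_functions_in L"
    by (auto elim!: test_functionsE)
  have KL: "compact (K \<union> L)" using K L by (simp add: compact_Un)
  have "x \<in> test_functions_in (K \<union> L)" "y \<in> test_functions_in (K \<union> L)"
    using K(2) L(2) test_functions_in_mono[of K "K \<union> L"] test_functions_in_mono[of L "K \<union> L"] by auto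
  then show "x + y \<in> test_functions"
    by (intro test_functionsI[OF KL] subspace_add subspace_test_functions_in compact_imp_closed[OF KL])
next
  fix c and x :: "'a \<Rightarrow> 'b" assume "x \<in> test_functions"
  then obtain K where K: "compact K" "x \<in> test_functions_in K"
    by (rule test_functionsE)
  then show "c *\<^sub>R x \<in> test_functions"
    by (intro test_functionsI[OF K(1)] subspace_scale subspace_test_functions_in compact_imp_closed)
qed

lemma test_functions_in_subset_test_functions:
  "compact K \<Longrightarrow> test_functions_in K \<subseteq> test_functions"
  using test_functionsI by blast

text \<open>The whole space is itself a convex balanced set with open traces, hence a neighbourhood of each
  of its points.\<close>

lemma subset_topspace_test_topology:
  "(test_functions :: ('a::euclidean_space \<Rightarrow> 'b::real_normed_vector) set) \<subseteq> topspace test_topology"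
proof -
  let ?V = "test_functions :: ('a \<Rightarrow> 'b) set"
  have "openin (test_topology_in K) (?V \<inter> topspace (test_topology_in K))" if "compact K" for K
  proof -
    have "?V \<inter> topspace (test_topology_in K) = topspace (test_topology_in K)"
      using test_functions_in_subset_test_functions[OF that] by auto
    then show ?thesis by (simp del: topspace_test_topology_in)
  qed
  then have traces: "\<forall>X\<in>{test_topology_in K | K. compact K}. openin X (?V \<inter> topspace X)"
    by blast
  have sub: "subspace ?V" by (rule subspace_test_functions)
  have "0 \<in> ?V" "convex ?V" "\<forall>c. \<bar>c\<bar> \<le> 1 \<longrightarrow> (*\<^sub>R) c ` ?V \<subseteq> ?V"
    using subspace_0[OF sub] subspace_imp_convex[OF sub] subspace_scale[OF sub]
    by (simp_all add: image_subset_iff)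
  moreover have "(+) x ` ?V \<subseteq> ?V" if "x \<in> ?V" for x
    using subspace_add[OF sub that] by (simp add: image_subset_iff)
  ultimately have "openin test_topology ?V"
    unfolding test_topology_def openin_lc_inductive_limit using traces
    by (intro conjI ballI exI[of _ ?V]) simp_all
  then show ?thesis by (rule openin_subset)
qed

text \<open>A set is bounded as soon as every seminorm is bounded on it; only the finitely many seminorms
  that describe a given neighbourhood of zero matter at a time.\<close>

lemma neighbourhood_of_zero_absorbs:
  assumes S: "S \<subseteq> Collect smooth"
    and bnd: "\<And>j K. compact K \<Longrightarrow> K \<noteq> {} \<Longrightarrow> bdd_above (deriv_seminorm j K ` S)"
    and U: "openin smooth_topology U" "0 \<in> U"
  shows "\<exists>s>0. \<forall>t>s. \<forall>\<theta>\<in>S. (1 / t) *\<^sub>R \<theta> \<in> U"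
proof -
  obtain F e where F: "finite F" "F \<subseteq> {deriv_seminorm j K | j K. compact K \<and> K \<noteq> {}}" "e > 0"
    "{\<theta> \<in> Collect smooth. \<forall>p\<in>F. p (\<theta> - 0) < e} \<subseteq> U"
    using U unfolding smooth_topology_def openin_seminorm_topology by blast
  have "\<forall>p\<in>F. \<exists>M. \<forall>\<theta>\<in>S. p \<theta> \<le> M"
  proof
    fix p assume "p \<in> F"
    then obtain j K where "p = deriv_seminorm j K" "compact K" "K \<noteq> {}" using F(2) by blast
    then show "\<exists>M. \<forall>\<theta>\<in>S. p \<theta> \<le> M" using bnd[of K j] by (auto simp: bdd_above_def)
  qed
  then obtain M where M: "\<And>p \<theta>. p \<in> F \<Longrightarrow> \<theta> \<in> S \<Longrightarrow> p \<theta> \<le> M p"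
    by metis
  define C where "C = (\<Sum>p\<in>F. \<bar>M p\<bar>) + 1"
  have C: "p \<theta> < C" if "p \<in> F" "\<theta> \<in> S" for p \<theta>
  proof -
    have "\<bar>M p\<bar> \<le> (\<Sum>p\<in>F. \<bar>M p\<bar>)"
      using that F(1) by (intro member_le_sum) auto
    then show ?thesis using M[OF that] by (simp add: C_def)
  qed
  have "C > 0" by (simp add: C_def add_nonneg_pos sum_nonneg)
  have "(1 / t) *\<^sub>R \<theta> \<in> U" if t: "t > C / e" and \<theta>: "\<theta> \<in> S" for t \<theta>
  proof -
    have "t > 0" using t \<open>C > 0\<close> F(3) by (meson divide_pos_pos less_trans)
    have sm: "smooth \<theta>" using S \<theta> by blast
    have "p ((1 / t) *\<^sub>R \<theta>) < e" if pF: "p \<in> F" for p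
    proof -
      have "p ((1 / t) *\<^sub>R \<theta>) = p \<theta> / t"
      proof -
        obtain j K where "p = deriv_seminorm j K" "compact K" "K \<noteq> {}" using F(2) pF by blast
        then show ?thesis using \<open>t > 0\<close> by (simp add: deriv_seminorm_scaleR[OF sm])
      qed
      also have "\<dots> < C / t"
        using C[OF pF \<theta>] \<open>t > 0\<close> by (simp add: divide_strict_right_mono)
      also have "\<dots> < e" using t \<open>t > 0\<close> F(3) by (simp add: field_simps)
      finally show ?thesis .
    qed
    then show ?thesis
      using F(4) smooth_scaleR[OF sm] by auto
  qed
  then show ?thesis
    using \<open>C > 0\<close> F(3) by (intro exI[of _ "C / e"]) auto
qed

lemma mem_scaled_set:
  fixes \<theta> :: "'v::real_vector"
  assumes "(1 / t) *\<^sub>R \<theta> \<in> U" "t \<noteq> (0::real)"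
  shows "\<theta> \<in> (*\<^sub>R) t ` U"
  using assms by (intro image_eqI[of _ _ "(1 / t) *\<^sub>R \<theta>"]) auto

lemma von_neumann_bounded_smooth_topologyI:
  assumes "S \<subseteq> Collect smooth"
    and "\<And>j K. compact K \<Longrightarrow> K \<noteq> {} \<Longrightarrow> bdd_above (deriv_seminorm j K ` S)"
  shows "von_neumann_bounded smooth_topology S"
  unfolding von_neumann_bounded_def
proof (intro conjI allI impI)
  fix U :: "('a \<Rightarrow> 'b) set"
  assume "openin smooth_topology U \<and> 0 \<in> U"
  then have "\<exists>s>0. \<forall>t>s. \<forall>\<theta>\<in>S. (1 / t) *\<^sub>R \<theta> \<in> U"
    by (intro neighbourhood_of_zero_absorbs assms) auto
  then obtain s where "s > 0" "\<forall>t>s. \<forall>\<theta>\<in>S. (1 / t) *\<^sub>R \<theta> \<in> U"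
    by metis
  then show "\<exists>s>0. \<forall>t>s. S \<subseteq> (*\<^sub>R) t ` U"
    by (intro exI[of _ s]) (auto intro!: mem_scaled_set)
qed (use assms in auto)

text \<open>Only the trace of a neighbourhood on the functions supported in \<open>K0\<close> matters, and there the
  topology is that of the smooth functions.\<close>

lemma von_neumann_bounded_test_topologyI:
  assumes K0: "compact K0" and S: "S \<subseteq> test_functions_in K0"
    and bnd: "\<And>j K. compact K \<Longrightarrow> K \<noteq> {} \<Longrightarrow> bdd_above (deriv_seminorm j K ` S)"
  shows "von_neumann_bounded test_topology S"
  unfolding von_neumann_bounded_def
proof (intro conjI allI impI)
  show "S \<subseteq> topspace test_topology"
    using S test_functions_in_subset_test_functions[OF K0] subset_topspace_test_topology by blast
  fix U :: "('a \<Rightarrow> 'b) set"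
  assume "openin test_topology U \<and> 0 \<in> U"
  then obtain W where W: "0 \<in> W" "\<forall>X\<in>{test_topology_in K | K. compact K}. openin X (W \<inter> topspace X)"
      "(+) 0 ` W \<subseteq> U"
    unfolding test_topology_def openin_lc_inductive_limit by meson
  have "openin (test_topology_in K0) (W \<inter> topspace (test_topology_in K0))"
    using W(2) K0 by blast
  then obtain U' where U': "openin smooth_topology U'" "W \<inter> test_functions_in K0 = U' \<inter> test_functions_in K0"
    unfolding topspace_test_topology_in unfolding test_topology_in_def openin_subtopology by blast
  have sub: "subspace (test_functions_in K0 :: ('a \<Rightarrow> 'b) set)"
    using K0 by (intro subspace_test_functions_in compact_imp_closed)
  have "S \<subseteq> Collect smooth" using S by (auto simp: test_functions_in_def)
  moreover have "0 \<in> U'" using W(1) U'(2) subspace_0[OF sub] by (metis IntD1 IntI)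
  ultimately have "\<exists>s>0. \<forall>t>s. \<forall>\<theta>\<in>S. (1 / t) *\<^sub>R \<theta> \<in> U'"
    by (intro neighbourhood_of_zero_absorbs bnd U'(1))
  then obtain s where s: "s > 0" "\<And>t \<theta>. t > s \<Longrightarrow> \<theta> \<in> S \<Longrightarrow> (1 / t) *\<^sub>R \<theta> \<in> U'"
    by metis
  have "(1 / t) *\<^sub>R \<theta> \<in> U" if t: "t > s" and \<theta>: "\<theta> \<in> S" for t \<theta>
  proof -
    have "(1 / t) *\<^sub>R \<theta> \<in> test_functions_in K0"
      using S \<theta> by (intro subspace_scale[OF sub]) auto
    then have "(1 / t) *\<^sub>R \<theta> \<in> W"
      using s(2)[OF t \<theta>] U'(2) by (metis IntD1 IntI)
    then show ?thesis using W(3) by auto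
  qed
  then show "\<exists>s>0. \<forall>t>s. S \<subseteq> (*\<^sub>R) t ` U"
    using s by (intro exI[of _ s]) (auto intro!: mem_scaled_set)
qed

section \<open>Translates and dilates of a test function\<close>

lemma continuous_iterated_deriv_affine:
  assumes "smooth \<theta>"
  shows "continuous_on S (\<lambda>(x, a). iterated_deriv (\<lambda>x. \<theta> ((x - a) /\<^sub>R r)) bs x)"
proof -
  have "continuous_on S (\<lambda>z. (1 / r) ^ length bs *\<^sub>R iterated_deriv \<theta> bs ((fst z - snd z) /\<^sub>R r))"
    by (intro continuous_intros continuous_on_compose2[OF smooth_continuous_on[OF assms, of UNIV]]) auto
  then show ?thesis
    by (simp add: iterated_deriv_affine[OF assms] case_prod_unfold)
qed

text \<open>Each seminorm involves only a compact set of points \<open>x\<close>, so that uniform continuity of the finitely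
  many basic derivatives in \<open>(x, a)\<close> on a compact set gives the claim.\<close>

lemma continuous_map_affine_smooth_topology:
  fixes \<theta> :: "'a::euclidean_space \<Rightarrow> 'b::real_normed_vector"
  assumes \<theta>: "smooth \<theta>"
  shows "continuous_map euclidean smooth_topology (\<lambda>a x. \<theta> ((x - a) /\<^sub>R r))"
  unfolding smooth_topology_def
proof (rule continuous_map_into_seminorm_topology)
  show "(\<lambda>a x. \<theta> ((x - a) /\<^sub>R r)) \<in> topspace euclidean \<rightarrow> Collect smooth"
    using smooth_affine[OF \<theta>] by auto
  fix a0 :: 'a and p :: "('a \<Rightarrow> 'b) \<Rightarrow> real" and e :: real
  assume "p \<in> {deriv_seminorm j K | j K. compact K \<and> K \<noteq> {}}" "0 < e"
  then obtain j K where p: "p = deriv_seminorm j K" and K: "compact K" "K \<noteq> {}" by blast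
  define g where "g a = (\<lambda>x. \<theta> ((x - a) /\<^sub>R r))" for a
  have smg: "smooth (g a)" for a unfolding g_def by (rule smooth_affine[OF \<theta>])
  define F where "F = (\<lambda>(x, a). \<Sum>bs\<in>basis_lists j. norm (iterated_deriv (g a) bs x - iterated_deriv (g a0) bs x))"
  have "continuous_on (K \<times> cball a0 1) F"
    unfolding F_def case_prod_unfold
    using continuous_iterated_deriv_affine[OF \<theta>, of "K \<times> cball a0 1" r]
    by (intro continuous_intros continuous_on_compose2[OF smooth_continuous_on[OF smg, of UNIV]])
      (auto simp: g_def case_prod_unfold)
  then have "uniformly_continuous_on (K \<times> cball a0 1) F"
    using K by (intro compact_uniformly_continuous compact_Times) auto
  then obtain d where d: "d > 0" "\<And>z w. z \<in> K \<times> cball a0 1 \<Longrightarrow> w \<in> K \<times> cball a0 1 \<Longrightarrow> dist w z < d \<Longrightarrow> dist (F w) (F z) < e / 2"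
    using \<open>0 < e\<close> unfolding uniformly_continuous_on_def by (metis half_gt_zero)
  have "deriv_seminorm j K (g a - g a0) < e" if a: "a \<in> ball a0 (min 1 d)" for a
  proof -
    have "deriv_seminorm j K (g a - g a0) \<le> e / 2"
    proof (rule deriv_seminorm_le_basis)
      fix x assume x: "x \<in> K"
      have "dist (F (x, a)) (F (x, a0)) < e / 2"
        using a x d(1) by (intro d(2)) (auto simp: dist_commute dist_Pair_Pair)
      moreover have "F (x, a0) = 0" by (simp add: F_def)
      ultimately have "F (x, a) < e / 2" by simp
      then show "(\<Sum>bs\<in>basis_lists j. norm (iterated_deriv (g a - g a0) bs x)) \<le> e / 2"
        by (simp add: F_def iterated_deriv_diff[OF smg smg])
    qed (use K smooth_diff[OF smg smg] in auto)
    then show ?thesis using \<open>0 < e\<close> by simp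
  qed
  then show "\<exists>U. openin euclidean U \<and> a0 \<in> U \<and>
      (\<forall>a\<in>U. p ((\<lambda>x. \<theta> ((x - a) /\<^sub>R r)) - (\<lambda>x. \<theta> ((x - a0) /\<^sub>R r))) < e)"
    using d(1) by (intro exI[of _ "ball a0 (min 1 d)"]) (auto simp: p g_def)
qed

lemma bdd_above_deriv_seminorm_affine:
  assumes \<theta>: "smooth \<theta>" and K: "compact K" "K \<noteq> {}" and A: "compact A"
  shows "bdd_above (deriv_seminorm j K ` (\<lambda>a x. \<theta> ((x - a) /\<^sub>R r)) ` A)"
proof -
  define g where "g a = (\<lambda>x. \<theta> ((x - a) /\<^sub>R r))" for a
  define F where "F = (\<lambda>(x, a). \<Sum>bs\<in>basis_lists j. norm (iterated_deriv (g a) bs x))"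
  have "continuous_on (K \<times> A) F"
    unfolding F_def case_prod_unfold
    using continuous_iterated_deriv_affine[OF \<theta>, of "K \<times> A" r]
    by (intro continuous_intros) (auto simp: g_def case_prod_unfold)
  then have "bdd_above (F ` (K \<times> A))"
    using K A by (intro bounded_imp_bdd_above compact_imp_bounded compact_continuous_image compact_Times)
  then obtain M where M: "\<And>x a. x \<in> K \<Longrightarrow> a \<in> A \<Longrightarrow> F (x, a) \<le> M"
    by (force simp: bdd_above_def)
  have "deriv_seminorm j K (g a) \<le> M" if "a \<in> A" for a
    using M[OF _ that] smooth_affine[OF \<theta>] K
    by (intro deriv_seminorm_le_basis) (auto simp: g_def F_def)
  then show ?thesis by (auto simp: g_def bdd_above_def)
qed

text \<open>A common compact support for all centres near \<open>a0\<close>; it is what keeps the argument inside one of the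
  spaces that make up the inductive limit.\<close>

lemma affine_mem_test_functions_in:
  fixes a :: "'a::euclidean_space"
  assumes \<theta>: "\<theta> \<in> test_functions_in (cball 0 1)" and r: "r > 0" and a: "a \<in> cball a0 d"
  shows "(\<lambda>x. \<theta> ((x - a) /\<^sub>R r)) \<in> test_functions_in (cball a0 (d + r))"
proof -
  have sm: "smooth \<theta>" and z: "\<And>x. x \<notin> cball 0 1 \<Longrightarrow> \<theta> x = 0"
    using \<theta> test_functions_in_iff[of "cball 0 1"] by auto
  have "\<theta> ((x - a) /\<^sub>R r) = 0" if "x \<notin> cball a0 (d + r)" for x
  proof (rule z)
    have "dist a0 x \<le> dist a0 a + dist a x" by (rule dist_triangle)
    then have "r < norm (x - a)"
      using that a by (simp add: dist_norm norm_minus_commute)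
    then have "1 < inverse r * norm (x - a)"
      using r by (simp add: field_simps)
    then show "(x - a) /\<^sub>R r \<notin> cball 0 1"
      using r by (simp del: scaleR_right_diff_distrib)
  qed
  then show ?thesis
    using smooth_affine[OF sm] by (simp add: test_functions_in_iff)
qed

lemma affine_mem_test_functions:
  fixes a :: "'a::euclidean_space"
  assumes \<theta>: "\<theta> \<in> test_functions_in (cball 0 1)" and r: "r > 0"
  shows "(\<lambda>x. \<theta> ((x - a) /\<^sub>R r)) \<in> test_functions"
  using affine_mem_test_functions_in[OF assms, of a a 1]
    test_functions_in_subset_test_functions[of "cball a (1 + r)"] by auto

section \<open>Distributions\<close>

lemma linear_functional_on_diff:
  assumes "linear_functional_on V T" "subspace V" "x \<in> V" "y \<in> V"
  shows "T (x - y) = T x - T y"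
proof -
  have "T (x - y) + T y = T (x - y + y)"
    using assms subspace_diff unfolding linear_functional_on_def by metis
  then show ?thesis by simp
qed

lemma linear_functional_on_add: "linear_functional_on V S \<Longrightarrow> linear_functional_on V T \<Longrightarrow> linear_functional_on V (S + T)"
  and linear_functional_on_scaleR: "linear_functional_on V T \<Longrightarrow> linear_functional_on V (c *\<^sub>R T)"
  and linear_functional_on_0: "linear_functional_on V 0"
  by (simp_all add: linear_functional_on_def algebra_simps)

lemma continuous_map_add_fun:
  "continuous_map X euclideanreal S \<Longrightarrow> continuous_map X euclideanreal T \<Longrightarrow> continuous_map X euclideanreal (S + T)"
  unfolding plus_fun_def by (rule continuous_map_add)

lemma continuous_map_scaleR_fun:
  "continuous_map X euclideanreal T \<Longrightarrow> continuous_map X euclideanreal (c *\<^sub>R T)"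
  unfolding scaleR_fun_def by (simp add: continuous_map_real_mult_left)

lemma continuous_map_0_fun: "continuous_map X euclideanreal 0"
  by (simp add: zero_fun_def)

lemma subspace_distributions: "subspace distributions"
  unfolding subspace_def distributions_def
  by (auto intro!: linear_functional_on_add linear_functional_on_scaleR linear_functional_on_0
      continuous_map_add_fun continuous_map_scaleR_fun continuous_map_0_fun)

lemma subspace_compact_distributions: "subspace compact_distributions"
  unfolding subspace_def compact_distributions_def
  by (auto intro!: linear_functional_on_add linear_functional_on_scaleR linear_functional_on_0
      continuous_map_add_fun continuous_map_scaleR_fun continuous_map_0_fun)

lemma compact_distribution_affine_continuous:
  assumes T: "T \<in> compact_distributions" and \<theta>: "smooth \<theta>"
  shows "continuous_on UNIV (\<lambda>a. T (\<lambda>x. \<theta> ((x - a) /\<^sub>R r)))"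
proof -
  have "continuous_map smooth_topology euclideanreal T"
    using T by (simp add: compact_distributions_def)
  from continuous_map_compose[OF continuous_map_affine_smooth_topology[OF \<theta>] this]
  show ?thesis by (simp add: o_def)
qed

text \<open>Continuity is a local matter, and for \<open>a\<close> in \<open>cball a0 1\<close> all the functions are supported in the
  fixed compact set \<open>cball a0 (1 + r)\<close>, where \<open>T\<close> is known to be continuous.\<close>

lemma distribution_affine_continuous:
  fixes \<theta> :: "'a::euclidean_space \<Rightarrow> 'b::real_normed_vector"
  assumes T: "T \<in> distributions" and \<theta>: "\<theta> \<in> test_functions_in (cball 0 1)" and r: "r > 0"
  shows "continuous_on UNIV (\<lambda>a. T (\<lambda>x. \<theta> ((x - a) /\<^sub>R r)))"
proof -
  have sm: "smooth \<theta>" using \<theta> by (simp add: test_functions_in_def)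
  have "isCont (\<lambda>a. T (\<lambda>x. \<theta> ((x - a) /\<^sub>R r))) a0" for a0
  proof -
    have "continuous_map (test_topology_in (cball a0 (1 + r))) euclideanreal T"
      using T by (simp add: distributions_def)
    moreover have "continuous_map (top_of_set (cball a0 1)) (test_topology_in (cball a0 (1 + r)))
        (\<lambda>a x. \<theta> ((x - a) /\<^sub>R r))"
      unfolding test_topology_in_def continuous_map_in_subtopology
      using affine_mem_test_functions_in[OF \<theta> r] continuous_map_affine_smooth_topology[OF sm]
      by (auto intro: continuous_map_from_subtopology)
    ultimately have "continuous_map (top_of_set (cball a0 1)) euclideanreal
        (T \<circ> (\<lambda>a x. \<theta> ((x - a) /\<^sub>R r)))"
      using continuous_map_compose by blast
    then have "continuous_on (cball a0 1) (\<lambda>a. T (\<lambda>x. \<theta> ((x - a) /\<^sub>R r)))"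
      by (simp add: o_def)
    then show ?thesis
      by (rule continuous_on_interior) simp
  qed
  then show ?thesis by (simp add: continuous_at_imp_continuous_on)
qed

lemma von_neumann_bounded_affine_smooth:
  assumes \<theta>: "smooth \<theta>" and A: "compact A"
  shows "von_neumann_bounded smooth_topology ((\<lambda>a x. \<theta> ((x - a) /\<^sub>R r)) ` A)"
  using smooth_affine[OF \<theta>]
  by (intro von_neumann_bounded_smooth_topologyI bdd_above_deriv_seminorm_affine \<theta> A) auto

lemma von_neumann_bounded_affine_test:
  fixes \<theta> :: "'a::euclidean_space \<Rightarrow> 'b::real_normed_vector"
  assumes \<theta>: "\<theta> \<in> test_functions_in (cball 0 1)" and r: "r > 0"
  shows "von_neumann_bounded test_topology ((\<lambda>a x. \<theta> ((x - a) /\<^sub>R r)) ` cball a0 1)"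
proof -
  have sm: "smooth \<theta>" using \<theta> by (simp add: test_functions_in_def)
  show ?thesis
    using affine_mem_test_functions_in[OF \<theta> r]
    by (intro von_neumann_bounded_test_topologyI[of "cball a0 (1 + r)"] bdd_above_deriv_seminorm_affine sm) auto
qed

lemma seminorm_on_SUP_abs:
  assumes S: "S \<noteq> {}" and bdd: "\<And>T. T \<in> V \<Longrightarrow> bdd_above ((\<lambda>x. \<bar>T x\<bar>) ` S)"
  shows "seminorm_on V (\<lambda>T. SUP x\<in>S. \<bar>T x\<bar>)"
  unfolding seminorm_on_def
proof (intro conjI ballI allI)
  fix T T' assume T: "T \<in> V" "T' \<in> V"
  show "(SUP x\<in>S. \<bar>(T + T') x\<bar>) \<le> (SUP x\<in>S. \<bar>T x\<bar>) + (SUP x\<in>S. \<bar>T' x\<bar>)"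
  proof (rule cSUP_least[OF S])
    fix x assume x: "x \<in> S"
    show "\<bar>(T + T') x\<bar> \<le> (SUP x\<in>S. \<bar>T x\<bar>) + (SUP x\<in>S. \<bar>T' x\<bar>)"
      using cSUP_upper[OF x bdd[OF T(1)]] cSUP_upper[OF x bdd[OF T(2)]] by simp
  qed
next
  fix c T assume T: "T \<in> V"
  have le: "(SUP x\<in>S. \<bar>(c *\<^sub>R T) x\<bar>) \<le> \<bar>c\<bar> * (SUP x\<in>S. \<bar>T x\<bar>)"
  proof (rule cSUP_least[OF S])
    fix x assume x: "x \<in> S"
    show "\<bar>(c *\<^sub>R T) x\<bar> \<le> \<bar>c\<bar> * (SUP x\<in>S. \<bar>T x\<bar>)"
      using mult_left_mono[OF cSUP_upper[OF x bdd[OF T]], of "\<bar>c\<bar>"] by (simp add: abs_mult)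
  qed
  have bdd': "bdd_above ((\<lambda>x. \<bar>(c *\<^sub>R T) x\<bar>) ` S)"
  proof -
    obtain M where M: "\<And>x. x \<in> S \<Longrightarrow> \<bar>T x\<bar> \<le> M" using bdd[OF T] by (auto simp: bdd_above_def)
    show ?thesis
    proof (rule bdd_aboveI2)
      fix x assume "x \<in> S"
      then show "\<bar>(c *\<^sub>R T) x\<bar> \<le> \<bar>c\<bar> * M"
        using mult_left_mono[OF M, of x "\<bar>c\<bar>"] by (simp add: abs_mult)
    qed
  qed
  have "\<bar>c\<bar> * (SUP x\<in>S. \<bar>T x\<bar>) \<le> (SUP x\<in>S. \<bar>(c *\<^sub>R T) x\<bar>)"
  proof (cases "c = 0")
    case True
    then show ?thesis using S by simp
  next
    case False
    have "(SUP x\<in>S. \<bar>T x\<bar>) \<le> (SUP x\<in>S. \<bar>(c *\<^sub>R T) x\<bar>) / \<bar>c\<bar>"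
    proof (rule cSUP_least[OF S])
      fix x assume x: "x \<in> S"
      show "\<bar>T x\<bar> \<le> (SUP x\<in>S. \<bar>(c *\<^sub>R T) x\<bar>) / \<bar>c\<bar>"
        using cSUP_upper[OF x bdd'] False by (simp add: field_simps abs_mult)
    qed
    then show ?thesis using False by (simp add: field_simps)
  qed
  with le show "(SUP x\<in>S. \<bar>(c *\<^sub>R T) x\<bar>) = \<bar>c\<bar> * (SUP x\<in>S. \<bar>T x\<bar>)" by simp
qed

text \<open>The supremum over the bounded set \<open>g ` cball a0 1\<close> is one of the seminorms of the strong topology,
  and it dominates \<open>\<bar>T (g a)\<bar>\<close> for \<open>a\<close> near \<open>a0\<close>.\<close>

lemma continuous_map_strong_pairing:
  fixes g :: "'m::euclidean_space \<Rightarrow> 'v::real_vector"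
  assumes V: "subspace V"
    and cont: "\<And>T. T \<in> V \<Longrightarrow> continuous_on UNIV (\<lambda>a. T (g a))"
    and bounded: "\<And>a0. von_neumann_bounded X (g ` cball a0 1)"
  shows "continuous_map (prod_topology euclidean (strong_topology X V)) euclideanreal (\<lambda>(a, T). T (g a))"
  unfolding strong_topology_def
proof (rule continuous_map_pairing[OF V])
  fix a0
  let ?S = "g ` cball a0 1"
  let ?p = "\<lambda>T. SUP x\<in>?S. \<bar>T x\<bar>"
  have bdd: "bdd_above ((\<lambda>x. \<bar>T x\<bar>) ` ?S)" if "T \<in> V" for T
  proof -
    have "compact ((\<lambda>a. \<bar>T (g a)\<bar>) ` cball a0 1)"
      by (intro compact_continuous_image continuous_intros continuous_on_subset[OF cont[OF that]]) auto
    then show ?thesis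
      by (simp add: image_image bounded_imp_bdd_above compact_imp_bounded)
  qed
  have "\<bar>T (g a)\<bar> \<le> ?p T" if "a \<in> ball a0 1" "T \<in> V" for a T
    using that by (intro cSUP_upper bdd) auto
  moreover have "seminorm_on V ?p"
    by (rule seminorm_on_SUP_abs) (use bdd in auto)
  moreover have "?S \<noteq> {}" by simp
  ultimately show "\<exists>p\<in>{\<lambda>T. SUP x\<in>S. \<bar>T x\<bar> | S. von_neumann_bounded X S \<and> S \<noteq> {}}.
      \<exists>C>0. \<exists>d>0. seminorm_on V p \<and> (\<forall>a\<in>ball a0 d. \<forall>T\<in>V. \<bar>T (g a)\<bar> \<le> C * p T)"
    using bounded[of a0]
    by (intro bexI[of _ ?p] exI[of _ 1] conjI) auto
qed (use cont in auto)

lemma continuous_map_compact_distributions_affine: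
  fixes \<theta> :: "'a::euclidean_space \<Rightarrow> 'b::real_normed_vector"
  assumes "smooth \<theta>"
  shows "continuous_map (prod_topology euclidean compact_distributions_b) euclideanreal
    (\<lambda>(a, T). T (\<lambda>x. \<theta> ((x - a) /\<^sub>R r)))"
  unfolding compact_distributions_b_def
  by (intro continuous_map_strong_pairing subspace_compact_distributions
      compact_distribution_affine_continuous von_neumann_bounded_affine_smooth assms) auto

lemma continuous_map_distributions_affine:
  fixes \<theta> :: "'a::euclidean_space \<Rightarrow> 'b::real_normed_vector"
  assumes "\<theta> \<in> test_functions_in (cball 0 1)" "r > 0"
  shows "continuous_map (prod_topology euclidean distributions_b) euclideanreal
    (\<lambda>(a, T). T (\<lambda>x. \<theta> ((x - a) /\<^sub>R r)))"
  unfolding distributions_b_def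
  by (intro continuous_map_strong_pairing subspace_distributions
      distribution_affine_continuous von_neumann_bounded_affine_test assms) auto

lemma seminorm_on_deriv_seminorm:
  assumes "compact K" "K \<noteq> {}"
  shows "seminorm_on (Collect smooth) (deriv_seminorm j K)"
  unfolding seminorm_on_def
  using deriv_seminorm_add[OF _ _ assms] deriv_seminorm_scaleR[OF _ assms] by blast

text \<open>Stated on a subspace \<open>W\<close> so as to cover functionals on the test functions with support in a
  given compact set as well as functionals on all smooth functions.\<close>

lemma continuous_map_functional_of_seminorm_bound:
  assumes V: "subspace V" and W: "subspace W" "W \<subseteq> V" and p: "seminorm_on V p"
    and q: "finite I" "\<And>i. i \<in> I \<Longrightarrow> q i \<in> Q" "\<And>x. x \<in> V \<Longrightarrow> p x \<le> (\<Sum>i\<in>I. q i x)"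
    and T: "linear_functional_on W T" and bnd: "\<And>x. x \<in> W \<Longrightarrow> \<bar>T x\<bar> \<le> C * p x"
  shows "continuous_map (subtopology (seminorm_topology V Q) W) euclideanreal T"
proof -
  have "continuous_map (subtopology (seminorm_topology V Q) W) (seminorm_topology UNIV {norm}) T"
  proof (rule continuous_map_into_seminorm_topology)
    fix x r and e :: real
    assume x: "x \<in> topspace (subtopology (seminorm_topology V Q) W)" and r: "r \<in> {norm :: real \<Rightarrow> real}" and e: "0 < e"
    have xW: "x \<in> W" using x by simp
    let ?U = "{y \<in> V. p (y - x) < e / (\<bar>C\<bar> + 1)} \<inter> W"
    have "openin (subtopology (seminorm_topology V Q) W) ?U"
      using openin_seminorm_ball_of_dominated[of V p I q Q x, OF V p q] xW W(2)
      unfolding openin_subtopology by blast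
    moreover have "x \<in> ?U"
    proof -
      have "p 0 = 0" by (rule seminorm_on_0[OF p V])
      then show ?thesis using xW W(2) e by (auto intro: divide_pos_pos)
    qed
    moreover have "\<bar>T y - T x\<bar> < e" if y: "y \<in> ?U" for y
    proof -
      have d: "y - x \<in> W" using y xW by (intro subspace_diff[OF W(1)]) auto
      have p0: "0 \<le> p (y - x)" using d W(2) by (intro seminorm_on_nonneg[OF p V]) auto
      have "T y - T x = T (y - x)"
        using linear_functional_on_diff[OF T W(1)] y xW by simp
      then have "\<bar>T y - T x\<bar> \<le> C * p (y - x)" using bnd[OF d] by simp
      also have "\<dots> \<le> (\<bar>C\<bar> + 1) * p (y - x)"
        using p0 by (intro mult_right_mono) auto
      also have "\<dots> < e" using y by (simp add: field_simps)
      finally show ?thesis .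
    qed
    ultimately show "\<exists>U. openin (subtopology (seminorm_topology V Q) W) U \<and> x \<in> U \<and> (\<forall>y\<in>U. r (T y - T x) < e)"
      using r by (intro exI[of _ ?U]) auto
  qed auto
  then show ?thesis by (simp add: seminorm_topology_norm)
qed

section \<open>Polynomial functions\<close>

abbreviation monomial :: "'a::euclidean_space list \<Rightarrow> 'a \<Rightarrow> real"
  where "monomial bs x \<equiv> prod_list (map ((\<bullet>) x) bs)"

lemma multilinear_expansion:
  fixes \<psi> :: "'a::euclidean_space list \<Rightarrow> 'b::real_vector"
  assumes "\<forall>vs i. length vs = m \<and> i < m \<longrightarrow> linear (\<lambda>v. \<psi> (vs[i := v]))"
  shows "\<psi> (replicate m x) = (\<Sum>bs\<in>basis_lists m. monomial bs x *\<^sub>R \<psi> bs)"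
  using assms
proof (induction m arbitrary: \<psi>)
  case (Suc m)
  let ?xs = "replicate m x"
  have "linear (\<lambda>v. \<psi> ((x # ?xs)[0 := v]))"
    using Suc(2) by (metis length_Cons length_replicate zero_less_Suc)
  then have lin: "linear (\<lambda>v. \<psi> (v # ?xs))" by simp
  have IH: "\<psi> (b # ?xs) = (\<Sum>bs\<in>basis_lists m. monomial bs x *\<^sub>R \<psi> (b # bs))" for b
  proof (rule Suc(1)[of "\<lambda>vs. \<psi> (b # vs)"], intro allI impI)
    fix vs :: "'a list" and i assume "length vs = m \<and> i < m"
    then have "linear (\<lambda>v. \<psi> ((b # vs)[Suc i := v]))"
      using Suc(2) by (metis Suc_less_eq length_Cons)
    then show "linear (\<lambda>v. \<psi> (b # vs[i := v]))" by simp
  qed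
  have "\<psi> (replicate (Suc m) x) = \<psi> ((\<Sum>b\<in>Basis. (x \<bullet> b) *\<^sub>R b) # ?xs)"
    by (simp add: euclidean_representation)
  also have "\<dots> = (\<Sum>b\<in>Basis. (x \<bullet> b) *\<^sub>R \<psi> (b # ?xs))"
    by (simp add: linear_sum[OF lin] linear_cmul[OF lin])
  also have "\<dots> = (\<Sum>bs\<in>basis_lists (Suc m). monomial bs x *\<^sub>R \<psi> bs)"
    by (simp add: IH sum_basis_lists_Suc scaleR_sum_right)
  finally show ?case .
qed simp

lemma poly_functions_expansion:
  fixes P :: "'a::euclidean_space \<Rightarrow> 'b::real_vector"
  assumes "P \<in> poly_functions k"
  obtains c where "P = (\<lambda>x. \<Sum>m\<in>{m. int m \<le> k}. \<Sum>bs\<in>basis_lists m. monomial bs x *\<^sub>R c bs)"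
proof -
  obtain \<psi> where \<psi>: "\<And>m. symmetric_multilinear m (\<psi> m)"
      "\<And>x. P x = (\<Sum>m\<in>{m. int m \<le> k}. \<psi> m (replicate m x))"
    using assms by (auto simp: poly_functions_def)
  have "\<psi> m (replicate m x) = (\<Sum>bs\<in>basis_lists m. monomial bs x *\<^sub>R \<psi> (length bs) bs)" for m x
  proof -
    have "\<psi> m (replicate m x) = (\<Sum>bs\<in>basis_lists m. monomial bs x *\<^sub>R \<psi> m bs)"
      using \<psi>(1)[of m] by (intro multilinear_expansion) (simp add: symmetric_multilinear_def)
    also have "\<dots> = (\<Sum>bs\<in>basis_lists m. monomial bs x *\<^sub>R \<psi> (length bs) bs)"
      by (rule sum.cong) (auto simp: basis_lists_def)
    finally show ?thesis .
  qed
  then have "P = (\<lambda>x. \<Sum>m\<in>{m. int m \<le> k}. \<Sum>bs\<in>basis_lists m. monomial bs x *\<^sub>R \<psi> (length bs) bs)"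
    by (simp add: \<psi>(2) fun_eq_iff)
  then show ?thesis by (rule that)
qed

lemma smooth_monomial: "smooth (\<lambda>x. monomial bs x *\<^sub>R c)"
proof (induction bs)
  case (Cons b bs)
  then have "smooth (\<lambda>x. (x \<bullet> b) *\<^sub>R (monomial bs x *\<^sub>R c))"
    by (rule smooth_inner_scaleR)
  then show ?case by simp
qed (simp add: smooth_const)

lemma smooth_sum: "(\<And>i. i \<in> I \<Longrightarrow> smooth (f i)) \<Longrightarrow> smooth (\<lambda>x. \<Sum>i\<in>I. f i x)"
proof (induction I rule: infinite_finite_induct)
  case (insert i I)
  then have "smooth (f i + (\<lambda>x. \<Sum>i\<in>I. f i x))"
    by (intro smooth_add) auto
  then show ?case using insert by (simp add: plus_fun_def)
qed (simp_all add: smooth_const)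

lemma smooth_poly_functions:
  assumes "P \<in> poly_functions k"
  shows "smooth P"
proof -
  obtain c where P: "P = (\<lambda>x. \<Sum>m\<in>{m. int m \<le> k}. \<Sum>bs\<in>basis_lists m. monomial bs x *\<^sub>R c bs)"
    using poly_functions_expansion[OF assms] .
  show ?thesis unfolding P by (intro smooth_sum smooth_monomial)
qed

lemma finite_degrees: "finite {m. int m \<le> k}"
  by (rule finite_subset[of _ "{..nat k}"]) auto

lemma monomial_scaleR: "monomial bs (s *\<^sub>R x) = s ^ length bs * monomial bs x"
  by (induction bs) auto

text \<open>Differentiating \<open>s \<mapsto> P(s u) = \<Sum>\<^sub>j s\<^sup>j q\<^sub>j\<close> in \<open>m\<close> steps; the \<open>m\<close>-fold derivative along \<open>u\<close> at zero is
  \<open>m! q\<^sub>m\<close>.\<close>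

lemma iterated_deriv_along_line:
  fixes P :: "'a::euclidean_space \<Rightarrow> 'b::real_normed_vector"
  assumes P: "smooth P" and q: "\<And>s. P (s *\<^sub>R u) = (\<Sum>j\<in>J. s ^ j *\<^sub>R q j)"
  shows "iterated_deriv P (replicate m u) (s *\<^sub>R u)
    = (\<Sum>j\<in>J. (\<Prod>i<m. real (j - i)) *\<^sub>R s ^ (j - m) *\<^sub>R q j)"
proof (induction m arbitrary: s)
  case (Suc m)
  have lin: "linear (\<lambda>v. iterated_deriv P (v # vs) x)" for vs x
    using smooth_has_derivative[OF P] has_derivative_linear by blast
  have "((\<lambda>s. s *\<^sub>R u) has_derivative (\<lambda>h. h *\<^sub>R u)) (at s)"
    by (rule derivative_eq_intros refl)+ auto
  from has_derivative_compose[OF this smooth_has_derivative[OF P]]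
  have "((\<lambda>s. iterated_deriv P (replicate m u) (s *\<^sub>R u)) has_derivative
      (\<lambda>h. iterated_deriv P (h *\<^sub>R u # replicate m u) (s *\<^sub>R u))) (at s)" .
  then have "((\<lambda>s. iterated_deriv P (replicate m u) (s *\<^sub>R u)) has_vector_derivative
      iterated_deriv P (u # replicate m u) (s *\<^sub>R u)) (at s)"
    unfolding has_vector_derivative_def linear_cmul[OF lin] .
  moreover have "((\<lambda>s. iterated_deriv P (replicate m u) (s *\<^sub>R u)) has_vector_derivative
      (\<Sum>j\<in>J. (\<Prod>i<m. real (j - i)) *\<^sub>R (real (j - m) * s ^ (j - m - 1)) *\<^sub>R q j)) (at s)"
    unfolding Suc.IH
    by (rule derivative_eq_intros refl)+ (auto intro!: derivative_eq_intros simp: mult_ac)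
  ultimately have "iterated_deriv P (u # replicate m u) (s *\<^sub>R u)
      = (\<Sum>j\<in>J. (\<Prod>i<m. real (j - i)) *\<^sub>R (real (j - m) * s ^ (j - m - 1)) *\<^sub>R q j)"
    by (rule vector_derivative_unique_at)
  then show ?case by (simp del: iterated_deriv.simps add: mult_ac)
qed (simp add: q)

text \<open>Write \<open>x = R u\<close> with \<open>\<parallel>u\<parallel> \<le> 1\<close> and \<open>P(R u) = \<Sum>\<^sub>m R\<^sup>m q\<^sub>m\<close>; since \<open>m! q\<^sub>m\<close> is a value of the \<open>m\<close>-th derivative at
  zero on unit vectors, \<open>\<parallel>q\<^sub>m\<parallel>\<close> is at most \<^term>\<open>deriv_norm m P 0\<close>.\<close>

lemma norm_poly_le_deriv_norms:
  fixes P :: "'a::euclidean_space \<Rightarrow> 'b::real_normed_vector"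
  assumes P: "P \<in> poly_functions k" and R: "1 \<le> R" "norm x \<le> R"
  shows "norm (P x) \<le> R ^ nat k * (\<Sum>m\<in>{m. int m \<le> k}. deriv_norm m P 0)"
proof -
  obtain c where c: "P = (\<lambda>x. \<Sum>m\<in>{m. int m \<le> k}. \<Sum>bs\<in>basis_lists m. monomial bs x *\<^sub>R c bs)"
    using poly_functions_expansion[OF P] .
  have sm: "smooth P" by (rule smooth_poly_functions[OF P])
  define u where "u = x /\<^sub>R R"
  have u: "norm u \<le> 1" "x = R *\<^sub>R u" using R by (auto simp: u_def field_simps)
  define q where "q m = (\<Sum>bs\<in>basis_lists m. monomial bs u *\<^sub>R c bs)" for m
  have Psu: "P (s *\<^sub>R u) = (\<Sum>m\<in>{m. int m \<le> k}. s ^ m *\<^sub>R q m)" for s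
    unfolding c q_def scaleR_sum_right monomial_scaleR
    by (intro sum.cong refl) (auto simp: basis_lists_def)
  have q: "norm (q m) \<le> deriv_norm m P 0" if m: "int m \<le> k" for m
  proof -
    let ?d = "\<lambda>j. \<Prod>i<m. real (j - i)"
    have "iterated_deriv P (replicate m u) 0 = (\<Sum>j\<in>{j. int j \<le> k}. ?d j *\<^sub>R 0 ^ (j - m) *\<^sub>R q j)"
      using iterated_deriv_along_line[OF sm Psu, of m 0] by simp
    also have "\<dots> = (\<Sum>j\<in>{j. int j \<le> k}. if j = m then ?d m *\<^sub>R q m else 0)"
    proof (intro sum.cong refl)
      fix j
      consider "j < m" | "j = m" | "j > m" by linarith
      then show "?d j *\<^sub>R 0 ^ (j - m) *\<^sub>R q j = (if j = m then ?d m *\<^sub>R q m else 0)"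
      proof cases
        case 1
        then have "?d j = 0" by (intro prod_zero) auto
        then show ?thesis using 1 by simp
      qed auto
    qed
    also have "\<dots> = ?d m *\<^sub>R q m" using m finite_degrees by simp
    finally have "norm (iterated_deriv P (replicate m u) 0) = \<bar>?d m\<bar> * norm (q m)"
      by (metis norm_scaleR)
    moreover have "1 * norm (q m) \<le> \<bar>?d m\<bar> * norm (q m)"
    proof (rule mult_right_mono)
      have "1 \<le> ?d m" by (rule prod_ge_1) auto
      then show "1 \<le> \<bar>?d m\<bar>" by linarith
    qed simp
    moreover have "norm (iterated_deriv P (replicate m u) 0) \<le> deriv_norm m P 0"
      using norm_iterated_deriv_le_deriv_norm[OF sm, of "replicate m u" 0] u by simp
    ultimately show ?thesis by simp
  qed
  have "norm (P x) \<le> (\<Sum>m\<in>{m. int m \<le> k}. norm (R ^ m *\<^sub>R q m))"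
    unfolding u(2) Psu by (rule norm_sum)
  also have "\<dots> \<le> (\<Sum>m\<in>{m. int m \<le> k}. R ^ nat k * deriv_norm m P 0)"
  proof (rule sum_mono)
    fix m assume "m \<in> {m. int m \<le> k}"
    then have "m \<le> nat k" "norm (q m) \<le> deriv_norm m P 0" using q by auto
    then show "norm (R ^ m *\<^sub>R q m) \<le> R ^ nat k * deriv_norm m P 0"
      using R by (auto intro!: mult_mono power_increasing)
  qed
  finally show ?thesis by (simp add: sum_distrib_left)
qed

lemma symmetric_multilinear_0: "symmetric_multilinear m (\<lambda>vs. 0)"
  by (simp add: symmetric_multilinear_def linear_zero)

lemma symmetric_multilinearD:
  assumes "symmetric_multilinear m \<psi>" "length vs = m"
  shows "i < m \<Longrightarrow> linear (\<lambda>v. \<psi> (vs[i := v]))" and "mset ws = mset vs \<Longrightarrow> \<psi> ws = \<psi> vs"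
  using assms unfolding symmetric_multilinear_def by blast+

lemma symmetric_multilinear_add:
  assumes "symmetric_multilinear m \<phi>" "symmetric_multilinear m \<psi>"
  shows "symmetric_multilinear m (\<lambda>vs. \<phi> vs + \<psi> vs)"
  unfolding symmetric_multilinear_def
proof (intro conjI allI impI; elim conjE)
  fix vs ws :: "'a list" assume "length vs = m" "mset ws = mset vs"
  then show "\<phi> ws + \<psi> ws = \<phi> vs + \<psi> vs"
    using symmetric_multilinearD(2)[OF assms(1)] symmetric_multilinearD(2)[OF assms(2)] by metis
qed (auto intro!: linear_compose_add symmetric_multilinearD(1)[OF assms(1)] symmetric_multilinearD(1)[OF assms(2)])

lemma symmetric_multilinear_scaleR:
  assumes "symmetric_multilinear m \<psi>"
  shows "symmetric_multilinear m (\<lambda>vs. c *\<^sub>R \<psi> vs)"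
  unfolding symmetric_multilinear_def
proof (intro conjI allI impI; elim conjE)
  fix vs ws :: "'a list" assume "length vs = m" "mset ws = mset vs"
  then show "c *\<^sub>R \<psi> ws = c *\<^sub>R \<psi> vs"
    using symmetric_multilinearD(2)[OF assms] by metis
qed (auto intro!: linear_compose_scale_right symmetric_multilinearD(1)[OF assms])

lemma subspace_poly_functions: "subspace (poly_functions k)"
  unfolding subspace_def
proof (intro conjI ballI allI)
  show "0 \<in> poly_functions k"
    unfolding poly_functions_def using symmetric_multilinear_0
    by (auto intro!: exI[of _ "\<lambda>m vs. 0"])
next
  fix P Q :: "'a \<Rightarrow> 'b" assume "P \<in> poly_functions k" "Q \<in> poly_functions k"
  then obtain \<phi> \<psi> where "\<And>m. symmetric_multilinear m (\<phi> m)" "\<And>m. symmetric_multilinear m (\<psi> m)"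
      "\<And>x. P x = (\<Sum>m\<in>{m. int m \<le> k}. \<phi> m (replicate m x))"
      "\<And>x. Q x = (\<Sum>m\<in>{m. int m \<le> k}. \<psi> m (replicate m x))"
    unfolding poly_functions_def by auto
  then show "P + Q \<in> poly_functions k"
    unfolding poly_functions_def
    by (auto intro!: exI[of _ "\<lambda>m vs. \<phi> m vs + \<psi> m vs"] symmetric_multilinear_add simp: sum.distrib)
next
  fix c and P :: "'a \<Rightarrow> 'b" assume "P \<in> poly_functions k"
  then obtain \<psi> where "\<And>m. symmetric_multilinear m (\<psi> m)"
      "\<And>x. P x = (\<Sum>m\<in>{m. int m \<le> k}. \<psi> m (replicate m x))"
    unfolding poly_functions_def by auto
  then show "c *\<^sub>R P \<in> poly_functions k"
    unfolding poly_functions_def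
    by (auto intro!: exI[of _ "\<lambda>m vs. c *\<^sub>R \<psi> m vs"] symmetric_multilinear_scaleR simp: scaleR_sum_right)
qed

lemma seminorm_on_poly_functions:
  "seminorm_on (poly_functions k :: ('a::euclidean_space \<Rightarrow> 'b::real_normed_vector) set)
    (\<lambda>P. \<Sum>m\<in>{m. int m \<le> k}. deriv_norm m P 0)"
proof -
  have eq: "deriv_norm m P 0 = deriv_seminorm m {0} P" for m and P :: "'a \<Rightarrow> 'b"
    by (simp add: deriv_seminorm_def)
  have "seminorm_on (Collect smooth) (\<lambda>P :: 'a \<Rightarrow> 'b. \<Sum>m\<in>{m. int m \<le> k}. deriv_seminorm m {0} P)"
    using seminorm_on_deriv_seminorm[of "{0 :: 'a}"] unfolding seminorm_on_def
    by (auto simp: sum_distrib_left sum.distrib[symmetric] intro!: sum_mono)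
  then show ?thesis
    unfolding eq by (rule seminorm_on_subset) (auto intro: smooth_poly_functions)
qed

section \<open>Polynomial functions as distributions\<close>

lemma
  fixes P :: "'a::euclidean_space \<Rightarrow> 'b::real_normed_vector \<Rightarrow>\<^sub>L real"
  assumes P: "smooth P" and \<theta>: "\<theta> \<in> test_functions_in K" and K: "compact K"
  shows integrable_smooth_test: "integrable lborel (\<lambda>x. blinfun_apply (P x) (\<theta> x))"
    and integral_smooth_test_le: "\<And>A B. (\<And>x. x \<in> K \<Longrightarrow> norm (P x) \<le> A) \<Longrightarrow> (\<And>x. x \<in> K \<Longrightarrow> norm (\<theta> x) \<le> B) \<Longrightarrow>
      0 \<le> A \<Longrightarrow> \<bar>\<integral>x. blinfun_apply (P x) (\<theta> x) \<partial>lborel\<bar> \<le> measure lborel K * (A * B)"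
proof -
  have sm: "smooth \<theta>" and z: "\<And>x. x \<notin> K \<Longrightarrow> \<theta> x = 0"
    using \<theta> test_functions_in_iff[OF compact_imp_closed[OF K]] by auto
  have "continuous_on K (\<lambda>x. blinfun_apply (P x) (\<theta> x))"
    using smooth_continuous_on[OF P, of K "[]"] smooth_continuous_on[OF sm, of K "[]"]
    by (intro continuous_intros) auto
  then have "integrable lborel (\<lambda>x. indicator K x *\<^sub>R blinfun_apply (P x) (\<theta> x))"
    by (rule borel_integrable_compact[OF K])
  moreover have "(\<lambda>x. indicator K x *\<^sub>R blinfun_apply (P x) (\<theta> x)) = (\<lambda>x. blinfun_apply (P x) (\<theta> x))"
    using z by (auto simp: fun_eq_iff indicator_def)
  ultimately show int: "integrable lborel (\<lambda>x. blinfun_apply (P x) (\<theta> x))" by simp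
  fix A B assume AB: "\<And>x. x \<in> K \<Longrightarrow> norm (P x) \<le> A" "\<And>x. x \<in> K \<Longrightarrow> norm (\<theta> x) \<le> B" "0 \<le> A"
  have "\<bar>\<integral>x. blinfun_apply (P x) (\<theta> x) \<partial>lborel\<bar> \<le> (\<integral>x. \<bar>blinfun_apply (P x) (\<theta> x)\<bar> \<partial>lborel)"
    using integral_norm_bound[of lborel "\<lambda>x. blinfun_apply (P x) (\<theta> x)"] by simp
  also have "\<dots> \<le> (\<integral>x. indicator K x *\<^sub>R (A * B) \<partial>lborel)"
  proof (rule integral_mono)
    show "integrable lborel (\<lambda>x. \<bar>blinfun_apply (P x) (\<theta> x)\<bar>)"
      using int by (rule integrable_abs)
    show "integrable lborel (\<lambda>x. indicator K x *\<^sub>R (A * B))"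
      by (rule borel_integrable_compact[OF K]) simp
    fix x
    show "\<bar>blinfun_apply (P x) (\<theta> x)\<bar> \<le> indicator K x *\<^sub>R (A * B)"
    proof (cases "x \<in> K")
      case True
      have "\<bar>blinfun_apply (P x) (\<theta> x)\<bar> \<le> norm (P x) * norm (\<theta> x)"
        using norm_blinfun[of "P x" "\<theta> x"] by simp
      also have "\<dots> \<le> A * B"
        using AB True by (intro mult_mono) auto
      finally show ?thesis using True by simp
    qed (simp add: z)
  qed
  also have "\<dots> = measure lborel K * (A * B)"
    by simp
  finally show "\<bar>\<integral>x. blinfun_apply (P x) (\<theta> x) \<partial>lborel\<bar> \<le> measure lborel K * (A * B)" .
qed

lemma poly_distribution_diff:
  assumes "smooth P" "smooth Q"
  shows "poly_distribution (P - Q) \<theta> = poly_distribution P \<theta> - poly_distribution Q \<theta>"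
proof (cases "\<theta> \<in> test_functions")
  case True
  then obtain K where "compact K" "\<theta> \<in> test_functions_in K" by (rule test_functionsE)
  then show ?thesis
    using True by (simp add: poly_distribution_def to_distribution_def blinfun.diff_left
        integrable_smooth_test assms)
qed (simp add: poly_distribution_def to_distribution_def)

lemma poly_distribution_in_distributions:
  fixes P :: "'a::euclidean_space \<Rightarrow> 'b::real_normed_vector \<Rightarrow>\<^sub>L real"
  assumes P: "smooth P"
  shows "poly_distribution P \<in> distributions"
proof -
  let ?T = "poly_distribution P"
  have T: "?T \<theta> = (\<integral>x. blinfun_apply (P x) (\<theta> x) \<partial>lborel)" if "\<theta> \<in> test_functions" for \<theta>
    using that by (simp add: poly_distribution_def to_distribution_def)
  have int: "integrable lborel (\<lambda>x. blinfun_apply (P x) (\<theta> x))" if "\<theta> \<in> test_functions" for \<theta>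
    using that integrable_smooth_test[OF P] by (auto elim!: test_functionsE)
  have "?T (x + y) = ?T x + ?T y" if "x \<in> test_functions" "y \<in> test_functions" for x y
    using that subspace_add[OF subspace_test_functions that] by (simp add: T int blinfun.add_right)
  moreover have "?T (c *\<^sub>R x) = c * ?T x" if "x \<in> test_functions" for c x
    using subspace_scale[OF subspace_test_functions that, of c] that by (simp add: T int blinfun.scaleR_right)
  ultimately have lin: "linear_functional_on test_functions ?T"
    by (simp add: linear_functional_on_def)
  have "continuous_map (test_topology_in K) euclideanreal ?T" if K: "compact K" for K
    unfolding test_topology_in_def smooth_topology_def
  proof (rule continuous_map_functional_of_seminorm_bound)
    (* the defining seminorms are indexed by nonempty compact sets, while K may be empty *)
    let ?K = "insert 0 K"
    have K': "compact ?K" using K by simp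
    show "subspace (test_functions_in K :: ('a \<Rightarrow> 'b) set)"
      by (intro subspace_test_functions_in compact_imp_closed K)
    show "seminorm_on (Collect smooth) (deriv_seminorm 0 ?K)"
      by (intro seminorm_on_deriv_seminorm K') auto
    show "deriv_seminorm 0 ?K \<in> {deriv_seminorm j K | j K. compact K \<and> K \<noteq> {}}"
      if "i \<in> {()}" for i using K' by blast
    have "x \<in> test_functions" if "x \<in> test_functions_in K" for x :: "'a \<Rightarrow> 'b"
      using that by (rule test_functionsI[OF K])
    then show "linear_functional_on (test_functions_in K) ?T"
      using lin unfolding linear_functional_on_def by simp
    define A where "A = deriv_seminorm 0 ?K P"
    fix \<theta> :: "'a \<Rightarrow> 'b" assume \<theta>: "\<theta> \<in> test_functions_in K"
    then have sm: "smooth \<theta>" by (simp add: test_functions_in_def)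
    have "\<bar>?T \<theta>\<bar> \<le> measure lborel K * (A * deriv_seminorm 0 ?K \<theta>)"
      unfolding T[OF test_functionsI[OF K \<theta>]] A_def
      by (intro integral_smooth_test_le[OF P \<theta> K] norm_le_deriv_seminorm deriv_seminorm_nonneg P sm K') auto
    then show "\<bar>?T \<theta>\<bar> \<le> measure lborel K * A * deriv_seminorm 0 ?K \<theta>" by (simp add: mult_ac)
  qed (auto simp: subspace_smooth test_functions_in_def)
  then show ?thesis
    using lin by (simp add: distributions_def poly_distribution_def to_distribution_def)
qed

text \<open>The integrals run over the ball \<open>cball a0 (1 + r)\<close>, which contains the supports for all \<open>a\<close> near \<open>a0\<close>
  and on which the values of \<open>P\<close> are controlled by the norm of the space of polynomial functions.\<close>

lemma continuous_map_poly_distribution_affine: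
  fixes \<theta> :: "'a::euclidean_space \<Rightarrow> 'b::real_normed_vector"
  assumes \<theta>: "\<theta> \<in> test_functions_in (cball 0 1)" and r: "r > 0"
  shows "continuous_map (prod_topology euclidean (poly_topology k)) euclideanreal
    (\<lambda>(a, P). poly_distribution P (\<lambda>x. \<theta> ((x - a) /\<^sub>R r)))"
  unfolding poly_topology_def
proof (rule continuous_map_pairing[OF subspace_poly_functions])
  fix a0 :: 'a
  have sm: "smooth \<theta>" and z: "\<And>x. x \<notin> cball 0 1 \<Longrightarrow> \<theta> x = 0"
    using \<theta> test_functions_in_iff[of "cball 0 1"] by auto
  define M where "M = deriv_seminorm 0 (cball 0 1) \<theta>"
  have "0 \<le> M" unfolding M_def by (intro deriv_seminorm_nonneg sm) auto
  have M: "norm (\<theta> x) \<le> M" for x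
    using norm_le_deriv_seminorm[OF sm, of "cball 0 1" x] z[of x] \<open>0 \<le> M\<close> by (cases "x \<in> cball 0 1") (auto simp: M_def)
  let ?K = "cball a0 (1 + r)"
  define R where "R = norm a0 + 1 + r"
  let ?p = "\<lambda>P :: 'a \<Rightarrow> 'b \<Rightarrow>\<^sub>L real. \<Sum>m\<in>{m. int m \<le> k}. deriv_norm m P 0"
  define C where "C = measure lborel ?K * (R ^ nat k * M) + 1"
  have "R \<ge> 1" using r by (simp add: R_def)
  then have "C > 0" using \<open>0 \<le> M\<close> by (simp add: C_def add_nonneg_pos)
  have "\<bar>poly_distribution P (\<lambda>x. \<theta> ((x - a) /\<^sub>R r))\<bar> \<le> C * ?p P"
    if a: "a \<in> ball a0 1" and P: "P \<in> poly_functions k" for a and P :: "'a \<Rightarrow> 'b \<Rightarrow>\<^sub>L real"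
  proof -
    have p0: "0 \<le> ?p P"
      by (intro sum_nonneg deriv_norm_nonneg smooth_poly_functions[OF P])
    have g: "(\<lambda>x. \<theta> ((x - a) /\<^sub>R r)) \<in> test_functions_in ?K"
      using a by (intro affine_mem_test_functions_in[OF \<theta> r]) auto
    have K: "compact ?K" by simp
    have R_le: "norm x \<le> R" if "x \<in> ?K" for x
      using that norm_triangle_ineq2[of x a0] by (simp add: R_def dist_norm norm_minus_commute)
    have "\<bar>\<integral>x. blinfun_apply (P x) (\<theta> ((x - a) /\<^sub>R r)) \<partial>lborel\<bar>
        \<le> measure lborel ?K * ((R ^ nat k * ?p P) * M)"
      using norm_poly_le_deriv_norms[OF P \<open>R \<ge> 1\<close> R_le] M p0 \<open>R \<ge> 1\<close>
      by (intro integral_smooth_test_le[OF smooth_poly_functions[OF P] g K]) auto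
    also have "\<dots> \<le> C * ?p P"
      using p0 by (simp add: C_def algebra_simps)
    finally show ?thesis
      using affine_mem_test_functions[OF \<theta> r, of a] by (simp add: poly_distribution_def to_distribution_def)
  qed
  then show "\<exists>p\<in>{?p}. \<exists>C>0. \<exists>d>0. seminorm_on (poly_functions k) p \<and>
      (\<forall>a\<in>ball a0 d. \<forall>P\<in>poly_functions k. \<bar>poly_distribution P (\<lambda>x. \<theta> ((x - a) /\<^sub>R r))\<bar> \<le> C * p P)"
    using \<open>C > 0\<close> seminorm_on_poly_functions by (intro bexI[of _ ?p] exI[of _ C] conjI exI[of _ 1]) auto
qed (auto intro: poly_distribution_diff smooth_poly_functions distribution_affine_continuous[OF _ \<theta> r]
    poly_distribution_in_distributions)

section \<open>Finite-dimensional spaces\<close>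

lemma closed_span_of_local_compactness:
  fixes B :: "'y::real_normed_vector set"
  assumes "\<And>M. \<exists>C. compact C \<and> C \<subseteq> span B \<and> span B \<inter> cball 0 M \<subseteq> C"
  shows "closed (span B)"
  unfolding closed_sequential_limits
proof (intro allI impI; elim conjE)
  fix x l assume x: "\<forall>n. x n \<in> span B" "x \<longlonglongrightarrow> l"
  then obtain M where "\<And>n. norm (x n) \<le> M"
    using convergent_imp_Bseq[of x] by (auto simp: convergent_def Bseq_def)
  moreover obtain C where C: "compact C" "C \<subseteq> span B" "span B \<inter> cball 0 M \<subseteq> C"
    using assms by blast
  ultimately have "\<forall>n. x n \<in> C" using x(1) by auto
  then have "l \<in> C"
    using C(1) x(2) compact_imp_closed closed_sequential_limits by blast
  then show "l \<in> span B" using C by blast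
qed

text \<open>Adding a vector \<open>b\<close> outside the closed subspace \<open>span B\<close>, at distance at least \<open>d\<close> say, a bound
  \<open>\<parallel>c b + y\<parallel> \<le> M\<close> with \<open>y \<in> span B\<close> entails \<open>\<bar>c\<bar> d \<le> M\<close>, so that both summands remain in compact
  sets.\<close>

lemma bounded_part_of_span_subset_compact:
  fixes B :: "'y::real_normed_vector set"
  assumes "finite B"
  shows "\<exists>C. compact C \<and> C \<subseteq> span B \<and> span B \<inter> cball 0 M \<subseteq> C"
  using assms
proof (induction B arbitrary: M)
  case empty
  then show ?case by (intro exI[of _ "{0}"]) auto
next
  case (insert b B)
  show ?case
  proof (cases "b \<in> span B")
    case True
    then show ?thesis using insert.IH[of M] by (simp add: span_redundant)
  next
    case False
    have "open (- span B)"
      using closed_span_of_local_compactness[OF insert.IH] by (simp add: open_Compl)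
    then obtain d where d: "d > 0" "ball b d \<subseteq> - span B"
      using False by (auto simp: open_contains_ball)
    have far: "\<bar>c\<bar> * d \<le> norm (c *\<^sub>R b + y)" if y: "y \<in> span B" for c y
    proof (cases "c = 0")
      case nz: False
      have "(-1 / c) *\<^sub>R y \<in> span B" using y by (rule span_scale)
      then have "(-1 / c) *\<^sub>R y \<notin> ball b d" using d(2) by blast
      then have "d \<le> norm (b + (1 / c) *\<^sub>R y)" by (simp add: dist_norm)
      then have "\<bar>c\<bar> * d \<le> norm (c *\<^sub>R (b + (1 / c) *\<^sub>R y))"
        by (simp add: mult_left_mono)
      then show ?thesis using nz by (simp add: scaleR_add_right)
    qed simp
    (* a bound for the component in span B once the coefficient c of b satisfies \<bar>c\<bar> \<le> M / d *)
    define M' where "M' = M + M / d * norm b"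
    obtain C' where C': "compact C'" "C' \<subseteq> span B" "span B \<inter> cball 0 M' \<subseteq> C'"
      using insert.IH by blast
    define C where "C = (\<lambda>(c, y). c *\<^sub>R b + y) ` ({- (M / d)..M / d} \<times> C')"
    have "compact C"
      unfolding C_def case_prod_unfold
      by (intro compact_continuous_image compact_Times compact_Icc C' continuous_intros)
    moreover have "C \<subseteq> span (insert b B)"
      using C'(2) span_mono[OF subset_insertI[of B b]]
      by (auto simp: C_def intro!: span_add span_scale[OF span_base])
    moreover have "z \<in> C" if z: "z \<in> span (insert b B)" "norm z \<le> M" for z
    proof -
      obtain c where c: "z - c *\<^sub>R b \<in> span B"
        using z(1) by (auto simp: span_breakdown_eq)
      have "\<bar>c\<bar> * d \<le> M" using far[OF c, of c] z(2) by simp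
      then have cM: "\<bar>c\<bar> \<le> M / d" using d(1) by (simp add: field_simps)
      have "norm (z - c *\<^sub>R b) \<le> norm z + \<bar>c\<bar> * norm b"
        using norm_triangle_ineq4[of z "c *\<^sub>R b"] by simp
      also have "\<dots> \<le> M'"
        unfolding M'_def using z(2) cM by (intro add_mono mult_right_mono) auto
      finally have "z - c *\<^sub>R b \<in> C'" using C'(3) c by auto
      then show "z \<in> C"
        unfolding C_def using cM by (intro image_eqI[of _ _ "(c, z - c *\<^sub>R b)"]) (auto simp: abs_le_iff)
    qed
    ultimately show ?thesis by (intro exI[of _ C]) auto
  qed
qed

lemma compact_cball_finite_span:
  fixes B :: "'y::real_normed_vector set"
  assumes "finite B" "span B = UNIV"
  shows "compact (cball (0 :: 'y) M)"
proof -
  obtain C where "compact C" "cball (0 :: 'y) M \<subseteq> C"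
    using bounded_part_of_span_subset_compact[OF assms(1), of M] assms(2) by auto
  then show ?thesis
    using compact_Int_closed[of C "cball 0 M"] by (simp add: Int_absorb1)
qed

lemma subspace_of_finite_span_finite_basis:
  fixes B :: "'v::real_vector set"
  assumes "finite B" "subspace W" "W \<subseteq> span B"
  obtains C where "finite C" "span C = W"
proof -
  obtain C where C: "C \<subseteq> W" "independent C" "W \<subseteq> span C"
    by (rule maximal_independent_subset)
  then have "finite C" using independent_span_bound[OF assms(1), of C] assms(3) by blast
  moreover have "span C = W" using C assms(2) span_minimal by blast
  ultimately show ?thesis by (rule that)
qed

lemma sum_fun_apply: "(\<Sum>i\<in>I. f i) x = (\<Sum>i\<in>I. f i x)"
  by (induction I rule: infinite_finite_induct) auto

text \<open>A functional is determined by its values on \<open>B\<close>, so that the dual space embeds into the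
  functions supported in \<open>B\<close>.\<close>

lemma finite_span_dual:
  fixes B :: "'y::real_normed_vector set"
  assumes B: "finite B" "span B = UNIV"
  obtains C :: "('y \<Rightarrow>\<^sub>L real) set" where "finite C" "span C = UNIV"
proof -
  define \<Phi> where "\<Phi> l = (\<lambda>y. if y \<in> B then blinfun_apply l y else 0)" for l :: "'y \<Rightarrow>\<^sub>L real"
  have lin: "linear \<Phi>"
    by (rule linearI) (auto simp: \<Phi>_def fun_eq_iff blinfun.add_left blinfun.scaleR_left)
  have "l = l'" if "\<Phi> l = \<Phi> l'" for l l'
  proof (rule blinfun_eqI)
    fix y
    have "blinfun_apply l b = blinfun_apply l' b" if "b \<in> B" for b
      using fun_cong[OF \<open>\<Phi> l = \<Phi> l'\<close>, of b] that by (simp add: \<Phi>_def)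
    then show "blinfun_apply l y = blinfun_apply l' y"
      using linear_eq_on_span[of "blinfun_apply l" "blinfun_apply l'" B y] B(2)
      by (simp add: bounded_linear.linear blinfun.bounded_linear_right)
  qed
  then have inj: "inj \<Phi>" by (rule injI)
  have "\<Phi> l = (\<Sum>b\<in>B. blinfun_apply l b *\<^sub>R (\<lambda>y. if y = b then 1 else 0))" for l
    by (rule ext) (use B(1) in \<open>simp add: \<Phi>_def sum_fun_apply if_distrib[of "(*) _"] cong: if_cong\<close>)
  then have \<Phi>_span: "\<Phi> l \<in> span ((\<lambda>b y. if y = b then 1 else 0) ` B)" for l
    by (simp add: span_sum span_scale span_base)
  obtain C :: "('y \<Rightarrow>\<^sub>L real) set" where C: "C \<subseteq> UNIV" "independent C" "UNIV \<subseteq> span C"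
    by (rule maximal_independent_subset)
  have "independent (\<Phi> ` C)"
    by (rule linear_independent_injective_image[OF lin C(2) inj_on_subset[OF inj subset_UNIV]])
  then have "finite (\<Phi> ` C)"
    using independent_span_bound[of "(\<lambda>b y. if y = b then 1 else 0) ` B" "\<Phi> ` C"] \<Phi>_span B(1) by auto
  then have "finite C" by (rule finite_imageD) (rule inj_on_subset[OF inj subset_UNIV])
  then show ?thesis using C(3) that[of C] by auto
qed

text \<open>The products of a monomial with a member of \<open>C\<close> span a space that contains all polynomial functions
  of degree at most \<open>k\<close>, and a subspace of a finite-dimensional space is finite-dimensional.\<close>

lemma poly_functions_finite_span:
  fixes C :: "'b::real_normed_vector set"
  assumes C: "finite C" "span C = UNIV"
  obtains D :: "('a::euclidean_space \<Rightarrow> 'b) set" where "finite D" "span D = poly_functions k"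
proof -
  define G where "G = (\<lambda>(bs, c) x. monomial bs x *\<^sub>R c) ` ((\<Union>m\<in>{m. int m \<le> k}. basis_lists m :: 'a list set) \<times> C)"
  have "finite G" using finite_degrees C(1) by (simp add: G_def)
  moreover have "P \<in> span G" if P: "P \<in> poly_functions k" for P :: "'a \<Rightarrow> 'b"
  proof -
    obtain c where c: "P = (\<lambda>x. \<Sum>m\<in>{m. int m \<le> k}. \<Sum>bs\<in>basis_lists m. monomial bs x *\<^sub>R c bs)"
      using poly_functions_expansion[OF P] .
    have term_in_span: "(\<lambda>x. monomial bs x *\<^sub>R c bs) \<in> span G" if bs: "bs \<in> basis_lists m" "int m \<le> k" for bs m
    proof -
      obtain u where u: "c bs = (\<Sum>v\<in>C. u v *\<^sub>R v)"
      proof -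
        have "c bs \<in> range (\<lambda>u. \<Sum>v\<in>C. u v *\<^sub>R v)"
          using C by (simp add: span_finite[symmetric])
        then show ?thesis using that by blast
      qed
      have "(\<lambda>x. monomial bs x *\<^sub>R c bs) = (\<Sum>v\<in>C. u v *\<^sub>R (\<lambda>x. monomial bs x *\<^sub>R v))"
        by (rule ext) (simp add: u sum_fun_apply scaleR_sum_right mult.commute)
      also have "\<dots> \<in> span G"
        using bs by (intro span_sum span_scale span_base)
          (auto simp: G_def intro!: image_eqI[of _ _ "(bs, _)"])
      finally show ?thesis .
    qed
    have "P = (\<Sum>m\<in>{m. int m \<le> k}. \<Sum>bs\<in>basis_lists m. (\<lambda>x. monomial bs x *\<^sub>R c bs))"
      unfolding c by (rule ext) (simp add: sum_fun_apply)
    also have "\<dots> \<in> span G"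
      by (intro span_sum term_in_span) auto
    finally show ?thesis .
  qed
  then have "poly_functions k \<subseteq> span G" by blast
  ultimately show ?thesis
    by (rule subspace_of_finite_span_finite_basis[OF _ subspace_poly_functions _ that])
qed

lemma seminorm_on_sum_scaleR_le:
  assumes p: "seminorm_on V p" and V: "subspace V" and B: "finite B" "B \<subseteq> V"
  shows "p (\<Sum>b\<in>B. c b *\<^sub>R b) \<le> (\<Sum>b\<in>B. \<bar>c b\<bar> * p b)"
  using B
proof (induction B)
  case empty
  then show ?case using seminorm_on_0[OF p V] by simp
next
  case (insert b B)
  have V': "c b *\<^sub>R b \<in> V" "(\<Sum>b\<in>B. c b *\<^sub>R b) \<in> V"
    using insert.prems by (auto intro!: subspace_scale[OF V] subspace_sum[OF V])
  have "p (c b *\<^sub>R b + (\<Sum>b\<in>B. c b *\<^sub>R b)) \<le> p (c b *\<^sub>R b) + p (\<Sum>b\<in>B. c b *\<^sub>R b)"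
    using p V' unfolding seminorm_on_def by blast
  moreover have "p (c b *\<^sub>R b) = \<bar>c b\<bar> * p b"
    using p insert.prems unfolding seminorm_on_def by blast
  ultimately show ?case using insert by simp
qed

text \<open>The parametrization \<open>c \<mapsto> \<Sum>\<^sub>b c\<^sub>b b\<close> is continuous for every family of seminorms, and it maps the
  compact cubes \<open>[-n, n]\<^sup>B\<close> onto an exhaustion of the span.\<close>

lemma finite_span_sigma_compact:
  fixes B :: "'v::real_vector set"
  assumes B: "finite B" and V: "V = span B" and Q: "\<And>p. p \<in> Q \<Longrightarrow> seminorm_on V p"
  obtains C :: "nat \<Rightarrow> 'v set" where "\<And>n. compactin (seminorm_topology V Q) (C n)" "(\<Union>n. C n) = V"
proof -
  have sub: "subspace V" and BV: "B \<subseteq> V" by (auto simp: V span_superset)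
  let ?X = "product_topology (\<lambda>_. euclideanreal) B"
  define \<sigma> where "\<sigma> c = (\<Sum>b\<in>B. c b *\<^sub>R b)" for c :: "'v \<Rightarrow> real"
  have cont: "continuous_map ?X (seminorm_topology V Q) \<sigma>"
  proof (rule continuous_map_into_seminorm_topology)
    show "\<sigma> \<in> topspace ?X \<rightarrow> V"
      using BV by (auto simp: \<sigma>_def intro!: subspace_sum[OF sub] subspace_scale[OF sub])
    fix c0 p and e :: real assume c0: "c0 \<in> topspace ?X" and p: "p \<in> Q" and e: "0 < e"
    have p0: "0 \<le> p b" if "b \<in> B" for b
      using seminorm_on_nonneg[OF Q[OF p] sub] that BV by blast
    define d where "d = e / ((\<Sum>b\<in>B. p b) + 1)"
    have S: "0 < (\<Sum>b\<in>B. p b) + 1" using p0 by (intro add_nonneg_pos sum_nonneg) auto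
    have d: "d > 0" unfolding d_def using e S by (rule divide_pos_pos)
    let ?U = "PiE B (\<lambda>b. ball (c0 b) d)"
    have "p (\<sigma> c - \<sigma> c0) < e" if c: "c \<in> ?U" for c
    proof -
      have "\<sigma> c - \<sigma> c0 = (\<Sum>b\<in>B. (c b - c0 b) *\<^sub>R b)"
        by (simp add: \<sigma>_def sum_subtractf scaleR_diff_left)
      then have "p (\<sigma> c - \<sigma> c0) \<le> (\<Sum>b\<in>B. \<bar>c b - c0 b\<bar> * p b)"
        using seminorm_on_sum_scaleR_le[OF Q[OF p] sub B BV] by simp
      also have "\<dots> \<le> (\<Sum>b\<in>B. d * p b)"
        using c p0 by (intro sum_mono mult_right_mono) (force simp: PiE_iff dist_real_def)+
      also have "\<dots> = d * (\<Sum>b\<in>B. p b)" by (simp add: sum_distrib_left)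
      also have "\<dots> < d * ((\<Sum>b\<in>B. p b) + 1)" using d by simp
      also have "\<dots> = e" using S by (simp add: d_def)
      finally show ?thesis .
    qed
    moreover have "openin ?X ?U" using B by (simp add: openin_PiE)
    moreover have "c0 \<in> ?U" using c0 d by (auto simp: PiE_iff)
    ultimately show "\<exists>U. openin ?X U \<and> c0 \<in> U \<and> (\<forall>c\<in>U. p (\<sigma> c - \<sigma> c0) < e)" by blast
  qed
  define C where "C n = \<sigma> ` PiE B (\<lambda>_. {- real n..real n})" for n
  have "compactin (seminorm_topology V Q) (C n)" for n
    unfolding C_def by (intro image_compactin[OF _ cont]) (simp add: compactin_PiE)
  moreover have "(\<Union>n. C n) = V"
  proof
    show "(\<Union>n. C n) \<subseteq> V"
      using BV by (auto simp: C_def \<sigma>_def intro!: subspace_sum[OF sub] subspace_scale[OF sub])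
    show "V \<subseteq> (\<Union>n. C n)"
    proof
      fix x assume "x \<in> V"
      then obtain u where u: "x = (\<Sum>b\<in>B. u b *\<^sub>R b)"
        using B by (auto simp: V span_finite)
      obtain n where n: "(\<Sum>b\<in>B. \<bar>u b\<bar>) \<le> real n" using real_arch_simple by blast
      have "\<bar>u b\<bar> \<le> real n" if "b \<in> B" for b
        using member_le_sum[of b B "\<lambda>b. \<bar>u b\<bar>"] that B n by force
      then have "restrict u B \<in> PiE B (\<lambda>_. {- real n..real n})"
        by (auto simp: PiE_iff abs_le_iff minus_le_iff)
      moreover have "x = \<sigma> (restrict u B)" by (simp add: u \<sigma>_def)
      ultimately show "x \<in> (\<Union>n. C n)" unfolding C_def by blast
    qed
  qed
  ultimately show ?thesis by (rule that)
qed

lemma poly_topology_sigma_compact: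
  fixes C :: "'b::real_normed_vector set"
  assumes C: "finite C" "span C = UNIV"
  obtains L :: "nat \<Rightarrow> ('a::euclidean_space \<Rightarrow> 'b) set"
  where "\<And>n. compactin (poly_topology k) (L n)" "(\<Union>n. L n) = poly_functions k"
proof -
  obtain D :: "('a \<Rightarrow> 'b) set" where D: "finite D" "span D = poly_functions k"
    using poly_functions_finite_span[OF C] .
  have norm: "seminorm_on (poly_functions k) p"
    if "p \<in> {\<lambda>P :: 'a \<Rightarrow> 'b. \<Sum>m\<in>{m. int m \<le> k}. deriv_norm m P 0}" for p
    using that seminorm_on_poly_functions by simp
  show ?thesis
  proof (rule finite_span_sigma_compact[OF D(1) D(2)[symmetric] norm])
    fix L :: "nat \<Rightarrow> ('a \<Rightarrow> 'b) set" assume "\<And>n. compactin (seminorm_topology (poly_functions k)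
        {\<lambda>P :: 'a \<Rightarrow> 'b. \<Sum>m\<in>{m. int m \<le> k}. deriv_norm m P 0}) (L n)"
      "(\<Union>n. L n) = (poly_functions k :: ('a \<Rightarrow> 'b) set)"
    then show ?thesis by (intro that[of L]) (simp_all add: poly_topology_def)
  qed
qed

section \<open>Compact sets of compactly supported distributions\<close>

text \<open>A cofinal sequence of seminorms: every defining seminorm of the space of smooth functions is below
  one of them.\<close>

definition smooth_norm :: "nat \<Rightarrow> ('a::euclidean_space \<Rightarrow> 'b::real_normed_vector) \<Rightarrow> real"
  where "smooth_norm N \<theta> = (\<Sum>j\<le>N. deriv_seminorm j (cball 0 (real N)) \<theta>)"

lemma seminorm_on_smooth_norm: "seminorm_on (Collect smooth) (smooth_norm N)"
proof -
  have "seminorm_on (Collect smooth) (deriv_seminorm j (cball 0 (real N)))" for j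
    by (intro seminorm_on_deriv_seminorm) auto
  then show ?thesis
    unfolding seminorm_on_def smooth_norm_def
    by (auto simp: sum_distrib_left sum.distrib[symmetric] intro!: sum_mono)
qed

lemma smooth_norm_scaleR: "smooth \<theta> \<Longrightarrow> smooth_norm N (c *\<^sub>R \<theta>) = \<bar>c\<bar> * smooth_norm N \<theta>"
  using seminorm_on_smooth_norm unfolding seminorm_on_def by blast

lemma smooth_norm_nonneg: "smooth \<theta> \<Longrightarrow> 0 \<le> smooth_norm N \<theta>"
  using seminorm_on_nonneg[OF seminorm_on_smooth_norm subspace_smooth] by blast

lemma deriv_seminorm_mono:
  assumes "smooth \<theta>" "K \<subseteq> L" "K \<noteq> {}" "compact L"
  shows "deriv_seminorm j K \<theta> \<le> deriv_seminorm j L \<theta>"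
  unfolding deriv_seminorm_def[of j K]
  using assms by (intro cSUP_least deriv_norm_le_deriv_seminorm) auto

lemma deriv_seminorm_le_smooth_norm:
  assumes "smooth \<theta>" "j \<le> N" "K \<subseteq> cball 0 (real N)" "K \<noteq> {}"
  shows "deriv_seminorm j K \<theta> \<le> smooth_norm N \<theta>"
proof -
  have "deriv_seminorm j K \<theta> \<le> deriv_seminorm j (cball 0 (real N)) \<theta>"
    using assms by (intro deriv_seminorm_mono) auto
  also have "\<dots> \<le> smooth_norm N \<theta>"
    unfolding smooth_norm_def using assms
    by (intro member_le_sum[of j "{..N}" "\<lambda>j. deriv_seminorm j (cball 0 (real N)) \<theta>"] deriv_seminorm_nonneg) auto
  finally show ?thesis .
qed

lemma bdd_above_deriv_seminorm_bounded:
  fixes S :: "('a::euclidean_space \<Rightarrow> 'b::real_normed_vector) set"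
  assumes S: "von_neumann_bounded smooth_topology S" and K: "compact K" "K \<noteq> {}"
  shows "\<exists>M. \<forall>\<theta>\<in>S. deriv_seminorm j K \<theta> \<le> M"
proof -
  let ?p = "deriv_seminorm j K :: ('a \<Rightarrow> 'b) \<Rightarrow> real"
  let ?U = "{\<theta> \<in> Collect smooth. ?p (\<theta> - 0) < 1}"
  have p: "seminorm_on (Collect smooth) ?p" by (rule seminorm_on_deriv_seminorm[OF K])
  have sm0: "smooth (0 :: 'a \<Rightarrow> 'b)" using smooth_const[of 0] by (simp add: zero_fun_def)
  have "openin smooth_topology ?U"
    unfolding smooth_topology_def
    using K sm0 by (intro openin_seminorm_ball subspace_smooth p) (auto simp: smooth_const)
  moreover have "0 \<in> ?U"
    using seminorm_on_0[OF p subspace_smooth] sm0 by simp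
  ultimately obtain s where s: "s > 0" "\<And>t. t > s \<Longrightarrow> S \<subseteq> (*\<^sub>R) t ` ?U"
    using S unfolding von_neumann_bounded_def by blast
  have "?p \<theta> \<le> s + 1" if "\<theta> \<in> S" for \<theta>
  proof -
    have "\<theta> \<in> (*\<^sub>R) (s + 1) ` ?U" using s(2)[of "s + 1"] that by auto
    then obtain \<phi> where \<phi>: "smooth \<phi>" "?p \<phi> < 1" "\<theta> = (s + 1) *\<^sub>R \<phi>" by auto
    then have "?p \<theta> = (s + 1) * ?p \<phi>"
      using s(1) by (simp add: deriv_seminorm_scaleR[OF _ K])
    also have "\<dots> \<le> (s + 1) * 1"
      using s(1) \<phi>(2) by (intro mult_left_mono) auto
    finally show ?thesis by simp
  qed
  then show ?thesis by blast
qed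

text \<open>The combinatorial core of the theorem of Arzela and Ascoli: elements of \<open>S\<close> are sorted by the positions of their
  finitely many values in a compact set.  Each step of the induction splits \<open>S\<close> according to the value of one more
  map.\<close>

lemma finite_net_of_maps:
  fixes f :: "'i \<Rightarrow> 's \<Rightarrow> 'm::metric_space"
  assumes "finite I" and "compact C" and "\<And>i \<theta>. i \<in> I \<Longrightarrow> \<theta> \<in> S \<Longrightarrow> f i \<theta> \<in> C" and e: "0 < e"
  obtains F where "finite F" "F \<subseteq> S" "\<And>\<theta>. \<theta> \<in> S \<Longrightarrow> \<exists>\<phi>\<in>F. \<forall>i\<in>I. dist (f i \<theta>) (f i \<phi>) < e"
proof -
  have "\<exists>F. finite F \<and> F \<subseteq> S \<and> (\<forall>\<theta>\<in>S. \<exists>\<phi>\<in>F. \<forall>i\<in>I. dist (f i \<theta>) (f i \<phi>) < e)"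
    using assms(1,3)
  proof (induction I arbitrary: S)
    case empty
    show ?case
    proof (cases "S = {}")
      case False
      then obtain \<phi> where "\<phi> \<in> S" by blast
      then show ?thesis by (intro exI[of _ "{\<phi>}"]) auto
    qed auto
  next
    case (insert i I)
    have "e / 2 > 0" using e by simp
    then obtain Y where Y: "finite Y" "C \<subseteq> (\<Union>y\<in>Y. ball y (e / 2))"
      using assms(2) unfolding compact_eq_totally_bounded by metis
    define Q where "Q y F \<longleftrightarrow> finite F \<and> F \<subseteq> {\<theta> \<in> S. f i \<theta> \<in> ball y (e / 2)} \<and>
        (\<forall>\<theta>\<in>{\<theta> \<in> S. f i \<theta> \<in> ball y (e / 2)}. \<exists>\<phi>\<in>F. \<forall>i\<in>I. dist (f i \<theta>) (f i \<phi>) < e)" for y F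
    have "\<exists>F. Q y F" for y
      unfolding Q_def using insert.prems by (intro insert.IH) auto
    then obtain F where F': "\<And>y. Q y (F y)" by metis
    have F: "finite (F y)" "F y \<subseteq> {\<theta> \<in> S. f i \<theta> \<in> ball y (e / 2)}"
      "\<theta> \<in> S \<Longrightarrow> f i \<theta> \<in> ball y (e / 2) \<Longrightarrow> \<exists>\<phi>\<in>F y. \<forall>i\<in>I. dist (f i \<theta>) (f i \<phi>) < e" for y \<theta>
      using F'[of y] by (auto simp: Q_def)
    have "\<exists>\<phi>\<in>(\<Union>y\<in>Y. F y). \<forall>i\<in>insert i I. dist (f i \<theta>) (f i \<phi>) < e" if \<theta>: "\<theta> \<in> S" for \<theta>
    proof -
      obtain y where y: "y \<in> Y" "f i \<theta> \<in> ball y (e / 2)"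
        using insert.prems[of i \<theta>] \<theta> Y(2) by blast
      obtain \<phi> where \<phi>: "\<phi> \<in> F y" "\<forall>i\<in>I. dist (f i \<theta>) (f i \<phi>) < e"
        using F(3)[OF \<theta> y(2)] by blast
      have "f i \<phi> \<in> ball y (e / 2)" using F(2) \<phi>(1) by blast
      then have "dist (f i \<theta>) (f i \<phi>) < e"
        using y(2) dist_triangle_half_r[of y "f i \<theta>" e "f i \<phi>"] by simp
      then show ?thesis using y(1) \<phi> by blast
    qed
    moreover have "finite (\<Union>y\<in>Y. F y)" "(\<Union>y\<in>Y. F y) \<subseteq> S" using F(1,2) Y(1) by auto
    ultimately show ?case by (intro exI[of _ "\<Union>y\<in>Y. F y"]) blast
  qed
  then show ?thesis using that by blast
qed

text \<open>The mean value inequality: the derivative of \<open>D\<^sup>j\<theta>\<close> evaluated at \<open>bs\<close> is \<open>D\<^sup>j\<^sup>+\<^sup>1\<theta>\<close> evaluated at one more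
  vector.\<close>

lemma iterated_deriv_lipschitz:
  fixes \<theta> :: "'a::euclidean_space \<Rightarrow> 'b::real_normed_vector"
  assumes \<theta>: "smooth \<theta>" and K: "compact K" "convex K" "x \<in> K" "y \<in> K"
    and bs: "\<And>v. v \<in> set bs \<Longrightarrow> norm v \<le> 1"
    and L: "deriv_seminorm (Suc (length bs)) K \<theta> \<le> L"
  shows "norm (iterated_deriv \<theta> bs x - iterated_deriv \<theta> bs y) \<le> L * norm (x - y)"
proof (rule differentiable_bound[OF K(2)])
  fix z assume z: "z \<in> K"
  show "(iterated_deriv \<theta> bs has_derivative (\<lambda>v. iterated_deriv \<theta> (v # bs) z)) (at z within K)"
    by (rule has_derivative_at_withinI[OF smooth_has_derivative[OF \<theta>]])
  have lin: "linear (\<lambda>v. iterated_deriv \<theta> (v # bs) z)"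
    using smooth_has_derivative[OF \<theta>] has_derivative_linear by blast
  show "onorm (\<lambda>v. iterated_deriv \<theta> (v # bs) z) \<le> L"
  proof (rule onorm_le)
    fix v :: 'a
    let ?u = "v /\<^sub>R norm v"
    have "inverse (norm v) * norm v \<le> 1" by (cases "v = 0") auto
    then have "norm (iterated_deriv \<theta> (?u # bs) z) \<le> deriv_seminorm (length (?u # bs)) K \<theta>"
      using bs by (intro norm_iterated_deriv_le_deriv_seminorm \<theta> K(1) z) auto
    then have u: "norm (iterated_deriv \<theta> (?u # bs) z) \<le> L" using L by simp
    have "v = norm v *\<^sub>R ?u" by (cases "v = 0") auto
    then have "iterated_deriv \<theta> (v # bs) z = iterated_deriv \<theta> (norm v *\<^sub>R ?u # bs) z" by (simp only:)
    also have "\<dots> = norm v *\<^sub>R iterated_deriv \<theta> (?u # bs) z" by (rule linear_cmul[OF lin])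
    finally have "norm (iterated_deriv \<theta> (v # bs) z) = norm v * norm (iterated_deriv \<theta> (?u # bs) z)"
      by simp
    also have "\<dots> \<le> norm v * L" using u by (rule mult_left_mono) simp
    finally show "norm (iterated_deriv \<theta> (v # bs) z) \<le> L * norm v" by (simp add: mult.commute)
  qed
qed (use K in auto)

text \<open>On a \<open>\<delta>\<close>-net \<open>X\<close> of the ball, finitely many members of \<open>S\<close> approximate the basic derivatives of all members of \<open>S\<close>
  up to \<open>\<eta>/3\<close>; the common Lipschitz constant \<open>L\<close> extends this from \<open>X\<close> to the ball at the cost of another
  \<open>2 L \<delta> \<le> 2 \<eta>/3\<close>.\<close>

lemma bounded_imp_totally_bounded_smooth_norm:
  fixes S :: "('a::euclidean_space \<Rightarrow> 'b::real_normed_vector) set"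
  assumes Y: "\<And>M. compact (cball (0 :: 'b) M)"
    and S: "von_neumann_bounded smooth_topology S" and e: "0 < e"
  obtains F where "finite F" "F \<subseteq> S" "\<And>\<theta>. \<theta> \<in> S \<Longrightarrow> \<exists>\<phi>\<in>F. smooth_norm N (\<theta> - \<phi>) < e"
proof -
  let ?B = "cball (0 :: 'a) (real N)"
  have smS: "smooth \<theta>" if "\<theta> \<in> S" for \<theta>
    using S that by (auto simp: von_neumann_bounded_def)
  have "\<exists>M. \<forall>\<theta>\<in>S. deriv_seminorm j ?B \<theta> \<le> M" for j
    by (rule bdd_above_deriv_seminorm_bounded[OF S]) auto
  then obtain M where M: "\<And>j \<theta>. \<theta> \<in> S \<Longrightarrow> deriv_seminorm j ?B \<theta> \<le> M j" by metis
  define L where "L = (\<Sum>j\<le>Suc N. \<bar>M j\<bar>)"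
  have "0 \<le> L" by (simp add: L_def sum_nonneg)
  have L: "deriv_seminorm j ?B \<theta> \<le> L" if "\<theta> \<in> S" "j \<le> Suc N" for j \<theta>
    using M[OF that(1), of j] member_le_sum[of j "{..Suc N}" "\<lambda>j. \<bar>M j\<bar>"] that(2) by (force simp: L_def)
  (* m counts the derivatives that enter smooth_norm N; an error of \<eta> in each of them adds up to less than e *)
  define m where "m = (\<Sum>j\<le>N. card (basis_lists j :: 'a list set))"
  define \<eta> where "\<eta> = e / (real m + 1)"
  define \<delta> where "\<delta> = \<eta> / (3 * (L + 1))"
  have \<eta>: "\<eta> > 0" using e by (simp add: \<eta>_def)
  then have \<delta>: "\<delta> > 0" using \<open>0 \<le> L\<close> by (simp add: \<delta>_def)
  have L\<delta>: "L * \<delta> \<le> \<eta> / 3"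
    using \<open>0 \<le> L\<close> \<eta> by (simp add: \<delta>_def field_simps)
  have "compact ?B" by simp
  then obtain X where X: "finite X" "X \<subseteq> ?B" "?B \<subseteq> (\<Union>x\<in>X. ball x \<delta>)"
    using compactE_image[of ?B ?B "\<lambda>x. ball x \<delta>"] \<delta> by (metis UN_I centre_in_ball open_ball subsetI)
  define I where "I = (\<Union>j\<le>N. basis_lists j :: 'a list set) \<times> X"
  have basis_norm: "norm v \<le> 1" if "bs \<in> basis_lists j" "v \<in> set bs" for v :: 'a and bs j
    using that by (auto simp: basis_lists_def)
  have "finite I" using X(1) by (simp add: I_def)
  moreover have "iterated_deriv \<theta> (fst i) (snd i) \<in> cball 0 L" if iI: "i \<in> I" and \<theta>: "\<theta> \<in> S" for i \<theta>
  proof -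
    obtain j bs x where i: "i = (bs, x)" "bs \<in> basis_lists j" "j \<le> N" "x \<in> X"
      using iI by (auto simp: I_def)
    have "norm (iterated_deriv \<theta> bs x) \<le> deriv_seminorm (length bs) ?B \<theta>"
      using i X(2) basis_norm by (intro norm_iterated_deriv_le_deriv_seminorm smS \<theta>) auto
    then show ?thesis using L[OF \<theta>, of j] i by (auto simp: basis_lists_def)
  qed
  moreover have "\<eta> / 3 > 0" using \<eta> by simp
  ultimately obtain F where F: "finite F" "F \<subseteq> S"
      "\<And>\<theta>. \<theta> \<in> S \<Longrightarrow> \<exists>\<phi>\<in>F. \<forall>i\<in>I. dist (iterated_deriv \<theta> (fst i) (snd i)) (iterated_deriv \<phi> (fst i) (snd i)) < \<eta> / 3"
    using finite_net_of_maps[of I "cball 0 L" S "\<lambda>i \<theta>. iterated_deriv \<theta> (fst i) (snd i)" "\<eta> / 3"] Y by metis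
  have "\<exists>\<phi>\<in>F. smooth_norm N (\<theta> - \<phi>) < e" if \<theta>: "\<theta> \<in> S" for \<theta>
  proof -
    obtain \<phi> where \<phi>: "\<phi> \<in> F"
        "\<And>i. i \<in> I \<Longrightarrow> dist (iterated_deriv \<theta> (fst i) (snd i)) (iterated_deriv \<phi> (fst i) (snd i)) < \<eta> / 3"
      using F(3)[OF \<theta>] by blast
    then have \<phi>S: "\<phi> \<in> S" using F(2) by blast
    have small: "norm (iterated_deriv (\<theta> - \<phi>) bs y) \<le> \<eta>" if bs: "bs \<in> basis_lists j" "j \<le> N" and y: "y \<in> ?B" for bs j y
    proof -
      obtain x where x: "x \<in> X" "dist x y < \<delta>" using X(3) y by auto
      have lip: "norm (iterated_deriv \<psi> bs y - iterated_deriv \<psi> bs x) \<le> \<eta> / 3" if \<psi>: "\<psi> \<in> S" for \<psi>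
      proof -
        have "norm (iterated_deriv \<psi> bs y - iterated_deriv \<psi> bs x) \<le> L * norm (y - x)"
          using bs y x(1) X(2) basis_norm L[OF \<psi>, of "Suc j"]
          by (intro iterated_deriv_lipschitz[of \<psi> ?B] smS \<psi>) (auto simp: basis_lists_def)
        also have "\<dots> \<le> L * \<delta>"
          using x(2) \<open>0 \<le> L\<close> by (intro mult_left_mono) (auto simp: dist_norm norm_minus_commute)
        finally show ?thesis using L\<delta> by simp
      qed
      have "(bs, x) \<in> I" using bs x(1) by (auto simp: I_def)
      then have "norm (iterated_deriv \<theta> bs x - iterated_deriv \<phi> bs x) < \<eta> / 3"
        using \<phi>(2)[of "(bs, x)"] by (simp add: dist_norm)
      moreover have "norm (u - w) \<le> norm (u - u') + norm (u' - w') + norm (w - w')" for u u' w w' :: 'b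
        using norm_diff_triangle_le[of u u' "norm (u - u')" w "norm (u' - w') + norm (w - w')"]
          norm_diff_triangle_le[of u' w' "norm (u' - w')" w "norm (w - w')"]
        by (simp add: norm_minus_commute)
      ultimately show ?thesis
        using lip[OF \<theta>] lip[OF \<phi>S] by (simp add: iterated_deriv_diff smS \<theta> \<phi>S) (smt (verit))
    qed
    have "smooth_norm N (\<theta> - \<phi>) \<le> (\<Sum>j\<le>N. real (card (basis_lists j :: 'a list set)) * \<eta>)"
      unfolding smooth_norm_def
    proof (intro sum_mono deriv_seminorm_le_basis smooth_diff smS \<theta> \<phi>S)
      fix j y assume "j \<in> {..N}" "y \<in> ?B"
      then have "(\<Sum>bs\<in>basis_lists j. norm (iterated_deriv (\<theta> - \<phi>) bs y)) \<le> (\<Sum>bs\<in>(basis_lists j :: 'a list set). \<eta>)"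
        using small by (intro sum_mono) auto
      then show "(\<Sum>bs\<in>basis_lists j. norm (iterated_deriv (\<theta> - \<phi>) bs y)) \<le> real (card (basis_lists j :: 'a list set)) * \<eta>"
        by simp
    qed auto
    also have "\<dots> = real m * \<eta>" by (simp add: m_def sum_distrib_right)
    also have "\<dots> < e" using e by (simp add: \<eta>_def field_simps)
    finally show ?thesis using \<phi>(1) by blast
  qed
  then show ?thesis by (rule that[OF F(1,2)])
qed

definition functionals_bounded_by :: "nat \<Rightarrow> (('a::euclidean_space \<Rightarrow> 'b::real_normed_vector) \<Rightarrow> real) set"
  where "functionals_bounded_by N = {T. linear_functional_on (Collect smooth) T \<and>
    (\<forall>\<theta>. \<not> smooth \<theta> \<longrightarrow> T \<theta> = 0) \<and> (\<forall>\<theta>. smooth \<theta> \<longrightarrow> \<bar>T \<theta>\<bar> \<le> real N * smooth_norm N \<theta>)}"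

lemma functionals_bounded_by_subset:
  "(functionals_bounded_by N :: (('a::euclidean_space \<Rightarrow> 'b::real_normed_vector) \<Rightarrow> real) set)
    \<subseteq> compact_distributions"
proof
  fix T :: "('a \<Rightarrow> 'b) \<Rightarrow> real" assume T: "T \<in> functionals_bounded_by N"
  have "continuous_map (subtopology smooth_topology (Collect smooth)) euclideanreal T"
    unfolding smooth_topology_def
  proof (rule continuous_map_functional_of_seminorm_bound[of _ _ _ "{..N}" "\<lambda>j. deriv_seminorm j (cball 0 (real N))"])
    show "seminorm_on (Collect smooth) (smooth_norm N)" by (rule seminorm_on_smooth_norm)
    show "\<And>\<theta>. \<theta> \<in> Collect smooth \<Longrightarrow> \<bar>T \<theta>\<bar> \<le> real N * smooth_norm N \<theta>"
      "linear_functional_on (Collect smooth) T"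
      using T by (auto simp: functionals_bounded_by_def)
  next
    show "deriv_seminorm j (cball 0 (real N)) \<in> {deriv_seminorm j K | j K. compact K \<and> K \<noteq> {}}" for j
      by (rule CollectI, rule exI[of _ j], rule exI[of _ "cball 0 (real N)"]) auto
  qed (auto simp: subspace_smooth smooth_norm_def)
  then have "continuous_map smooth_topology euclideanreal T"
    using subtopology_topspace[of "smooth_topology :: ('a \<Rightarrow> 'b) topology"] by simp
  then show "T \<in> compact_distributions"
    using T by (auto simp: functionals_bounded_by_def compact_distributions_def)
qed

text \<open>Continuity at zero gives \<open>p < e \<Longrightarrow> \<bar>T\<bar> < 1\<close> for finitely many seminorms \<open>p\<close>, all of which are
  below \<open>smooth_norm N\<close> when \<open>N\<close> is large; homogeneity does the rest.\<close>

lemma compact_distribution_bounded_by: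
  fixes T :: "('a::euclidean_space \<Rightarrow> 'b::real_normed_vector) \<Rightarrow> real"
  assumes T: "T \<in> compact_distributions"
  obtains N where "T \<in> functionals_bounded_by N"
proof -
  have lin: "linear_functional_on (Collect smooth) T"
    and zero: "\<And>\<theta>. \<not> smooth \<theta> \<Longrightarrow> T \<theta> = 0"
    and cont: "continuous_map smooth_topology euclideanreal T"
    using T by (auto simp: compact_distributions_def)
  have sm0: "smooth (0 :: 'a \<Rightarrow> 'b)" using smooth_const[of 0] by (simp add: zero_fun_def)
  have hom: "T (c *\<^sub>R \<theta>) = c * T \<theta>" if "smooth \<theta>" for c \<theta>
    using lin that by (simp add: linear_functional_on_def)
  define U where "U = {\<theta> \<in> topspace smooth_topology. T \<theta> \<in> ball 0 1}"
  have "openin smooth_topology U"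
    unfolding U_def using cont by (rule openin_continuous_map_preimage) simp
  then have nbhd: "\<forall>\<theta>\<in>U. \<exists>F e. finite F \<and> F \<subseteq> {deriv_seminorm j K | j K. compact K \<and> K \<noteq> {}} \<and> e > 0 \<and>
      {\<phi> \<in> Collect smooth. \<forall>p\<in>F. p (\<phi> - \<theta>) < e} \<subseteq> U"
    unfolding smooth_topology_def openin_seminorm_topology by (rule conjunct2)
  have "0 \<in> U" using sm0 hom[OF sm0, of 0] by (simp add: U_def)
  from bspec[OF nbhd this]
  obtain F e where F: "finite F" "F \<subseteq> {deriv_seminorm j K | j K. compact K \<and> K \<noteq> {}}" "e > 0"
    and FT: "{\<theta> \<in> Collect smooth. \<forall>p\<in>F. p (\<theta> - 0) < e} \<subseteq> U"
    by (elim exE conjE)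
  have "\<exists>N0. \<forall>N\<ge>N0. \<forall>\<theta>. smooth \<theta> \<longrightarrow> p \<theta> \<le> smooth_norm N \<theta>" if p: "p \<in> F" for p
  proof -
    have "p \<in> {deriv_seminorm j K | j K. compact K \<and> K \<noteq> {}}" using F(2) p by (rule subsetD)
    then obtain j K where K: "p = deriv_seminorm j K" "compact K" "K \<noteq> {}" by blast
    obtain R where R: "\<And>x. x \<in> K \<Longrightarrow> norm x \<le> R"
      using compact_imp_bounded[OF K(2)] by (auto simp: bounded_iff)
    obtain n where n: "R \<le> real n" using real_arch_simple by blast
    have "p \<theta> \<le> smooth_norm N \<theta>" if "max j n \<le> N" "smooth \<theta>" for N \<theta>
      unfolding K(1)
    proof (rule deriv_seminorm_le_smooth_norm[OF that(2) _ _ K(3)])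
      show "K \<subseteq> cball 0 (real N)"
      proof
        fix x assume "x \<in> K"
        then have "norm x \<le> R" by (rule R)
        then show "x \<in> cball 0 (real N)" using n that(1) by simp
      qed
    qed (use that in simp)
    then show ?thesis by blast
  qed
  then obtain N0 where N0: "\<And>p N \<theta>. p \<in> F \<Longrightarrow> N0 p \<le> N \<Longrightarrow> smooth \<theta> \<Longrightarrow> p \<theta> \<le> smooth_norm N \<theta>"
    by metis
  obtain n where n: "1 / e < real n" using reals_Archimedean2 by blast
  define N where "N = n + (\<Sum>p\<in>F. N0 p)"
  have NN: "N0 p \<le> N" if "p \<in> F" for p
    using member_le_sum[of p F N0] that F(1) by (simp add: N_def)
  have "real n \<le> real N" by (simp only: N_def of_nat_le_iff le_add1)
  with n have N: "1 / e < real N" by simp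
  then have "0 < real N" using F(3) by (smt (verit) divide_pos_pos)
  have "\<bar>T \<theta>\<bar> \<le> real N * smooth_norm N \<theta>" if \<theta>: "smooth \<theta>" for \<theta>
  proof (rule ccontr)
    assume *: "\<not> \<bar>T \<theta>\<bar> \<le> real N * smooth_norm N \<theta>"
    define c where "c = \<bar>T \<theta>\<bar>"
    have "0 \<le> real N * smooth_norm N \<theta>" using smooth_norm_nonneg[OF \<theta>] by simp
    then have c: "c > 0" using * by (simp add: c_def)
    let ?\<phi> = "(1 / c) *\<^sub>R \<theta>"
    have sm: "smooth ?\<phi>" by (rule smooth_scaleR[OF \<theta>])
    have "smooth_norm N ?\<phi> = smooth_norm N \<theta> / c"
      using c by (simp add: smooth_norm_scaleR[OF \<theta>])
    also have "\<dots> < 1 / real N"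
      using * c \<open>0 < real N\<close> by (simp add: c_def field_simps)
    also have "\<dots> < e" using N F(3) \<open>0 < real N\<close> by (simp add: field_simps)
    finally have "p (?\<phi> - 0) < e" if "p \<in> F" for p
      using N0[OF that NN[OF that] sm] by simp
    then have "\<bar>T ?\<phi>\<bar> < 1" using FT sm by (auto simp: U_def)
    moreover have "\<bar>T ?\<phi>\<bar> = 1" using c by (simp add: hom[OF \<theta>] c_def)
    ultimately show False by simp
  qed
  then have "T \<in> functionals_bounded_by N"
    using lin zero by (simp add: functionals_bounded_by_def)
  then show ?thesis by (rule that)
qed

text \<open>Compactness refers to the product topology on the type of functions, that is, to pointwise
  convergence.  The bounds describe a product of compact intervals, and linearity is a closed condition.\<close>

lemma compact_functionals_bounded_by:
  "compact (functionals_bounded_by N :: (('a::euclidean_space \<Rightarrow> 'b::real_normed_vector) \<Rightarrow> real) set)"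
proof -
  let ?I = "\<lambda>\<theta> :: 'a \<Rightarrow> 'b. if smooth \<theta> then {- (real N * smooth_norm N \<theta>)..real N * smooth_norm N \<theta>} else {0}"
  let ?L = "{T :: ('a \<Rightarrow> 'b) \<Rightarrow> real. linear_functional_on (Collect smooth) T}"
  have "compactin (product_topology (\<lambda>_. euclideanreal) UNIV) (PiE UNIV ?I)"
    by (simp add: compactin_PiE)
  then have "compact (PiE UNIV ?I)" by (simp add: euclidean_product_topology)
  moreover have "closed ?L"
  proof -
    have "?L = (\<Inter>\<theta>\<in>Collect smooth. \<Inter>\<phi>\<in>Collect smooth. {T. T (\<theta> + \<phi>) = T \<theta> + T \<phi>}) \<inter>
        (\<Inter>c. \<Inter>\<theta>\<in>Collect smooth. {T. T (c *\<^sub>R \<theta>) = c * T \<theta>})"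
      by (auto simp: linear_functional_on_def)
    also have "closed \<dots>"
      by (intro closed_Int closed_INT ballI closed_Collect_eq continuous_intros continuous_on_product_coordinates)
    finally show ?thesis .
  qed
  moreover have "functionals_bounded_by N = PiE UNIV ?I \<inter> ?L"
  proof -
    have "T \<in> PiE UNIV ?I \<longleftrightarrow> (\<forall>\<theta>. \<not> smooth \<theta> \<longrightarrow> T \<theta> = 0) \<and> (\<forall>\<theta>. smooth \<theta> \<longrightarrow> \<bar>T \<theta>\<bar> \<le> real N * smooth_norm N \<theta>)" for T
      by (auto simp: PiE_iff abs_le_iff minus_le_iff split: if_splits)
    then show ?thesis by (auto simp: functionals_bounded_by_def)
  qed
  ultimately show ?thesis by (simp add: compact_Int_closed)
qed

text \<open>Two functionals that satisfy the bound and are close on a finite \<open>p\<^sub>N\<close>-net of a bounded set are uniformly close on the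
  whole of it.\<close>

lemma continuous_map_functionals_bounded_by_strong:
  assumes Y: "\<And>M. compact (cball (0 :: 'b::real_normed_vector) M)"
  shows "continuous_map (top_of_set (functionals_bounded_by N)) compact_distributions_b
    (\<lambda>T :: ('a::euclidean_space \<Rightarrow> 'b) \<Rightarrow> real. T)"
  unfolding compact_distributions_b_def strong_topology_def
proof (rule continuous_map_into_seminorm_topology)
  let ?K = "functionals_bounded_by N :: (('a \<Rightarrow> 'b) \<Rightarrow> real) set"
  show "(\<lambda>T. T) \<in> topspace (top_of_set ?K) \<rightarrow> compact_distributions"
    using functionals_bounded_by_subset by auto
  fix T0 :: "('a \<Rightarrow> 'b) \<Rightarrow> real" and p and e :: real
  assume "T0 \<in> topspace (top_of_set ?K)" and e: "0 < e"
    and "p \<in> {(\<lambda>T :: ('a \<Rightarrow> 'b) \<Rightarrow> real. SUP x\<in>S. \<bar>T x\<bar>) | S. von_neumann_bounded smooth_topology S \<and> S \<noteq> {}}"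
  then obtain S where p: "p = (\<lambda>T. SUP x\<in>S. \<bar>T x\<bar>)" and S: "von_neumann_bounded smooth_topology S" "S \<noteq> {}"
    and T0: "T0 \<in> ?K" by auto
  have smS: "smooth \<theta>" if "\<theta> \<in> S" for \<theta>
    using S(1) that by (auto simp: von_neumann_bounded_def)
  define d where "d = e / (4 * (real N + 1))"
  have "d > 0" using e by (simp add: d_def)
  then obtain F where F: "finite F" "F \<subseteq> S" "\<And>\<theta>. \<theta> \<in> S \<Longrightarrow> \<exists>\<phi>\<in>F. smooth_norm N (\<theta> - \<phi>) < d"
    using bounded_imp_totally_bounded_smooth_norm[OF Y S(1)] by metis
  have Nd: "real N * d \<le> e / 4"
    using e by (simp add: d_def field_simps)
  let ?U = "{T. \<forall>\<phi>\<in>F. T (id \<phi>) \<in> ball (T0 \<phi>) (e / 4)}"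
  have "open ?U"
    using product_topology_basis'[OF F(1), of "\<lambda>\<phi>. ball (T0 \<phi>) (e / 4)" id] by simp
  moreover have "T0 \<in> ?U" using e by simp
  moreover have "p (T - T0) < e" if T: "T \<in> ?K" "T \<in> ?U" for T
  proof -
    have near: "\<bar>T' \<theta> - T' \<phi>\<bar> \<le> e / 4" if T': "T' \<in> ?K" and "\<theta> \<in> S" "\<phi> \<in> S" "smooth_norm N (\<theta> - \<phi>) < d" for T' \<theta> \<phi>
    proof -
      have sm: "smooth \<theta>" "smooth \<phi>" using that smS by auto
      have lin: "linear_functional_on (Collect smooth) T'" using T' by (simp add: functionals_bounded_by_def)
      have "\<bar>T' \<theta> - T' \<phi>\<bar> = \<bar>T' (\<theta> - \<phi>)\<bar>"
        using linear_functional_on_diff[OF lin subspace_smooth] sm by simp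
      also have "\<dots> \<le> real N * smooth_norm N (\<theta> - \<phi>)"
        using T' smooth_diff[OF sm] by (simp add: functionals_bounded_by_def)
      also have "\<dots> \<le> real N * d" using that(4) by (intro mult_left_mono) auto
      finally show ?thesis using Nd by simp
    qed
    have "p (T - T0) \<le> 3 * e / 4"
      unfolding p
    proof (rule cSUP_least[OF S(2)])
      fix \<theta> assume \<theta>: "\<theta> \<in> S"
      then obtain \<phi> where \<phi>: "\<phi> \<in> F" "smooth_norm N (\<theta> - \<phi>) < d" using F(3) by blast
      then have "\<phi> \<in> S" using F(2) by blast
      then have "\<bar>T \<theta> - T \<phi>\<bar> \<le> e / 4" "\<bar>T0 \<theta> - T0 \<phi>\<bar> \<le> e / 4"
        using near \<theta> \<phi>(2) T(1) T0 by auto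
      moreover have "\<bar>T0 \<phi> - T \<phi>\<bar> < e / 4" using T(2) \<phi>(1) by (simp add: dist_real_def)
      ultimately have "\<bar>T \<theta> - T0 \<theta>\<bar> \<le> 3 * e / 4" by linarith
      then show "\<bar>(T - T0) \<theta>\<bar> \<le> 3 * e / 4" by simp
    qed
    then show ?thesis using e by simp
  qed
  ultimately show "\<exists>U. openin (top_of_set ?K) U \<and> T0 \<in> U \<and> (\<forall>T\<in>U. p (T - T0) < e)"
    using T0 by (intro exI[of _ "?K \<inter> ?U"]) (auto intro!: openin_open_Int)
qed

lemma compact_distributions_sigma_compact:
  assumes Y: "\<And>M. compact (cball (0 :: 'b::real_normed_vector) M)"
  shows "compactin compact_distributions_b (functionals_bounded_by N :: (('a::euclidean_space \<Rightarrow> 'b) \<Rightarrow> real) set)"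
    and "(\<Union>N. functionals_bounded_by N) = (compact_distributions :: (('a \<Rightarrow> 'b) \<Rightarrow> real) set)"
proof -
  have "compactin (top_of_set (functionals_bounded_by N)) (functionals_bounded_by N :: (('a \<Rightarrow> 'b) \<Rightarrow> real) set)"
    using compact_functionals_bounded_by by (simp add: compactin_subtopology)
  from image_compactin[OF this continuous_map_functionals_bounded_by_strong[OF Y]]
  show "compactin compact_distributions_b (functionals_bounded_by N :: (('a \<Rightarrow> 'b) \<Rightarrow> real) set)" by simp
  show "(\<Union>N. functionals_bounded_by N) = (compact_distributions :: (('a \<Rightarrow> 'b) \<Rightarrow> real) set)"
  proof (intro subset_antisym UN_least functionals_bounded_by_subset subsetI)
    fix T :: "('a \<Rightarrow> 'b) \<Rightarrow> real" assume "T \<in> compact_distributions"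
    then obtain N where "T \<in> functionals_bounded_by N" by (rule compact_distribution_bounded_by)
    then show "T \<in> (\<Union>N. functionals_bounded_by N)" by (rule UN_I[OF UNIV_I])
  qed
qed

section \<open>Suprema of continuous functions depending on a scale\<close>

lemma eventually_at_right_0_iff:
  fixes Q :: "real \<Rightarrow> bool"
  shows "eventually Q (at_right 0) \<longleftrightarrow> (\<exists>N::nat. \<forall>r. 0 < r \<and> r < 1 / (real N + 1) \<longrightarrow> Q r)"
proof
  assume "eventually Q (at_right 0)"
  then obtain b where b: "b > 0" "\<And>y. 0 < y \<Longrightarrow> y < b \<Longrightarrow> Q y"
    by (auto simp: eventually_at_right_field)
  obtain N :: nat where "1 / (real N + 1) < b"
    using reals_Archimedean[OF b(1)] by (auto simp: inverse_eq_divide add.commute)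
  then show "\<exists>N::nat. \<forall>r. 0 < r \<and> r < 1 / (real N + 1) \<longrightarrow> Q r"
    using b(2) by (meson less_trans)
next
  assume "\<exists>N::nat. \<forall>r. 0 < r \<and> r < 1 / (real N + 1) \<longrightarrow> Q r"
  then obtain N :: nat where N: "\<And>r. 0 < r \<Longrightarrow> r < 1 / (real N + 1) \<Longrightarrow> Q r" by blast
  show "eventually Q (at_right 0)"
    unfolding eventually_at_right_field
    by (rule exI[of _ "1 / (real N + 1)"]) (simp add: N)
qed

lemma Limsup_less_infinity_iff:
  fixes f :: "real \<Rightarrow> ereal"
  assumes "F \<noteq> bot"
  shows "Limsup F f < \<infinity> \<longleftrightarrow> (\<exists>M::nat. eventually (\<lambda>r. f r \<le> ereal (real M)) F)"
proof
  assume "Limsup F f < \<infinity>"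
  then obtain M :: nat where "Limsup F f < ereal (real M)"
    using less_PInf_Ex_of_nat[of "Limsup F f"] by auto
  then show "\<exists>M::nat. eventually (\<lambda>r. f r \<le> ereal (real M)) F"
    by (intro exI[of _ M] eventually_mono[OF Limsup_lessD]) auto
next
  assume "\<exists>M::nat. eventually (\<lambda>r. f r \<le> ereal (real M)) F"
  then obtain M :: nat where "Limsup F f \<le> ereal (real M)"
    using Limsup_bounded by blast
  then show "Limsup F f < \<infinity>" by (rule le_less_trans) simp
qed

lemma tendsto_0_iff_le_inverse:
  fixes f :: "'a \<Rightarrow> ereal"
  assumes "eventually (\<lambda>r. 0 \<le> f r) F"
  shows "(f \<longlongrightarrow> 0) F \<longleftrightarrow> (\<forall>m::nat. eventually (\<lambda>r. f r \<le> ereal (1 / (real m + 1))) F)"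
proof
  assume f: "(f \<longlongrightarrow> 0) F"
  show "\<forall>m::nat. eventually (\<lambda>r. f r \<le> ereal (1 / (real m + 1))) F"
  proof
    fix m :: nat
    have "eventually (\<lambda>r. f r < ereal (1 / (real m + 1))) F"
      by (rule order_tendstoD(2)[OF f]) (simp add: add_nonneg_pos)
    then show "eventually (\<lambda>r. f r \<le> ereal (1 / (real m + 1))) F"
      by (rule eventually_mono) auto
  qed
next
  assume f: "\<forall>m::nat. eventually (\<lambda>r. f r \<le> ereal (1 / (real m + 1))) F"
  show "(f \<longlongrightarrow> 0) F"
  proof (rule order_tendstoI)
    fix a :: ereal assume "a < 0"
    then show "eventually (\<lambda>r. a < f r) F"
      using assms by (auto elim: eventually_mono)
  next
    fix a :: ereal assume "0 < a"
    then obtain b where b: "0 < b" "ereal b < a"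
      using ereal_dense2[of 0 a] by auto
    obtain m :: nat where "1 / (real m + 1) < b"
      using reals_Archimedean[OF b(1)] by (auto simp: inverse_eq_divide add.commute)
    then have m: "ereal (1 / (real m + 1)) < a" using b(2) by (meson ereal_less_eq(3) le_less_trans less_imp_le)
    show "eventually (\<lambda>r. f r < a) F"
      using f by (rule allE[of _ m]) (auto elim!: eventually_mono intro: le_less_trans m)
  qed
qed

lemma borel_sets_of_closed: "closedin X S \<Longrightarrow> S \<in> borel_sets_of X"
  unfolding borel_sets_of_def closedin_def
  using sigma_sets.Compl[OF sigma_sets.Basic, of "topspace X - S" "{U. openin X U}" "topspace X"]
  by (auto simp: double_diff)

lemma borel_sets_of_countable_INT:
  assumes "\<And>i::nat. A i \<in> borel_sets_of X"
  shows "(\<Inter>i. A i) \<in> borel_sets_of X"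
  using assms unfolding borel_sets_of_def
  by (intro sigma_sets_INTER) (auto dest: openin_subset)

lemma borel_sets_of_countable_UN:
  assumes "\<And>i::nat. A i \<in> borel_sets_of X"
  shows "(\<Union>i. A i) \<in> borel_sets_of X"
  using assms unfolding borel_sets_of_def by (rule sigma_sets.Union)

lemma countable_union_of_UN:
  assumes "countable I" "\<And>i. i \<in> I \<Longrightarrow> P (A i)"
  shows "(countable union_of P) (\<Union>i\<in>I. A i)"
  unfolding union_of_def using assms by (intro exI[of _ "A ` I"]) auto

lemma fsigma_in_sigma_compact:
  assumes E: "fsigma_in X E" and C: "countable \<C>" "\<And>C. C \<in> \<C> \<Longrightarrow> compactin X C" "topspace X \<subseteq> \<Union>\<C>"
  shows "(countable union_of compactin X) E"
proof -
  obtain \<U> where U: "countable \<U>" "\<U> \<subseteq> Collect (closedin X)" "\<Union>\<U> = E"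
    using E unfolding fsigma_in_def union_of_def by blast
  have "(countable union_of compactin X) (\<Union>(U, C)\<in>\<U> \<times> \<C>. U \<inter> C)"
    using U C by (intro countable_union_of_UN) (auto intro: closed_Int_compactin)
  moreover have "(\<Union>(U, C)\<in>\<U> \<times> \<C>. U \<inter> C) = \<Union>\<U> \<inter> \<Union>\<C>" by auto
  moreover have "\<Union>\<U> \<inter> \<Union>\<C> = E"
    using U(3) C(3) fsigma_in_subset[OF E] by blast
  ultimately show ?thesis by simp
qed

text \<open>The supremum over \<open>\<theta>\<close> of the continuous functions \<open>G r \<theta>\<close> is only lower semicontinuous, which suffices
  for its sublevel sets to be closed.  That some \<open>G r \<theta>\<close> vanishes at each point makes the supremum
  nonnegative, so that its convergence to zero is a condition on upper bounds alone.\<close>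

locale scaled_family =
  fixes X :: "'z topology" and G :: "real \<Rightarrow> 'i \<Rightarrow> 'z \<Rightarrow> real" and \<Theta> :: "'i set" and w :: "real \<Rightarrow> real"
  assumes cont: "\<And>r \<theta>. 0 < r \<Longrightarrow> \<theta> \<in> \<Theta> \<Longrightarrow> continuous_map X euclideanreal (G r \<theta>)"
    and vanishing: "\<And>r z. 0 < r \<Longrightarrow> z \<in> topspace X \<Longrightarrow> \<exists>\<theta>\<in>\<Theta>. G r \<theta> z = 0"
    and w_pos: "\<And>r. 0 < r \<Longrightarrow> 0 < w r"
begin

definition scaled_sup :: "'z \<Rightarrow> real \<Rightarrow> ereal"
  where "scaled_sup z r = ereal (w r) * (SUP \<theta>\<in>\<Theta>. ereal (G r \<theta> z))"

definition bounded_below_scale :: "real \<Rightarrow> nat \<Rightarrow> 'z set"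
  where "bounded_below_scale c N =
    {z \<in> topspace X. \<forall>r. 0 < r \<and> r < 1 / (real N + 1) \<longrightarrow> scaled_sup z r \<le> ereal c}"

lemma scaled_sup_le_iff:
  assumes "0 < r"
  shows "scaled_sup z r \<le> ereal c \<longleftrightarrow> (\<forall>\<theta>\<in>\<Theta>. w r * G r \<theta> z \<le> c)"
proof -
  have "scaled_sup z r \<le> ereal c \<longleftrightarrow> (SUP \<theta>\<in>\<Theta>. ereal (G r \<theta> z)) \<le> ereal c / ereal (w r)"
    unfolding scaled_sup_def using w_pos[OF assms]
    by (subst ereal_le_divide_pos) (simp_all del: ereal_divide)
  also have "\<dots> \<longleftrightarrow> (\<forall>\<theta>\<in>\<Theta>. w r * G r \<theta> z \<le> c)"
    using w_pos[OF assms] by (simp add: SUP_le_iff field_simps)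
  finally show ?thesis .
qed

lemma scaled_sup_nonneg:
  assumes "0 < r" "z \<in> topspace X"
  shows "0 \<le> scaled_sup z r"
proof -
  obtain \<theta> where "\<theta> \<in> \<Theta>" "G r \<theta> z = 0" using vanishing[OF assms] by blast
  then have "ereal 0 \<le> (SUP \<theta>\<in>\<Theta>. ereal (G r \<theta> z))" by (intro SUP_upper2[of \<theta>]) auto
  then show ?thesis
    unfolding scaled_sup_def using w_pos[OF assms(1)] by (simp add: zero_ereal_def[symmetric])
qed

lemma closedin_bounded_below_scale: "closedin X (bounded_below_scale c N)"
proof -
  let ?A = "\<lambda>r \<theta>. {z \<in> topspace X. w r * G r \<theta> z \<in> {..c}}"
  have "closedin X (?A r \<theta>)" if "0 < r" "\<theta> \<in> \<Theta>" for r \<theta>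
    by (intro closedin_continuous_map_preimage[of _ euclideanreal] continuous_map_real_mult_left cont that) simp
  then have "closedin X (topspace X \<inter> \<Inter>{?A r \<theta> | r \<theta>. 0 < r \<and> r < 1 / (real N + 1) \<and> \<theta> \<in> \<Theta>})"
    by (subst Inter_insert[symmetric]) (intro closedin_Inter, auto)
  moreover have "bounded_below_scale c N
      = topspace X \<inter> \<Inter>{?A r \<theta> | r \<theta>. 0 < r \<and> r < 1 / (real N + 1) \<and> \<theta> \<in> \<Theta>}"
    unfolding bounded_below_scale_def by (auto simp: scaled_sup_le_iff)
  ultimately show ?thesis by simp
qed

lemma Limsup_finite_eq:
  "{z \<in> topspace X. Limsup (at_right 0) (scaled_sup z) < \<infinity>} = (\<Union>(M, N)\<in>UNIV. bounded_below_scale (real M) N)"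
  unfolding Limsup_less_infinity_iff[OF trivial_limit_at_right_real] eventually_at_right_0_iff
  by (auto simp: bounded_below_scale_def)

lemma fsigma_Limsup_finite: "fsigma_in X {z \<in> topspace X. Limsup (at_right 0) (scaled_sup z) < \<infinity>}"
  unfolding Limsup_finite_eq fsigma_in_def
  by (intro countable_union_of_UN) (auto simp: closedin_bounded_below_scale)

lemma borel_tendsto_0: "{z \<in> topspace X. (scaled_sup z \<longlongrightarrow> 0) (at_right 0)} \<in> borel_sets_of X"
proof -
  have "{z \<in> topspace X. (scaled_sup z \<longlongrightarrow> 0) (at_right 0)}
      = (\<Inter>m. \<Union>N. bounded_below_scale (1 / (real m + 1)) N)"
  proof -
    have "eventually (\<lambda>r. 0 \<le> scaled_sup z r) (at_right 0)" if "z \<in> topspace X" for z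
      using scaled_sup_nonneg[OF _ that] by (auto simp: eventually_at_right_field intro: exI[of _ 1])
    then show ?thesis
      by (auto simp: tendsto_0_iff_le_inverse eventually_at_right_0_iff bounded_below_scale_def)
  qed
  then show ?thesis
    by (simp only:) (intro borel_sets_of_countable_INT borel_sets_of_countable_UN borel_sets_of_closed
        closedin_bounded_below_scale)
qed

end

section \<open>Sets of distributions described by the growth of rescalings\<close>

lemma topspace_compact_distributions_b [simp]: "topspace compact_distributions_b = compact_distributions"
  and topspace_distributions_b [simp]: "topspace distributions_b = distributions"
  and topspace_poly_topology [simp]: "topspace (poly_topology k) = poly_functions k"
  by (simp_all add: compact_distributions_b_def distributions_b_def poly_topology_def strong_topology_def)

lemma continuous_map_rescale:
  fixes t :: "'t \<Rightarrow> (real^'n \<Rightarrow> 'y::banach) \<Rightarrow> real"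
  assumes t: "continuous_map (prod_topology euclidean \<tau>) euclideanreal (\<lambda>(a, T). t T (\<lambda>x. \<theta> ((x - a) /\<^sub>R r)))"
    and \<theta>: "\<theta> \<in> test_functions_in (cball 0 1)" and r: "r > 0"
  shows "continuous_map (prod_topology euclidean (prod_topology \<tau> (poly_topology k))) euclideanreal
    (\<lambda>(a, T, P). rescale (t T - poly_distribution P) a r \<theta>)"
proof -
  let ?X = "prod_topology (euclidean :: (real^'n) topology) (prod_topology \<tau> (poly_topology k :: (real^'n \<Rightarrow> 'y \<Rightarrow>\<^sub>L real) topology))"
  have fst: "continuous_map ?X euclidean fst"
    and fst_snd: "continuous_map ?X \<tau> (\<lambda>z. fst (snd z))"
    and snd_snd: "continuous_map ?X (poly_topology k) (\<lambda>z. snd (snd z))"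
    using continuous_map_compose[OF continuous_map_snd continuous_map_fst]
      continuous_map_compose[OF continuous_map_snd continuous_map_snd]
    by (auto simp: o_def continuous_map_fst)
  have T: "continuous_map ?X euclideanreal (\<lambda>z. t (fst (snd z)) (\<lambda>x. \<theta> ((x - fst z) /\<^sub>R r)))"
    using continuous_map_compose[OF continuous_map_pairedI[OF fst fst_snd] t] by (simp add: o_def)
  have P: "continuous_map ?X euclideanreal (\<lambda>z. poly_distribution (snd (snd z)) (\<lambda>x. \<theta> ((x - fst z) /\<^sub>R r)))"
    using continuous_map_compose[OF continuous_map_pairedI[OF fst snd_snd]
        continuous_map_poly_distribution_affine[OF \<theta> r]] by (simp add: o_def)
  have "continuous_map ?X euclideanreal (\<lambda>z. (1 / r ^ CARD('n)) * (t (fst (snd z)) (\<lambda>x. \<theta> ((x - fst z) /\<^sub>R r))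
      - poly_distribution (snd (snd z)) (\<lambda>x. \<theta> ((x - fst z) /\<^sub>R r))))"
    by (intro continuous_map_real_mult_left continuous_map_diff T P)
  then show ?thesis
    by (simp add: rescale_def case_prod_unfold)
qed

lemma linear_functional_on_at_0:
  assumes "linear_functional_on V T" "subspace V"
  shows "T 0 = 0"
  using linear_functional_on_diff[OF assms subspace_0[OF assms(2)] subspace_0[OF assms(2)]] by simp

lemma poly_distribution_0: "poly_distribution P 0 = 0"
  by (simp add: poly_distribution_def to_distribution_def)

lemma rescale_0:
  assumes "S 0 = 0"
  shows "rescale S a r 0 = 0"
  using assms by (simp add: rescale_def zero_fun_def)

lemma scaled_family_rescale:
  fixes t :: "'t \<Rightarrow> (real^'n \<Rightarrow> 'y::banach) \<Rightarrow> real"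
  assumes \<nu>: "seminorm_on (test_functions_in (cball 0 1)) \<nu>"
    and t0: "\<And>T. T \<in> topspace \<tau> \<Longrightarrow> t T 0 = 0"
    and t: "\<And>\<theta> r. \<theta> \<in> test_functions_in (cball 0 1) \<Longrightarrow> r > 0 \<Longrightarrow>
      continuous_map (prod_topology euclidean \<tau>) euclideanreal (\<lambda>(a, T). t T (\<lambda>x. \<theta> ((x - a) /\<^sub>R r)))"
  shows "scaled_family (prod_topology euclidean (prod_topology \<tau> (poly_topology k)))
    (\<lambda>r \<theta> (a, T, P). rescale (t T - poly_distribution P) a r \<theta>)
    {\<theta> \<in> test_functions_in (cball 0 1). \<nu> \<theta> \<le> 1} (\<lambda>r. r powr \<kappa>)"
proof
  fix r :: real assume r: "0 < r"
  show "0 < r powr \<kappa>" using r by simp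
  show "continuous_map (prod_topology euclidean (prod_topology \<tau> (poly_topology k))) euclideanreal
      (\<lambda>(a, T, P). rescale (t T - poly_distribution P) a r \<theta>)"
    if "\<theta> \<in> {\<theta> \<in> test_functions_in (cball 0 1). \<nu> \<theta> \<le> 1}" for \<theta>
    using that r by (intro continuous_map_rescale t) auto
  fix z :: "(real^'n) \<times> 't \<times> (real^'n \<Rightarrow> 'y \<Rightarrow>\<^sub>L real)"
  assume z: "z \<in> topspace (prod_topology euclidean (prod_topology \<tau> (poly_topology k)))"
  obtain a T P where zz: "z = (a, T, P)" by (cases z)
  have sub: "subspace (test_functions_in (cball 0 1) :: (real^'n \<Rightarrow> 'y) set)"
    by (rule subspace_test_functions_in) simp
  have "\<nu> 0 = 0" by (rule seminorm_on_0[OF \<nu> sub])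
  moreover have "(t T - poly_distribution P) 0 = 0"
    using t0[of T] z by (simp add: zz poly_distribution_0)
  ultimately show "\<exists>\<theta>\<in>{\<theta> \<in> test_functions_in (cball 0 1). \<nu> \<theta> \<le> 1}.
      (case z of (a, T, P) \<Rightarrow> rescale (t T - poly_distribution P) a r \<theta>) = 0"
    using subspace_0[OF sub] by (intro bexI[of _ 0]) (auto simp: zz rescale_0)
qed

text \<open>Closed balls, the sets \<^const>\<open>functionals_bounded_by\<close> and the images of coordinate cubes exhaust the three
  factors.\<close>

lemma product_sigma_compact:
  fixes X :: "((real^'n) \<times> ((real^'n \<Rightarrow> 'y::banach) \<Rightarrow> real) \<times> (real^'n \<Rightarrow> 'y \<Rightarrow>\<^sub>L real)) topology"
  assumes Y: "finite (B :: 'y set)" "span B = UNIV"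
    and X: "X = prod_topology euclidean (prod_topology compact_distributions_b (poly_topology k))"
  shows "\<exists>\<C>. countable \<C> \<and> (\<forall>C\<in>\<C>. compactin X C) \<and> topspace X \<subseteq> \<Union>\<C>"
proof -
  obtain D :: "('y \<Rightarrow>\<^sub>L real) set" where D: "finite D" "span D = UNIV"
    using finite_span_dual[OF Y] .
  obtain L :: "nat \<Rightarrow> (real^'n \<Rightarrow> 'y \<Rightarrow>\<^sub>L real) set"
    where L: "\<And>n. compactin (poly_topology k) (L n)" "(\<Union>n. L n) = poly_functions k"
    using poly_topology_sigma_compact[where ?'a = "real^'n" and k = k, OF D] by metis
  note K = compact_distributions_sigma_compact[OF compact_cball_finite_span[OF Y]]
  define A where "A = (\<lambda>(i, N, n). cball (0 :: real^'n) (real i) \<times> (functionals_bounded_by N :: ((real^'n \<Rightarrow> 'y) \<Rightarrow> real) set) \<times> L n)"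
  have "compactin X C" if "C \<in> range A" for C
    using that by (auto simp: X A_def compactin_Times L(1) K(1))
  moreover have "topspace X \<subseteq> \<Union>(range A)"
  proof
    fix z assume "z \<in> topspace X"
    then obtain a T P where z: "z = (a, T, P)" "T \<in> compact_distributions" "P \<in> poly_functions k"
      by (cases z) (auto simp: X)
    obtain N n where "T \<in> functionals_bounded_by N" "P \<in> L n"
      using z(2,3) unfolding K(2)[symmetric] L(2)[symmetric] by blast
    moreover obtain i where "norm a \<le> real i" using real_arch_simple by blast
    ultimately have "z \<in> A (i, N, n)" by (simp add: z(1) A_def)
    then show "z \<in> \<Union>(range A)" by blast
  qed
  ultimately show ?thesis by (intro exI[of _ "range A"]) auto
qed

theorem theorem2:
  fixes \<kappa> :: real and k :: int and \<nu> :: "(real^'n \<Rightarrow> 'y::banach) \<Rightarrow> real"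
  assumes "seminorm_on (test_functions_in (cball 0 1)) \<nu>"
    and "continuous_map (test_topology_in (cball 0 1)) euclideanreal \<nu>"
  shows
    "(let X = prod_topology euclidean (prod_topology compact_distributions_b (poly_topology k));
          X' = prod_topology euclidean (prod_topology distributions_b (poly_topology k));
          E = {(a, T, P). T \<in> compact_distributions \<and> P \<in> poly_functions k \<and>
            Limsup (at_right 0)
              (\<lambda>r. ereal (r powr \<kappa>) * rescaled_sup \<nu> a (to_distribution T) P r) < \<infinity>};
          E\<^sub>0 = {(a, T, P). T \<in> compact_distributions \<and> P \<in> poly_functions k \<and>
            ((\<lambda>r. ereal (r powr \<kappa>) * rescaled_sup \<nu> a (to_distribution T) P r) \<longlongrightarrow> 0)
              (at_right 0)};
          D = {(a, T, P). T \<in> distributions \<and> P \<in> poly_functions k \<and>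
            Limsup (at_right 0) (\<lambda>r. ereal (r powr \<kappa>) * rescaled_sup \<nu> a T P r) < \<infinity>};
          D\<^sub>0 = {(a, T, P). T \<in> distributions \<and> P \<in> poly_functions k \<and>
            ((\<lambda>r. ereal (r powr \<kappa>) * rescaled_sup \<nu> a T P r) \<longlongrightarrow> 0) (at_right 0)}
      in fsigma_in X E
       \<and> ((\<exists>B :: 'y set. finite B \<and> span B = UNIV) \<longrightarrow> (countable union_of compactin X) E)
       \<and> E\<^sub>0 \<in> borel_sets_of X
       \<and> fsigma_in X' D
       \<and> D\<^sub>0 \<in> borel_sets_of X')"
proof -
  let ?\<Theta> = "{\<theta> \<in> test_functions_in (cball 0 1). \<nu> \<theta> \<le> 1}"
  let ?w = "\<lambda>r :: real. r powr \<kappa>"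
  define X :: "((real^'n) \<times> ((real^'n \<Rightarrow> 'y) \<Rightarrow> real) \<times> (real^'n \<Rightarrow> 'y \<Rightarrow>\<^sub>L real)) topology"
    where "X = prod_topology euclidean (prod_topology compact_distributions_b (poly_topology k))"
  define X' :: "((real^'n) \<times> ((real^'n \<Rightarrow> 'y) \<Rightarrow> real) \<times> (real^'n \<Rightarrow> 'y \<Rightarrow>\<^sub>L real)) topology"
    where "X' = prod_topology euclidean (prod_topology distributions_b (poly_topology k))"
  have topX: "topspace X = UNIV \<times> compact_distributions \<times> poly_functions k"
    and topX': "topspace X' = UNIV \<times> distributions \<times> poly_functions k"
    by (simp_all add: X_def X'_def)
  interpret E: scaled_family X "\<lambda>r \<theta> (a, T, P). rescale (to_distribution T - poly_distribution P) a r \<theta>" ?\<Theta> ?w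
    unfolding X_def
  proof (rule scaled_family_rescale[OF assms(1)])
    fix T :: "(real^'n \<Rightarrow> 'y) \<Rightarrow> real" assume "T \<in> topspace compact_distributions_b"
    then have "linear_functional_on (Collect smooth) T" by (simp add: compact_distributions_def)
    then have "T 0 = 0" by (rule linear_functional_on_at_0[OF _ subspace_smooth])
    then show "to_distribution T 0 = 0" by (simp add: to_distribution_def)
  next
    fix \<theta> :: "real^'n \<Rightarrow> 'y" and r :: real assume \<theta>: "\<theta> \<in> test_functions_in (cball 0 1)" "0 < r"
    have "smooth \<theta>" using \<theta>(1) by (simp add: test_functions_in_def)
    then show "continuous_map (prod_topology euclidean compact_distributions_b) euclideanreal
        (\<lambda>(a, T). to_distribution T (\<lambda>x. \<theta> ((x - a) /\<^sub>R r)))"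
      using continuous_map_compact_distributions_affine affine_mem_test_functions[OF \<theta>]
      by (simp add: to_distribution_def)
  qed
  interpret D: scaled_family X' "\<lambda>r \<theta> (a, T, P). rescale (T - poly_distribution P) a r \<theta>" ?\<Theta> ?w
    unfolding X'_def
  proof (rule scaled_family_rescale[OF assms(1)])
    fix T :: "(real^'n \<Rightarrow> 'y) \<Rightarrow> real" assume "T \<in> topspace distributions_b"
    then have "linear_functional_on test_functions T" by (simp add: distributions_def)
    then show "T 0 = 0"
      by (rule linear_functional_on_at_0[OF _ subspace_test_functions])
  qed (rule continuous_map_distributions_affine)
  have E_sup: "E.scaled_sup (a, T, P) = (\<lambda>r. ereal (r powr \<kappa>) * rescaled_sup \<nu> a (to_distribution T) P r)" for a T P
    by (simp add: E.scaled_sup_def rescaled_sup_def fun_eq_iff)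
  have D_sup: "D.scaled_sup (a, T, P) = (\<lambda>r. ereal (r powr \<kappa>) * rescaled_sup \<nu> a T P r)" for a T P
    by (simp add: D.scaled_sup_def rescaled_sup_def fun_eq_iff)
  have "{(a, T, P). T \<in> compact_distributions \<and> P \<in> poly_functions k \<and>
        Limsup (at_right 0) (\<lambda>r. ereal (r powr \<kappa>) * rescaled_sup \<nu> a (to_distribution T) P r) < \<infinity>}
      = {z \<in> topspace X. Limsup (at_right 0) (E.scaled_sup z) < \<infinity>}"
    and "{(a, T, P). T \<in> compact_distributions \<and> P \<in> poly_functions k \<and>
        ((\<lambda>r. ereal (r powr \<kappa>) * rescaled_sup \<nu> a (to_distribution T) P r) \<longlongrightarrow> 0) (at_right 0)}
      = {z \<in> topspace X. (E.scaled_sup z \<longlongrightarrow> 0) (at_right 0)}"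
    and "{(a, T, P). T \<in> distributions \<and> P \<in> poly_functions k \<and>
        Limsup (at_right 0) (\<lambda>r. ereal (r powr \<kappa>) * rescaled_sup \<nu> a T P r) < \<infinity>}
      = {z \<in> topspace X'. Limsup (at_right 0) (D.scaled_sup z) < \<infinity>}"
    and "{(a, T, P). T \<in> distributions \<and> P \<in> poly_functions k \<and>
        ((\<lambda>r. ereal (r powr \<kappa>) * rescaled_sup \<nu> a T P r) \<longlongrightarrow> 0) (at_right 0)}
      = {z \<in> topspace X'. (D.scaled_sup z \<longlongrightarrow> 0) (at_right 0)}"
    unfolding topX topX' by (auto simp: E_sup D_sup)
  note sets = this
  have sigma_compact: "(countable union_of compactin X) {z \<in> topspace X. Limsup (at_right 0) (E.scaled_sup z) < \<infinity>}"
    if findim: "\<exists>B :: 'y set. finite B \<and> span B = UNIV"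
  proof -
    obtain B :: "'y set" where B: "finite B" "span B = UNIV" using findim by blast
    obtain \<C> where "countable \<C>" "\<forall>C\<in>\<C>. compactin X C" "topspace X \<subseteq> \<Union>\<C>"
      using product_sigma_compact[OF B X_def] by (elim exE conjE)
    then show ?thesis by (intro fsigma_in_sigma_compact[OF E.fsigma_Limsup_finite]) auto
  qed
  show ?thesis
    unfolding Let_def X_def[symmetric] X'_def[symmetric] sets
    by (intro conjI impI sigma_compact E.fsigma_Limsup_finite E.borel_tendsto_0
        D.fsigma_Limsup_finite D.borel_tendsto_0)
qed

end
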